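(* Every $5$-oriented Spherical Diagram with alignment $(2,3,3,3,3)$ has at least five swirls. Moreover, there exist $5$-oriented SDs with alignment $(2,3,3,3,3)$ having exactly five swirls and eight arcs, and $5$-oriented Spherical Occlusion Diagrams with alignment $(2,3,3,3,3)$ having exactly five swirls and nine arcs.
   Context: A geodesic arc on the unit sphere in $\mathbb R^3$ is the unique shortest curve joining two non-antipodal points. An arc $a$ blocks an arc $b$ (equivalently, $b$ hits $a$) if an endpoint of $b$ lies in the relative interior of $a$. A Spherical Diagram (SD) is a finite non-empty collection $\mathcal D$ of pairwise interior-disjoint geodesic arcs on the unit sphere such that each arc of $\mathcal D$ is blocked by arcs of $\mathcal D$ at each of its endpoints. A Spherical Occlusion Diagram (SOD) is an SD such that all arcs of $\mathcal D$ that hit the same arc of $\mathcal D$ reach it from the same side. A swirl of an SD is a cycle of arcs, each of which hits the next (and the last hits the first), going either all clockwise or all counterclockwise. An SD $\mathcal D$ is $k$-oriented if there exist a set $P$ of $k$ points on the unit sphere (poles), no two antipodal, and a function $f\colon\mathcal D\to P$ such that each arc $a\in\mathcal D$ lies on a great circle through $f(a)$ but contains neither $f(a)$ nor its antipode $-f(a)$. A $k$-oriented SD with poles $p_1,\dots,p_k$ has alignment $(d_1,\dots,d_k)$ (listed in nondecreasing order) if, for each $i$, there are exactly $d_i$ distinct great circles containing $p_i$ and at least one other pole. *)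

theory Defs
  imports "HOL-Analysis.Analysis" "HOL-Library.Multiset"
begin

type_synonym point = "real^3"
(* an arc is represented by its ordered pair of endpoints *)
type_synonym arc = "point \<times> point"

definition on_sphere :: "point \<Rightarrow> bool" where
  "on_sphere x \<longleftrightarrow> norm x = 1"

definition det3 :: "point \<Rightarrow> point \<Rightarrow> point \<Rightarrow> real" where
  "det3 u v w = cross3 u v \<bullet> w"

definition valid_arc :: "arc \<Rightarrow> bool" where
  "valid_arc a \<longleftrightarrow> on_sphere (fst a) \<and> on_sphere (snd a) \<and> fst a \<noteq> snd a \<and> fst a \<noteq> - snd a"

definition arc_points :: "arc \<Rightarrow> point set" where
  "arc_points a = {x. \<exists>t\<in>{0..1}. x = sgn ((1 - t) *\<^sub>R fst a + t *\<^sub>R snd a)}"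

definition arc_relint :: "arc \<Rightarrow> point set" where
  "arc_relint a = {x. \<exists>t\<in>{0<..<1}. x = sgn ((1 - t) *\<^sub>R fst a + t *\<^sub>R snd a)}"

definition hits :: "arc \<Rightarrow> arc \<Rightarrow> bool" where
  "hits b a \<longleftrightarrow> fst b \<in> arc_relint a \<or> snd b \<in> arc_relint a"

definition is_SD :: "arc set \<Rightarrow> bool" where
  "is_SD D \<longleftrightarrow> finite D \<and> D \<noteq> {} \<and> (\<forall>a\<in>D. valid_arc a)
     \<and> (\<forall>a\<in>D. \<forall>b\<in>D. a \<noteq> b \<longrightarrow> arc_relint a \<inter> arc_relint b = {})
     \<and> (\<forall>a\<in>D. (\<exists>b\<in>D. fst a \<in> arc_relint b) \<and> (\<exists>b\<in>D. snd a \<in> arc_relint b))"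

definition is_SOD :: "arc set \<Rightarrow> bool" where
  "is_SOD D \<longleftrightarrow> is_SD D \<and>
     (\<forall>a\<in>D. (\<forall>b\<in>D. hits b a \<longrightarrow> arc_points b \<subseteq> {x. det3 (fst a) (snd a) x \<ge> 0})
           \<or> (\<forall>b\<in>D. hits b a \<longrightarrow> arc_points b \<subseteq> {x. det3 (fst a) (snd a) x \<le> 0}))"

(* a swirl as a list of distinct arcs: arc i is traversed from s i to e i, e i lies in the
   relative interior of the next arc, and all turns have the same orientation *)
definition is_swirl :: "arc set \<Rightarrow> arc list \<Rightarrow> bool" where
  "is_swirl D xs \<longleftrightarrow> xs \<noteq> [] \<and> distinct xs \<and> set xs \<subseteq> D \<and>
     (\<exists>s e :: nat \<Rightarrow> point.
        (\<forall>i<length xs. xs ! i = (s i, e i) \<or> xs ! i = (e i, s i)) \<and>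
        (\<forall>i<length xs. e i \<in> arc_relint (xs ! ((i + 1) mod length xs))) \<and>
        ((\<forall>i<length xs. det3 (s i) (e i) (e ((i + 1) mod length xs)) > 0) \<or>
         (\<forall>i<length xs. det3 (s i) (e i) (e ((i + 1) mod length xs)) < 0)))"

(* swirls are cycles, i.e. lists up to cyclic rotation *)
definition swirls :: "arc set \<Rightarrow> arc list set set" where
  "swirls D = {{rotate n xs | n. True} | xs. is_swirl D xs}"

definition num_swirls :: "arc set \<Rightarrow> nat" where
  "num_swirls D = card (swirls D)"

definition oriented :: "nat \<Rightarrow> arc set \<Rightarrow> point set \<Rightarrow> (arc \<Rightarrow> point) \<Rightarrow> bool" where
  "oriented k D P f \<longleftrightarrow> finite P \<and> card P = k \<and> (\<forall>p\<in>P. on_sphere p)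
     \<and> (\<forall>p\<in>P. \<forall>q\<in>P. q \<noteq> - p)
     \<and> (\<forall>a\<in>D. f a \<in> P \<and> det3 (fst a) (snd a) (f a) = 0
              \<and> f a \<notin> arc_points a \<and> - f a \<notin> arc_points a)"

definition great_circle_through :: "point \<Rightarrow> point \<Rightarrow> point set" where
  "great_circle_through p q = {x. on_sphere x \<and> cross3 p q \<bullet> x = 0}"

definition align_deg :: "point set \<Rightarrow> point \<Rightarrow> nat" where
  "align_deg P p = card (great_circle_through p ` (P - {p}))"

(* alignment as the multiset of the d_i (equivalently the nondecreasing list) *)
definition alignment :: "point set \<Rightarrow> nat multiset" where
  "alignment P = image_mset (align_deg P) (mset_set P)"

end

theory Submission
  imports Defs
begin

text \<open>
  The pole configuration is projectively unique: a quadrilateral \<open>A\<^sub>1 B\<^sub>1 A\<^sub>2 B\<^sub>2\<close> together with the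
  intersection \<open>p\<close> of its diagonals. Choose a sign for every pole so that the signed poles lie in an
  open hemisphere, and let \<open>K\<close> be the convex cone they span. Walking along arcs, always towards the
  signed pole, never leaves \<open>K\<close> and yields a closed walk in \<open>K\<close>. Its winding number is nonzero
  somewhere, say positive; a walk that always turns left keeps on its left side a winding number that
  never decreases, so it is trapped in \<open>K\<close> and ends in a swirl. Hence every such cone \<open>K\<close> contains
  a swirl.

  Apply this to the quadrilateral cone \<open>Q\<close> and to eight triangular cones, two in each of the four
  lunes cut out by the diagonals. The four cones on one side have disjoint interiors and give four
  swirls. If the swirl in \<open>Q\<close> is one of them, then the other triangular cone in its lune, whose interior
  is disjoint from \<open>Q\<close>, provides a fifth one.

  The two examples have integer coordinates before normalisation, so their properties reduce to
  sign conditions on integer determinants.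
\<close>

section \<open>Cones over arcs\<close>


text \<open>The winding number is never defined as such: it is a count of signed crossings with the
  ray that continues an arc, so every step becomes a sign condition on determinants. Arcs may share
  endpoints, and the closed walk may run along the very arc being followed, so the delicate
  crossings are those through the corner itself; hence the ray is shifted to the left and comes with
  and without its origin. All counting takes place in an open hemisphere \<open>h > 0\<close>, where
  central projection makes the picture planar. A nonzero count comes from a vertex of the convex
  hull of the projected walk: there a single turn forces the count, and the sense of that turn
  selects the orientation \<open>t\<close>. A walk that always turns left must repeat a directed
  arc, but a swirl needs distinct undirected arcs; excluding cycles that use an arc in both
  directions is the main extra work. Cones that share boundary points still give different swirls,
  because a swirl whose corners all lie in one plane through the origin could not turn.\<close>

lemma det3_expand:
  "det3 u v w = u$1 * (v$2 * w$3 - v$3 * w$2) + u$2 * (v$3 * w$1 - v$1 * w$3) + u$3 * (v$1 * w$2 - v$2 * w$1)"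
  by (simp add: det3_def cross3_def inner_vec_def sum_3 algebra_simps)

text \<open>No normalisation: for a valid arc and a unit vector, membership agrees with
  \<open>arc_relint\<close>, and incidences become linear algebra.\<close>

definition ocone :: "arc \<Rightarrow> point set" where
  "ocone a = {x. \<exists>\<alpha> \<beta>. \<alpha> > 0 \<and> \<beta> > 0 \<and> x = \<alpha> *\<^sub>R fst a + \<beta> *\<^sub>R snd a}"

lemma oconeI: "\<alpha> > 0 \<Longrightarrow> \<beta> > 0 \<Longrightarrow> \<alpha> *\<^sub>R fst a + \<beta> *\<^sub>R snd a \<in> ocone a"
  by (auto simp: ocone_def)

lemma ocone_swap [simp]: "ocone (prod.swap a) = ocone a"
proof -
  have *: "ocone (prod.swap b) \<subseteq> ocone b" for b
    by (auto simp: ocone_def) (metis add.commute)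
  show ?thesis using *[of a] *[of "prod.swap a"] by auto
qed

lemma ocone_add:
  assumes "u \<in> ocone d" "x > 0" "y \<ge> 0"
  shows "x *\<^sub>R u + y *\<^sub>R snd d \<in> ocone d"
proof -
  obtain \<alpha> \<beta> where ab: "\<alpha> > 0" "\<beta> > 0" "u = \<alpha> *\<^sub>R fst d + \<beta> *\<^sub>R snd d" using assms(1) by (auto simp: ocone_def)
  have "x *\<^sub>R u + y *\<^sub>R snd d = (x * \<alpha>) *\<^sub>R fst d + (x * \<beta> + y) *\<^sub>R snd d"
    by (simp add: ab(3) algebra_simps)
  moreover have "x * \<alpha> > 0" "x * \<beta> + y > 0" using ab assms by (auto intro: add_pos_nonneg)
  ultimately show ?thesis using oconeI by metis
qed

lemma relint_imp_ocone:
  assumes "valid_arc a" "x \<in> arc_relint a"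
  shows "x \<in> ocone a"
proof -
  obtain t where t: "0 < t" "t < 1" "x = sgn ((1 - t) *\<^sub>R fst a + t *\<^sub>R snd a)"
    using assms(2) by (auto simp: arc_relint_def)
  let ?y = "(1 - t) *\<^sub>R fst a + t *\<^sub>R snd a"
  have "?y \<noteq> 0"
  proof
    assume "?y = 0"
    then have eq: "(1 - t) *\<^sub>R fst a = - (t *\<^sub>R snd a)" by (simp add: eq_neg_iff_add_eq_0)
    then have "norm ((1 - t) *\<^sub>R fst a) = norm (t *\<^sub>R snd a)" by simp
    then have "1 - t = t" using t assms(1) by (simp add: valid_arc_def on_sphere_def)
    with eq t have "fst a = - snd a" by (metis scaleR_cancel_left scaleR_minus_right less_irrefl)
    then show False using assms(1) by (simp add: valid_arc_def)
  qed
  then have "x = (inverse (norm ?y) * (1 - t)) *\<^sub>R fst a + (inverse (norm ?y) * t) *\<^sub>R snd a"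
    using t(3) by (simp add: sgn_div_norm scaleR_add_right)
  then show ?thesis using oconeI t \<open>?y \<noteq> 0\<close> by simp
qed

lemma ocone_imp_relint:
  assumes "norm x = 1" "x \<in> ocone a"
  shows "x \<in> arc_relint a"
proof -
  obtain \<alpha> \<beta> where ab: "\<alpha> > 0" "\<beta> > 0" "x = \<alpha> *\<^sub>R fst a + \<beta> *\<^sub>R snd a"
    using assms by (auto simp: ocone_def)
  define t where "t = \<beta> / (\<alpha> + \<beta>)"
  have t: "0 < t" "t < 1" using ab by (auto simp: t_def field_simps)
  have 1: "1 - t = \<alpha> / (\<alpha> + \<beta>)" using ab by (simp add: t_def field_simps)
  have "(1 - t) *\<^sub>R fst a + t *\<^sub>R snd a = (1 / (\<alpha> + \<beta>)) *\<^sub>R x"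
    unfolding 1 unfolding ab(3) t_def by (simp add: scaleR_add_right)
  then have "sgn ((1 - t) *\<^sub>R fst a + t *\<^sub>R snd a) = sgn x"
    using ab by (simp add: sgn_scaleR)
  also have "sgn x = x" using assms(1) by (simp add: sgn_div_norm)
  finally show ?thesis using t by (auto simp: arc_relint_def)
qed

lemma valid_cross: "valid_arc a \<Longrightarrow> cross3 (fst a) (snd a) \<noteq> 0"
proof
  assume v: "valid_arc a" and "cross3 (fst a) (snd a) = 0"
  then have "collinear {0, fst a, snd a}" by (simp add: cross_eq_0)
  moreover have "fst a \<noteq> 0" using v by (auto simp: valid_arc_def on_sphere_def)
  ultimately obtain c where "snd a = c *\<^sub>R fst a"
    by (metis collinear_lemma scaleR_zero_left)
  then have "\<bar>c\<bar> = 1" "snd a = c *\<^sub>R fst a" using v by (auto simp: valid_arc_def on_sphere_def)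
  then show False using v by (auto simp: valid_arc_def abs_if split: if_splits)
qed

text \<open>Expansion of \<open>u\<close> in the basis \<open>s\<close>, \<open>e\<close>,
  \<open>cross3 s e\<close>, cleared of denominators. For coplanar \<open>u\<close> the last term
  vanishes, and the signs of the other two coefficients locate \<open>u\<close> relative to the
  arc.\<close>

lemma cross_expansion:
  "(cross3 s e \<bullet> cross3 s e) *\<^sub>R u = (cross3 u e \<bullet> cross3 s e) *\<^sub>R s
     + (cross3 s u \<bullet> cross3 s e) *\<^sub>R e + (cross3 s e \<bullet> u) *\<^sub>R cross3 s e"
  by (simp add: vec_eq_iff forall_3 cross3_def inner_vec_def sum_3) (simp add: algebra_simps)

lemma plane_span:
  assumes "cross3 s e \<noteq> 0" "det3 s e u = 0"
  obtains x y where "u = x *\<^sub>R s + y *\<^sub>R e"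
proof -
  let ?N = "cross3 s e"
  note cross_expansion[of s e u]
  moreover have "?N \<bullet> u = 0" using assms(2) by (simp add: det3_def)
  ultimately have eq: "(?N \<bullet> ?N) *\<^sub>R u = (cross3 u e \<bullet> ?N) *\<^sub>R s + (cross3 s u \<bullet> ?N) *\<^sub>R e" by simp
  have "u = (1 / (?N \<bullet> ?N)) *\<^sub>R ((?N \<bullet> ?N) *\<^sub>R u)" using assms(1) by simp
  also have "\<dots> = ((cross3 u e \<bullet> ?N) / (?N \<bullet> ?N)) *\<^sub>R s + ((cross3 s u \<bullet> ?N) / (?N \<bullet> ?N)) *\<^sub>R e"
    unfolding eq by (simp add: scaleR_add_right)
  finally have "u = ((cross3 u e \<bullet> ?N) / (?N \<bullet> ?N)) *\<^sub>R s + ((cross3 s u \<bullet> ?N) / (?N \<bullet> ?N)) *\<^sub>R e" .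
  then show ?thesis using that by blast
qed

text \<open>In coordinates around the corner \<open>e\<close> at which \<open>b\<close> hits \<open>c\<close>, with \<open>P\<close> positive left of \<open>b\<close> and
  \<open>M\<close> positive left of \<open>c\<close>, the rays of \<open>b\<close> and \<open>c\<close> bound the wedge \<open>P > 0 \<ge> M\<close>: an edge
  enters or leaves it across one of the two rays.\<close>

lemma wedge_count:
  fixes Pu Pw Mu Mw X :: real
  assumes sX: "X > 0 \<longleftrightarrow> Pu * Mw > Pw * Mu" "X < 0 \<longleftrightarrow> Pu * Mw < Pw * Mu" "X = 0 \<longleftrightarrow> Pu * Mw = Pw * Mu"
    and N: "X = 0 \<Longrightarrow> Pu \<le> 0 \<Longrightarrow> Pw > 0 \<Longrightarrow> Mw \<le> 0"
  shows "(if \<not> Mu > 0 \<and> Mw > 0 \<and> X > 0 then 1 else 0) - (if Mu > 0 \<and> \<not> Mw > 0 \<and> X < 0 then 1 else 0)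
       - ((if \<not> Pu > 0 \<and> Pw > 0 \<and> X \<ge> 0 then 1 else 0) - (if Pu > 0 \<and> \<not> Pw > 0 \<and> X \<le> 0 then 1 else 0))
     \<ge> of_bool (Pu > 0 \<and> \<not> Mu > 0) - (of_bool (Pw > 0 \<and> \<not> Mw > 0) :: int)"
proof -
  have sg: "a > 0 \<Longrightarrow> b > 0 \<Longrightarrow> a * b > 0" "a \<le> 0 \<Longrightarrow> b \<le> 0 \<Longrightarrow> a * b \<ge> 0"
    "a > 0 \<Longrightarrow> b \<le> 0 \<Longrightarrow> a * b \<le> 0" "a \<le> 0 \<Longrightarrow> b > 0 \<Longrightarrow> a * b \<le> 0" for a b :: real
    by (auto simp: mult_nonpos_nonpos mult_nonneg_nonpos mult_nonpos_nonneg)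
  show ?thesis
  proof (cases "X = 0")
    case True
    with sX N have "Pu * Mw = Pw * Mu" "Pu \<le> 0 \<Longrightarrow> Pw > 0 \<Longrightarrow> Mw \<le> 0" by auto
    then show ?thesis using True sg[of Pu Mw] sg[of Pw Mu]
      by (cases "Pu > 0"; cases "Pw > 0"; cases "Mu > 0"; cases "Mw > 0") (simp_all add: not_less del: mult_pos_pos)
  next
    case False
    then consider "X > 0" "Pu * Mw > Pw * Mu" | "X < 0" "Pu * Mw < Pw * Mu" using sX by linarith
    then show ?thesis
    proof cases
      case 1
      then show ?thesis using sg[of Pu Mw] sg[of Pw Mu]
        by (cases "Pu > 0"; cases "Pw > 0"; cases "Mu > 0"; cases "Mw > 0") (simp_all add: not_less del: mult_pos_pos)
    next
      case 2
      then show ?thesis using sg[of Pu Mw] sg[of Pw Mu]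
        by (cases "Pu > 0"; cases "Pw > 0"; cases "Mu > 0"; cases "Mw > 0") (simp_all add: not_less del: mult_pos_pos)
    qed
  qed
qed

section \<open>Left turns and winding numbers\<close>

text \<open>\<open>S\<close> consists of directed arcs, in both directions. The sign \<open>t\<close> selects the orientation of the
  sphere: for \<open>t = - 1\<close> the word \<open>left\<close> means right.\<close>

locale arrangement =
  fixes S :: "arc set" and t :: real
  assumes fin: "finite S"
    and swapS: "b \<in> S \<Longrightarrow> prod.swap b \<in> S"
    and indep: "b \<in> S \<Longrightarrow> cross3 (fst b) (snd b) \<noteq> 0"
    and disj: "b \<in> S \<Longrightarrow> c \<in> S \<Longrightarrow> x \<in> ocone b \<Longrightarrow> x \<in> ocone c \<Longrightarrow> c = b \<or> c = prod.swap b"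
    and blocked: "b \<in> S \<Longrightarrow> \<exists>c\<in>S. snd b \<in> ocone c"
    and unit: "b \<in> S \<Longrightarrow> norm (snd b) = 1"
    and t: "t = 1 \<or> t = - 1"
begin

definition dt :: "point \<Rightarrow> point \<Rightarrow> point \<Rightarrow> real" where
  "dt u v w = t * det3 u v w"

lemma dt_lin:
  "dt (x + y) v w = dt x v w + dt y v w" "dt u (x + y) w = dt u x w + dt u y w" "dt u v (x + y) = dt u v x + dt u v y"
  "dt (a *\<^sub>R x) v w = a * dt x v w" "dt u (a *\<^sub>R x) w = a * dt u x w" "dt u v (a *\<^sub>R x) = a * dt u v x"
  by (simp_all add: dt_def det3_expand algebra_simps)

lemma dt_alt [simp]: "dt u u v = 0" "dt u v u = 0" "dt v u u = 0"
  by (simp_all add: dt_def det3_expand algebra_simps)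

lemma dt_cyc: "dt u v w = dt v w u" and dt_swap: "dt v u w = - dt u v w"
  by (simp_all add: dt_def det3_expand algebra_simps)

text \<open>Cramer's rule: the linear dependence of four vectors in 3-space. It turns sign
  information on determinants into cone membership.\<close>

lemma dt_rel: "dt e u w *\<^sub>R q + dt q e w *\<^sub>R u = dt q u w *\<^sub>R e + dt q e u *\<^sub>R w"
  by (simp add: dt_def det3_expand vec_eq_iff forall_3) (auto simp: algebra_simps)

text \<open>Three-term Pluecker relation for the directions seen from \<open>e\<close>.\<close>

lemma dt_pluecker: "dt e u w * dt s e c = dt s e u * dt e c w - dt s e w * dt e c u"
  by (simp add: dt_def det3_expand) (simp add: algebra_simps)

definition left_of :: "arc \<Rightarrow> point \<Rightarrow> bool" where
  "left_of c x \<longleftrightarrow> dt (fst c) (snd c) x > 0"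

text \<open>The signed crossing of the edge \<open>u \<rightarrow> w\<close> with the ray that continues \<open>c\<close> from \<open>q\<close> onwards,
  the ray being shifted infinitesimally to the left. For \<open>cross_from\<close> the ray includes \<open>q\<close>, for
  \<open>cross_beyond\<close> it does not. The sum over the edges of a closed walk is the winding number
  at a point just left of \<open>c\<close>, slightly before respectively slightly after \<open>q\<close>.\<close>

definition cross_from :: "arc \<Rightarrow> point \<Rightarrow> point \<Rightarrow> point \<Rightarrow> int" where
  "cross_from c q u w = (if \<not> left_of c u \<and> left_of c w \<and> dt q u w \<ge> 0 then 1 else 0)
                  - (if left_of c u \<and> \<not> left_of c w \<and> dt q u w \<le> 0 then 1 else 0)"

definition cross_beyond :: "arc \<Rightarrow> point \<Rightarrow> point \<Rightarrow> point \<Rightarrow> int" where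
  "cross_beyond c q u w = (if \<not> left_of c u \<and> left_of c w \<and> dt q u w > 0 then 1 else 0)
                  - (if left_of c u \<and> \<not> left_of c w \<and> dt q u w < 0 then 1 else 0)"

definition lstep :: "arc \<Rightarrow> arc \<Rightarrow> bool" where
  "lstep b c \<longleftrightarrow> b \<in> S \<and> c \<in> S \<and> snd b \<in> ocone c \<and> left_of c (fst b)"

lemma ocone_dt:
  assumes "q \<in> ocone c"
  obtains \<alpha> where "\<alpha> > 0" "\<And>x. dt q (snd c) x = \<alpha> * dt (fst c) (snd c) x"
  using assms by (auto simp: ocone_def dt_lin)

lemma left_of_swap: "left_of (prod.swap c) x \<longleftrightarrow> dt (fst c) (snd c) x < 0"
  unfolding left_of_def by (subst dt_swap) auto

lemma left_of_ocone: assumes "x \<in> ocone b" shows "\<not> left_of b x"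
  using assms by (auto simp: ocone_def left_of_def dt_lin)

lemma left_of_ends [simp]: "\<not> left_of b (fst b)" "\<not> left_of b (snd b)" by (auto simp: left_of_def)

lemma ends_not_ocone:
  assumes "b \<in> S" shows "snd b \<notin> ocone b" "fst b \<notin> ocone b"
proof -
  have *: False if aS: "a \<in> S" and aa: "snd a \<in> ocone a" for a
  proof -
    obtain \<alpha> \<beta> where ab: "\<alpha> > 0" "snd a = \<alpha> *\<^sub>R fst a + \<beta> *\<^sub>R snd a" using aa unfolding ocone_def by blast
    have "cross3 (snd a) (snd a) = \<alpha> *\<^sub>R cross3 (fst a) (snd a)"
      by (subst (1) ab(2)) (simp add: cross_add_left cross_mult_left)
    then show False using ab indep[OF aS] by simp
  qed
  show "snd b \<notin> ocone b" "fst b \<notin> ocone b"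
    using *[of b] *[of "prod.swap b"] assms swapS by auto
qed

lemma swap_neq: assumes "b \<in> S" shows "prod.swap b \<noteq> b"
proof
  assume "prod.swap b = b"
  then have "fst b = snd b" by (metis fst_swap)
  then show False using indep[OF assms] by simp
qed

text \<open>If the tail of \<open>b\<close> lay in the plane of \<open>c\<close>, the points of
  \<open>b\<close> just before its head would be interior to \<open>c\<close> as well, against
  disjointness.\<close>

lemma transversal:
  assumes b: "b \<in> S" and c: "c \<in> S" and q: "snd b \<in> ocone c"
  shows "dt (fst c) (snd c) (fst b) \<noteq> 0"
proof
  assume "dt (fst c) (snd c) (fst b) = 0"
  then have "det3 (fst c) (snd c) (fst b) = 0" using t by (auto simp: dt_def)
  then obtain x y where xy: "fst b = x *\<^sub>R fst c + y *\<^sub>R snd c" using plane_span indep[OF c] by metis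
  obtain \<alpha> \<beta> where ab: "\<alpha> > 0" "\<beta> > 0" "snd b = \<alpha> *\<^sub>R fst c + \<beta> *\<^sub>R snd c"
    using q by (auto simp: ocone_def)
  \<comment> \<open>A step so short that adding \<open>d\<close> times the tail keeps both
    coefficients of \<open>snd b\<close> over the ends of \<open>c\<close> positive.\<close>
  define d where "d = min (\<alpha> / (2 * (\<bar>x\<bar> + 1))) (\<beta> / (2 * (\<bar>y\<bar> + 1)))"
  have d: "d > 0" using ab by (simp add: d_def)
  have "d \<le> \<alpha> / (2 * (\<bar>x\<bar> + 1))" "d \<le> \<beta> / (2 * (\<bar>y\<bar> + 1))" by (auto simp: d_def)
  then have "d * (2 * (\<bar>x\<bar> + 1)) \<le> \<alpha>" "d * (2 * (\<bar>y\<bar> + 1)) \<le> \<beta>"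
    by (simp_all add: pos_le_divide_eq)
  moreover have "d * \<bar>x\<bar> = \<bar>d * x\<bar>" "d * \<bar>y\<bar> = \<bar>d * y\<bar>" using d by (auto simp: abs_mult)
  ultimately have "\<alpha> + d * x > 0" "\<beta> + d * y > 0" using d by (auto simp: algebra_simps abs_if split: if_splits)
  then have "(\<alpha> + d * x) *\<^sub>R fst c + (\<beta> + d * y) *\<^sub>R snd c \<in> ocone c" by (rule oconeI)
  also have "(\<alpha> + d * x) *\<^sub>R fst c + (\<beta> + d * y) *\<^sub>R snd c = d *\<^sub>R fst b + 1 *\<^sub>R snd b"
    unfolding xy ab(3) by (simp add: algebra_simps)
  finally have "d *\<^sub>R fst b + 1 *\<^sub>R snd b \<in> ocone c" .
  moreover have "d *\<^sub>R fst b + 1 *\<^sub>R snd b \<in> ocone b" using d by (intro oconeI) auto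
  ultimately have "c = b \<or> c = prod.swap b" using disj b c by blast
  then show False using q ends_not_ocone[OF b] by auto
qed

lemma lstep_exists: assumes "b \<in> S" shows "\<exists>c. lstep b c"
proof -
  obtain c where c: "c \<in> S" "snd b \<in> ocone c" using blocked[OF assms] by blast
  then consider "left_of c (fst b)" | "left_of (prod.swap c) (fst b)"
    using transversal[OF assms] unfolding left_of_swap by (force simp: left_of_def)
  then show ?thesis
  proof cases
    case 1
    then show ?thesis using c assms unfolding lstep_def by blast
  next
    case 2
    then have "lstep b (prod.swap c)" using c assms swapS by (auto simp: lstep_def)
    then show ?thesis by blast
  qed
qed

text \<open>The blocking arc at a head is unique up to direction, and the side from which it is
  reached fixes the direction.\<close>

lemma lstep_unique:
  assumes "lstep b c" "lstep b' c'" "snd b = snd b'" "left_of c' (fst b) \<or> left_of c (fst b')"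
  shows "c = c'"
proof -
  have "c' = c \<or> c' = prod.swap c" using assms disj by (metis lstep_def)
  then show ?thesis using assms left_of_swap[of c] by (auto simp: lstep_def left_of_def)
qed

text \<open>A closed walk is a periodic sequence on all of \<open>nat\<close>, so successors need no
  modular indices. Its vertices are the heads; the edge from \<open>snd (g i)\<close> to the next
  head is a part of the arc \<open>g (Suc i)\<close>.\<close>

definition walk :: "(nat \<Rightarrow> arc) \<Rightarrow> nat \<Rightarrow> bool" where
  "walk g n \<longleftrightarrow> n > 0 \<and> (\<forall>i. g i \<in> S \<and> snd (g i) \<in> ocone (g (Suc i)) \<and> g (i + n) = g i)"

definition crossings :: "(nat \<Rightarrow> arc) \<Rightarrow> nat \<Rightarrow> arc \<Rightarrow> point \<Rightarrow> int" where
  "crossings g n c q = (\<Sum>i<n. cross_from c q (snd (g i)) (snd (g (Suc i))))"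

text \<open>The rays continuing \<open>b\<close> and \<open>c\<close> from the corner bound a wedge.
  An edge changes the difference of the two ray counts as it changes the indicator of the wedge, and
  this indicator telescopes around a closed walk.\<close>

lemma edge_corner:
  assumes b: "b \<in> S" and ls: "lstep b c" and d: "d \<in> S" and u: "u \<in> ocone d" and w: "w = snd d"
    and h: "h \<bullet> snd b > 0" "h \<bullet> u > 0" "h \<bullet> w > 0"
  shows "cross_beyond c (snd b) u w - cross_from b (snd b) u w
    \<ge> of_bool (left_of b u \<and> \<not> left_of c u) - of_bool (left_of b w \<and> \<not> left_of c w)"
proof -
  let ?e = "snd b"
  define P where "P = (\<lambda>x. dt (fst b) ?e x)"
  define M where "M = (\<lambda>x. dt ?e (snd c) x)"
  define X where "X = dt ?e u w"
  have c: "c \<in> S" "?e \<in> ocone c" "left_of c (fst b)" using ls by (auto simp: lstep_def)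
  obtain \<alpha> where \<alpha>: "\<alpha> > 0" "\<And>x. M x = \<alpha> * dt (fst c) (snd c) x"
    using ocone_dt[OF c(2)] unfolding M_def by blast
  have ltc: "left_of c x \<longleftrightarrow> M x > 0" for x using \<alpha> by (simp add: left_of_def zero_less_mult_iff)
  have ltb: "left_of b x \<longleftrightarrow> P x > 0" for x by (simp add: left_of_def P_def)
  define D where "D = dt (fst b) ?e (snd c)"
  have D: "D > 0" using c(3) unfolding ltc by (metis D_def M_def dt_cyc)
  have X: "X * D = P u * M w - P w * M u"
    unfolding X_def D_def P_def M_def by (rule dt_pluecker)
  \<comment> \<open>The degenerate case, where the plane of the edge contains the corner: here the
    corner would be interior to \<open>d\<close>, so \<open>d\<close> would be \<open>c\<close> up
    to direction and \<open>w\<close> could not be strictly left of \<open>c\<close>.\<close>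
  have N1: "M w \<le> 0" if "X = 0" "P u \<le> 0" "P w > 0"
  proof (rule ccontr)
    assume neg: "\<not> M w \<le> 0"
    have "dt ?e u w *\<^sub>R fst b + dt (fst b) ?e w *\<^sub>R u = dt (fst b) u w *\<^sub>R ?e + dt (fst b) ?e u *\<^sub>R w"
      (is "?l = ?r") by (rule dt_rel)
    then have eq: "dt (fst b) u w *\<^sub>R ?e = P w *\<^sub>R u + (- P u) *\<^sub>R w"
      using that by (simp add: P_def X_def)
    \<comment> \<open>Pairing with \<open>h\<close> fixes the sign of the coefficient of the corner:
      the edge passes through the corner and not through its antipode.\<close>
    from arg_cong[OF eq, of "\<lambda>x. h \<bullet> x"] have "dt (fst b) u w * (h \<bullet> ?e) = P w * (h \<bullet> u) + (- P u) * (h \<bullet> w)"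
      by (simp only: inner_add_right inner_scaleR_right)
    moreover have "P w * (h \<bullet> u) > 0" "(- P u) * (h \<bullet> w) \<ge> 0" using that h by (auto intro!: mult_nonpos_nonneg)
    ultimately have mu: "dt (fst b) u w > 0" using h by (smt (verit) zero_less_mult_iff)
    let ?m = "dt (fst b) u w"
    have "?e = (1 / ?m) *\<^sub>R (?m *\<^sub>R ?e)" using mu by simp
    also have "\<dots> = (P w / ?m) *\<^sub>R u + (- P u / ?m) *\<^sub>R w" unfolding eq by (simp add: algebra_simps)
    finally have ee: "?e = (P w / ?m) *\<^sub>R u + (- P u / ?m) *\<^sub>R w" .
    have "?e \<in> ocone d"
      unfolding w by (subst ee, unfold w, rule ocone_add[OF u]) (use mu that in \<open>auto simp: w intro: divide_nonpos_pos\<close>)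
    then have "d = c \<or> d = prod.swap c" using disj c d by blast
    then have "dt (fst c) (snd c) w = 0" using w by auto
    then show False using neg \<alpha> by simp
  qed
  have sX: "X > 0 \<longleftrightarrow> P u * M w > P w * M u" "X < 0 \<longleftrightarrow> P u * M w < P w * M u" "X = 0 \<longleftrightarrow> P u * M w = P w * M u"
    using X D by (smt (verit) zero_less_mult_iff mult_less_0_iff)+
  show ?thesis
    unfolding cross_beyond_def cross_from_def ltc ltb X_def[symmetric]
    by (rule wedge_count[OF sX N1])
qed

end


definition pointed_cone :: "point set \<Rightarrow> point \<Rightarrow> bool" where
  "pointed_cone K h \<longleftrightarrow> (\<forall>x\<in>K. \<forall>y\<in>K. x + y \<in> K) \<and> (\<forall>x\<in>K. \<forall>a>0. a *\<^sub>R x \<in> K) \<and> (\<forall>x\<in>K. h \<bullet> x > 0)"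

section \<open>Monotonicity of the crossing count along left turns, and the trapping
  argument\<close>

context arrangement begin

lemma ahead_rel:
  assumes q: "q \<in> ocone c" and q': "q' = a *\<^sub>R q + b *\<^sub>R snd c" and ab: "b > 0"
  obtains k where "k > 0"
    "(k * dt (fst c) (snd c) w) *\<^sub>R u - (k * dt (fst c) (snd c) u) *\<^sub>R w = dt q u w *\<^sub>R q' - dt q' u w *\<^sub>R q"
proof -
  obtain \<alpha> where \<alpha>: "\<alpha> > 0" "\<And>x. dt q (snd c) x = \<alpha> * dt (fst c) (snd c) x" using ocone_dt[OF q] by blast
  have qq: "dt q q' x = (b * \<alpha>) * dt (fst c) (snd c) x" for x by (simp add: q' dt_lin \<alpha>)
  have "dt q q' w *\<^sub>R u - dt q q' u *\<^sub>R w = dt q u w *\<^sub>R q' - dt q' u w *\<^sub>R q"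
    using dt_rel[of q' u w q] by (simp add: algebra_simps)
  then show ?thesis using that[of "b * \<alpha>"] ab \<alpha> unfolding qq by simp
qed

text \<open>Moving the origin of the ray forward along \<open>c\<close> never lowers the count: a
  positive crossing between \<open>q\<close> and \<open>q'\<close> would cut the interior of
  \<open>c\<close>, while a negative crossing from \<open>q'\<close> onwards already lies beyond
  \<open>q\<close>.\<close>

lemma edge_ahead:
  assumes c: "c \<in> S" and d: "d \<in> S" and q: "q \<in> ocone c"
    and q': "q' = a *\<^sub>R q + b *\<^sub>R snd c" and ab: "a \<ge> 0" "b > 0"
    and u: "u \<in> ocone d" and h: "h \<bullet> q > 0" "h \<bullet> q' \<ge> 0" "h \<bullet> u > 0" "h \<bullet> snd d > 0"
  shows "cross_beyond c q u (snd d) \<le> cross_from c q' u (snd d)"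
proof -
  let ?w = "snd d"
  let ?D = "\<lambda>x. dt (fst c) (snd c) x"
  obtain k where k: "k > 0" and rel: "(k * ?D ?w) *\<^sub>R u - (k * ?D u) *\<^sub>R ?w = dt q u ?w *\<^sub>R q' - dt q' u ?w *\<^sub>R q"
    using ahead_rel[OF q q' ab(2)] by blast
  have up: "dt q' u ?w \<ge> 0" if D: "?D u \<le> 0" "?D ?w > 0" and X: "dt q u ?w > 0"
  proof (rule ccontr)
    assume neg: "\<not> dt q' u ?w \<ge> 0"
    have "(k * ?D ?w) *\<^sub>R u + (- (k * ?D u)) *\<^sub>R ?w \<in> ocone d"
      using k D by (intro ocone_add[OF u]) (auto simp: mult_nonneg_nonpos)
    moreover have "(dt q u ?w * a - dt q' u ?w) *\<^sub>R q + (dt q u ?w * b) *\<^sub>R snd c \<in> ocone c"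
      using X neg ab by (intro ocone_add[OF q]) (auto intro: add_nonneg_pos simp: diff_conv_add_uminus simp del: add_uminus_conv_diff)
    moreover have "(k * ?D ?w) *\<^sub>R u + (- (k * ?D u)) *\<^sub>R ?w = (dt q u ?w * a - dt q' u ?w) *\<^sub>R q + (dt q u ?w * b) *\<^sub>R snd c"
      using rel by (simp add: q' algebra_simps)
    ultimately have "d = c \<or> d = prod.swap c" using disj c d by metis
    then show False using D by auto
  qed
  \<comment> \<open>Here the positivity of \<open>h\<close> enters: it prevents the great circle of
    \<open>c\<close> from being crossed on the opposite side of the sphere.\<close>
  have down: "dt q u ?w < 0" if D: "?D u > 0" "?D ?w \<le> 0" and X: "dt q' u ?w \<le> 0"
  proof (rule ccontr)
    assume neg: "\<not> dt q u ?w < 0"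
    from arg_cong[OF rel, of "\<lambda>x. h \<bullet> x"]
    have "k * ?D ?w * (h \<bullet> u) - k * ?D u * (h \<bullet> ?w) = dt q u ?w * (h \<bullet> q') - dt q' u ?w * (h \<bullet> q)"
      by (simp only: inner_diff_right inner_scaleR_right)
    moreover have "k * ?D ?w * (h \<bullet> u) \<le> 0" "k * ?D u * (h \<bullet> ?w) > 0" "dt q u ?w * (h \<bullet> q') \<ge> 0" "dt q' u ?w * (h \<bullet> q) \<le> 0"
      using k D X neg h by (auto simp: mult_nonneg_nonpos mult_nonpos_nonneg mult_le_0_iff)
    ultimately show False by linarith
  qed
  show ?thesis using up down by (auto simp: cross_beyond_def cross_from_def left_of_def not_less)
qed

text \<open>The point \<open>q'\<close> may be any point of \<open>c\<close> ahead of the corner,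
  not only its head, and may lie on the boundary \<open>h = 0\<close>; the trapping argument uses
  this freedom.\<close>

lemma crossings_mono:
  assumes g: "walk g n" and pos: "\<And>i. h \<bullet> snd (g i) > 0" and ls: "lstep b c"
    and q': "q' = x *\<^sub>R snd b + y *\<^sub>R snd c" "x \<ge> 0" "y > 0" and h: "h \<bullet> snd b > 0" "h \<bullet> q' \<ge> 0"
  shows "crossings g n b (snd b) \<le> crossings g n c q'"
proof -
  define ind :: "point \<Rightarrow> int" where "ind = (\<lambda>x. of_bool (left_of b x \<and> \<not> left_of c x))"
  have bc: "b \<in> S" "c \<in> S" "snd b \<in> ocone c" using ls by (auto simp: lstep_def)
  have gS: "g i \<in> S" "snd (g i) \<in> ocone (g (Suc i))" for i using g by (auto simp: walk_def)
  have "(\<Sum>i<n. ind (snd (g i)) - ind (snd (g (Suc i)))) = ind (snd (g 0)) - ind (snd (g n))"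
    by (rule sum_lessThan_telescope')
  also have "g n = g 0" using g by (auto simp: walk_def dest: spec[of _ 0])
  finally have "0 = (\<Sum>i<n. ind (snd (g i)) - ind (snd (g (Suc i))))" by simp
  also have "\<dots> \<le> (\<Sum>i<n. cross_beyond c (snd b) (snd (g i)) (snd (g (Suc i))) - cross_from b (snd b) (snd (g i)) (snd (g (Suc i))))"
  proof (rule sum_mono)
    fix i
    show "ind (snd (g i)) - ind (snd (g (Suc i))) \<le> cross_beyond c (snd b) (snd (g i)) (snd (g (Suc i))) - cross_from b (snd b) (snd (g i)) (snd (g (Suc i)))"
      unfolding ind_def by (rule edge_corner[OF bc(1) ls gS(1) gS(2) refl h(1) pos pos])
  qed
  also have "\<dots> = (\<Sum>i<n. cross_beyond c (snd b) (snd (g i)) (snd (g (Suc i)))) - crossings g n b (snd b)"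
    by (simp add: sum_subtractf crossings_def)
  also have "(\<Sum>i<n. cross_beyond c (snd b) (snd (g i)) (snd (g (Suc i)))) \<le> crossings g n c q'"
    unfolding crossings_def by (intro sum_mono edge_ahead[OF bc(2) gS(1) bc(3) q' gS(2) h pos pos])
  finally show ?thesis by simp
qed

lemma crossings_mono_end:
  assumes "walk g n" "\<And>i. h \<bullet> snd (g i) > 0" "lstep b c" "h \<bullet> snd b > 0" "h \<bullet> snd c > 0"
  shows "crossings g n b (snd b) \<le> crossings g n c (snd c)"
  using assms by (intro crossings_mono[where h = h and x = 0 and y = 1]) auto

lemma crossings_pos_edge:
  assumes "crossings g n c q \<ge> 1"
  obtains i where "i < n" "\<not> left_of c (snd (g i))" "left_of c (snd (g (Suc i)))" "dt q (snd (g i)) (snd (g (Suc i))) \<ge> 0"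
proof -
  have "\<exists>i<n. cross_from c q (snd (g i)) (snd (g (Suc i))) > 0"
  proof (rule ccontr)
    assume "\<not> ?thesis"
    then have "crossings g n c q \<le> 0" unfolding crossings_def by (intro sum_nonpos) (meson lessThan_iff linorder_not_le)
    then show False using assms by simp
  qed
  then show ?thesis using that by (auto simp: cross_from_def split: if_splits)
qed

text \<open>A positive count at \<open>q'\<close> provides an edge of the walk that crosses the ray
  beyond \<open>q'\<close>. Hence \<open>q'\<close> lies between the old corner and that edge, so it
  is a positive combination of points of \<open>K\<close>.\<close>

lemma crossings_trap:
  assumes K: "pointed_cone K h" and g: "walk g n" and gK: "\<And>i. snd (g i) \<in> K"
    and ls: "lstep b c" and b: "snd b \<in> K" "crossings g n b (snd b) \<ge> 1"
  shows "snd c \<in> K"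
proof -
  have hK: "x \<in> K \<Longrightarrow> h \<bullet> x > 0" and addK: "x \<in> K \<Longrightarrow> y \<in> K \<Longrightarrow> x + y \<in> K"
    and scK: "x \<in> K \<Longrightarrow> r > 0 \<Longrightarrow> r *\<^sub>R x \<in> K" for x y r
    using K by (auto simp: pointed_cone_def)
  have bc: "b \<in> S" "c \<in> S" "snd b \<in> ocone c" using ls by (auto simp: lstep_def)
  let ?q = "snd b"
  have key: "q' \<in> K" if q': "q' = x *\<^sub>R ?q + y *\<^sub>R snd c" "x \<ge> 0" "y > 0" and hq: "h \<bullet> q' \<ge> 0" for q' x y
  proof -
    have "crossings g n b ?q \<le> crossings g n c q'" using crossings_mono[OF g _ ls q'] hK gK b hq by blast
    then have "crossings g n c q' \<ge> 1" using b by simp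
    then obtain i where i: "\<not> left_of c (snd (g i))" "left_of c (snd (g (Suc i)))" "dt q' (snd (g i)) (snd (g (Suc i))) \<ge> 0"
      using crossings_pos_edge by metis
    let ?u = "snd (g i)" and ?w = "snd (g (Suc i))"
    let ?D = "\<lambda>x. dt (fst c) (snd c) x"
    obtain k where k: "k > 0" and rel: "(k * ?D ?w) *\<^sub>R ?u - (k * ?D ?u) *\<^sub>R ?w = dt ?q ?u ?w *\<^sub>R q' - dt q' ?u ?w *\<^sub>R ?q"
      using ahead_rel[OF bc(3) q'(1,3)] by blast
    have D: "?D ?w > 0" "?D ?u \<le> 0" using i by (auto simp: left_of_def)
    have wk: "v + r *\<^sub>R v' \<in> K" if "v \<in> K" "v' \<in> K" "r \<ge> 0" for v v' r
      using that addK scK by (cases "r = 0") auto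
    have "((k * ?D ?w) *\<^sub>R ?u + (- (k * ?D ?u)) *\<^sub>R ?w) + dt q' ?u ?w *\<^sub>R ?q \<in> K"
      using k D i b gK by (intro wk scK) (auto simp: mult_nonneg_nonpos)
    also have "((k * ?D ?w) *\<^sub>R ?u + (- (k * ?D ?u)) *\<^sub>R ?w) + dt q' ?u ?w *\<^sub>R ?q = dt ?q ?u ?w *\<^sub>R q'"
      using rel by (simp add: algebra_simps)
    finally have Xq: "dt ?q ?u ?w *\<^sub>R q' \<in> K" .
    then have "dt ?q ?u ?w * (h \<bullet> q') > 0" using hK by fastforce
    then have "dt ?q ?u ?w > 0" using hq by (simp add: zero_less_mult_iff)
    then show ?thesis using scK[OF Xq, of "1 / dt ?q ?u ?w"] by simp
  qed
  show ?thesis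
  proof (cases "h \<bullet> snd c \<ge> 0")
    case True
    then show ?thesis using key[of "snd c" 0 1] by simp
  next
    case False
    \<comment> \<open>If \<open>c\<close> left the hemisphere, this would be the direction in which
      it meets the plane \<open>h = 0\<close>. The argument above would put it into
      \<open>K\<close>, where \<open>h\<close> is positive.\<close>
    define q' where "q' = (- (h \<bullet> snd c)) *\<^sub>R ?q + (h \<bullet> ?q) *\<^sub>R snd c"
    have 0: "h \<bullet> q' = 0" by (simp add: q'_def inner_add_right inner_diff_right algebra_simps)
    have "q' \<in> K" using key[OF q'_def] False hK[OF b(1)] 0 by simp
    then show ?thesis using hK 0 by fastforce
  qed
qed

end


text \<open>The point farthest from a given one is a vertex of the convex hull. Choosing it by
  distance from \<open>q\<close> makes it different from \<open>q\<close>, so one forbidden vertex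
  can be avoided.\<close>

lemma exposed_point:
  fixes V :: "point set"
  assumes fin: "finite V" and V: "\<And>x. x \<in> V \<Longrightarrow> norm x = 1 \<and> h \<bullet> x > 0" and p: "p \<in> V" "p \<noteq> q"
    and q: "q \<in> V"
  shows "\<exists>v\<in>V. \<exists>l. v \<noteq> q \<and> l \<bullet> v = 0 \<and> (\<forall>x\<in>V. x \<noteq> v \<longrightarrow> l \<bullet> x < 0)"
proof -
  \<comment> \<open>Central projection to the affine plane where \<open>h\<close> equals 1; it is
    injective on unit vectors of the hemisphere.\<close>
  define N where "N = (\<lambda>x. (1 / (h \<bullet> x)) *\<^sub>R x)"
  have N_inj: "x = y" if "x \<in> V" "y \<in> V" "N x = N y" for x y
  proof -
    have "norm (N x) = 1 / (h \<bullet> x)" "norm (N y) = 1 / (h \<bullet> y)" using V[OF that(1)] V[OF that(2)] by (simp_all add: N_def)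
    then have "h \<bullet> x = h \<bullet> y" using that V by (metis divide_cancel_left one_neq_zero)
    then show ?thesis using that V[of x] by (auto simp: N_def)
  qed
  define m where "m = Max ((\<lambda>x. norm (N x - N q)) ` V)"
  have le: "norm (N x - N q) \<le> m" if "x \<in> V" for x using that fin by (simp add: m_def)
  have "m \<in> (\<lambda>x. norm (N x - N q)) ` V" unfolding m_def using fin p by (intro Max_in) auto
  then obtain v where v: "v \<in> V" "m = norm (N v - N q)" by auto
  have "norm (N p - N q) > 0" using N_inj p q by auto
  then have "m > 0" using le[OF p(1)] by linarith
  then have "v \<noteq> q" using v by auto
  define a where "a = N v - N q"
  \<comment> \<open>The linear form whose zero set on the affine plane is the line through
    \<open>N v\<close> perpendicular to \<open>a\<close>.\<close>
  define l where "l = a - (a \<bullet> N v) *\<^sub>R h"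
  have lx: "l \<bullet> x = (h \<bullet> x) * (a \<bullet> N x - a \<bullet> N v)" if "x \<in> V" for x
    using V[OF that] by (simp add: l_def N_def inner_diff_left algebra_simps)
  have "l \<bullet> x < 0" if x: "x \<in> V" "x \<noteq> v" for x
  proof -
    have "N x \<noteq> N v" using N_inj x v by blast
    then have "0 < (norm (N x - N v))\<^sup>2" by simp
    also have "N x - N v = (N x - N q) - a" by (simp add: a_def)
    also have "(norm (\<dots>))\<^sup>2 = (norm (N x - N q))\<^sup>2 - 2 * (a \<bullet> (N x - N q)) + (norm a)\<^sup>2"
      by (simp add: power2_norm_eq_inner inner_diff_left inner_diff_right inner_commute)
    also have "(norm (N x - N q))\<^sup>2 \<le> (norm a)\<^sup>2"
      using le[OF x(1)] by (intro power_mono) (auto simp: v a_def)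
    finally have "a \<bullet> (N x - N q) < (norm a)\<^sup>2" by simp
    also have "(norm a)\<^sup>2 = a \<bullet> (N v - N q)" by (simp add: power2_norm_eq_inner a_def)
    finally have "a \<bullet> N x < a \<bullet> N v" by (simp add: inner_diff_right)
    then show ?thesis using V[OF x(1)] by (simp add: lx[OF x(1)] mult_pos_neg)
  qed
  moreover have "l \<bullet> v = 0" using lx[OF v(1)] by simp
  ultimately show ?thesis using v \<open>v \<noteq> q\<close> by blast
qed

section \<open>Closed walks, exposed vertices and cycles of left turns\<close>

context arrangement begin

definition swalk :: "(nat \<Rightarrow> arc) \<Rightarrow> nat \<Rightarrow> bool" where
  "swalk g n \<longleftrightarrow> walk g n \<and> inj_on g {..<n}"

lemma walk_period: assumes "walk g n" shows "g (i + k * n) = g i"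
proof (induction k)
  case (Suc k)
  have "g (i + Suc k * n) = g ((i + k * n) + n)" by (simp add: algebra_simps)
  also have "\<dots> = g (i + k * n)" using assms by (auto simp: walk_def)
  finally show ?case using Suc by simp
qed simp

lemma walk_mod: assumes "walk g n" shows "g (i mod n) = g i"
  using walk_period[OF assms, of "i mod n" "i div n"] by simp

lemma swalk_pred:
  assumes g: "swalk g n" and eq: "g (Suc i) = g (Suc j)"
  shows "g i = g j"
proof -
  have w: "walk g n" "n > 0" using g by (auto simp: swalk_def walk_def)
  have "g (Suc i mod n) = g (Suc j mod n)" using eq walk_mod[OF w(1)] by simp
  then have "Suc i mod n = Suc j mod n" using g w by (auto simp: swalk_def inj_on_def)
  then have "(Suc i + (n - 1)) mod n = (Suc j + (n - 1)) mod n" by (metis mod_add_cong)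
  then have "(i + n) mod n = (j + n) mod n" using w by simp
  then have "i mod n = j mod n" by simp
  then show ?thesis using walk_mod[OF w(1)] by metis
qed

lemma walk_prev:
  assumes "walk g n"
  obtains k where "snd (g k) \<in> ocone (g i)"
proof -
  have n: "n > 0" using assms by (simp add: walk_def)
  have "snd (g (i + n - 1)) \<in> ocone (g (Suc (i + n - 1)))" using assms unfolding walk_def by blast
  also have "Suc (i + n - 1) = i + n" using n by simp
  also have "g (i + n) = g i" using assms by (simp add: walk_def)
  finally show ?thesis by (rule that)
qed

lemma lstep_lt: assumes "lstep b c" shows "left_of b (snd c)"
proof -
  have c: "snd b \<in> ocone c" "dt (fst c) (snd c) (fst b) > 0" using assms by (auto simp: lstep_def left_of_def)
  obtain \<alpha> where \<alpha>: "\<alpha> > 0" "\<And>x. dt (snd b) (snd c) x = \<alpha> * dt (fst c) (snd c) x" using ocone_dt[OF c(1)] by blast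
  have "dt (fst b) (snd b) (snd c) = dt (snd b) (snd c) (fst b)" by (rule dt_cyc)
  then show ?thesis using \<alpha> c by (simp add: left_of_def)
qed

text \<open>Past its head, \<open>b\<close> enters the side \<open>l > 0\<close>, where the walk has
  no points. So only an edge that starts or ends at the head itself can be counted.\<close>

lemma edge_exposed:
  assumes q: "q \<in> ocone b" "l \<bullet> q < 0" and v: "l \<bullet> snd b = 0"
    and u: "u = snd b \<or> l \<bullet> u < 0" and w: "w = snd b \<or> l \<bullet> w < 0"
  shows "\<not> left_of b u \<Longrightarrow> left_of b w \<Longrightarrow> dt (snd b) u w \<ge> 0 \<Longrightarrow> u = snd b"
    and "left_of b u \<Longrightarrow> \<not> left_of b w \<Longrightarrow> dt (snd b) u w \<le> 0 \<Longrightarrow> w = snd b"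
proof -
  let ?v = "snd b"
  let ?D = "\<lambda>x. dt (fst b) (snd b) x"
  obtain \<alpha> where \<alpha>: "\<alpha> > 0" "\<And>x. dt q ?v x = \<alpha> * ?D x" using ocone_dt[OF q(1)] by blast
  have "l \<bullet> (dt ?v u w *\<^sub>R q + dt q ?v w *\<^sub>R u) = l \<bullet> (dt q u w *\<^sub>R ?v + dt q ?v u *\<^sub>R w)"
    using dt_rel by simp
  then have rel: "dt ?v u w * (l \<bullet> q) + \<alpha> * ?D w * (l \<bullet> u) = \<alpha> * ?D u * (l \<bullet> w)"
    by (simp add: inner_add_right v \<alpha>)
  have lw: "l \<bullet> w \<le> 0" "l \<bullet> u \<le> 0" using u w v by auto
  show "u = ?v" if "\<not> left_of b u" "left_of b w" "dt ?v u w \<ge> 0"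
  proof (rule ccontr)
    assume "u \<noteq> ?v"
    then have "l \<bullet> u < 0" using u by simp
    then have "\<alpha> * ?D w * (l \<bullet> u) < 0" using \<alpha> that by (simp add: left_of_def mult_pos_neg)
    moreover have "dt ?v u w * (l \<bullet> q) \<le> 0" using that q by (simp add: mult_nonneg_nonpos)
    moreover have "\<alpha> * ?D u * (l \<bullet> w) \<ge> 0" using \<alpha> that lw by (intro mult_nonpos_nonpos mult_nonneg_nonpos) (auto simp: left_of_def)
    ultimately show False using rel by linarith
  qed
  show "w = ?v" if "left_of b u" "\<not> left_of b w" "dt ?v u w \<le> 0"
  proof (rule ccontr)
    assume "w \<noteq> ?v"
    then have "l \<bullet> w < 0" using w by simp
    then have "\<alpha> * ?D u * (l \<bullet> w) < 0" using \<alpha> that by (simp add: left_of_def mult_pos_neg)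
    moreover have "dt ?v u w * (l \<bullet> q) \<ge> 0" using that q by (simp add: mult_nonpos_nonpos)
    moreover have "\<alpha> * ?D w * (l \<bullet> u) \<ge> 0" using \<alpha> that lw by (intro mult_nonpos_nonpos mult_nonneg_nonpos) (auto simp: left_of_def)
    ultimately show False using rel by linarith
  qed
qed

text \<open>At an exposed vertex no edge counts negatively, and the left turn made there contributes
  1.\<close>

lemma crossings_exposed_ge_1:
  assumes g: "swalk g n" and ls: "lstep (g j) (g (Suc j))"
    and v: "l \<bullet> snd (g j) = 0" and ex: "\<And>i. snd (g i) \<noteq> snd (g j) \<Longrightarrow> l \<bullet> snd (g i) < 0"
  shows "crossings g n (g j) (snd (g j)) \<ge> 1"
proof -
  let ?v = "snd (g j)" and ?b = "g j" and ?c = "g (Suc j)"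
  have w: "walk g n" "n > 0" using g by (auto simp: swalk_def walk_def)
  have gS: "g i \<in> S" "snd (g i) \<in> ocone (g (Suc i))" for i using w by (auto simp: walk_def)
  obtain k where k: "snd (g k) \<in> ocone ?b" using walk_prev[OF w(1)] by blast
  have lk: "l \<bullet> snd (g k) < 0" using ends_not_ocone[OF gS(1)] k ex by metis
  have exd: "snd (g i) = ?v \<or> l \<bullet> snd (g i) < 0" for i using ex by blast
  note ee = edge_exposed[OF k lk v exd exd]
  have nonneg: "cross_from ?b ?v (snd (g i)) (snd (g (Suc i))) \<ge> 0" for i
  proof (rule ccontr)
    assume "\<not> ?thesis"
    then have *: "left_of ?b (snd (g i))" "\<not> left_of ?b (snd (g (Suc i)))" "dt ?v (snd (g i)) (snd (g (Suc i))) \<le> 0"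
      by (auto simp: cross_from_def split: if_splits)
    then have v': "snd (g (Suc i)) = ?v" using ee(2) by blast
    let ?c' = "g (Suc (Suc i))"
    have vc: "?v \<in> ocone ?c" "?v \<in> ocone ?c'" using gS(2)[of j] gS(2)[of "Suc i"] v' by auto
    then consider "?c' = ?c" | "?c' = prod.swap ?c" using disj gS by blast
    \<comment> \<open>If the walk continues along \<open>c\<close>, injectivity makes the arriving
      arc \<open>b\<close> itself, which does not come from its own left. If it continues along the
      reversal, both ends of \<open>c\<close> are walk vertices and the exposed vertex lies strictly
      between them.\<close>
    then show False
    proof cases
      case 1
      then have "g (Suc i) = ?b" using swalk_pred[OF g] by blast
      then show False using gS(2)[of i] * left_of_ocone by metis
    next
      case 2
      then have "snd ?c' = fst ?c" by simp
      moreover have "fst ?c \<noteq> ?v" "snd ?c \<noteq> ?v" using ends_not_ocone[OF gS(1)] vc by metis+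
      ultimately have "l \<bullet> fst ?c < 0" "l \<bullet> snd ?c < 0" using ex by metis+
      moreover obtain x y where "x > 0" "y > 0" "?v = x *\<^sub>R fst ?c + y *\<^sub>R snd ?c" using vc(1) by (auto simp: ocone_def)
      ultimately have "l \<bullet> ?v < 0" by (simp add: inner_add_right add_neg_neg mult_pos_neg)
      then show False using v by simp
    qed
  qed
  have "1 = cross_from ?b ?v ?v (snd ?c)" using lstep_lt[OF ls] by (simp add: cross_from_def)
  also have "\<dots> = cross_from ?b ?v (snd (g (j mod n))) (snd (g (Suc (j mod n))))"
    using walk_mod[OF w(1), of j] walk_mod[OF w(1), of "Suc j"] walk_mod[OF w(1), of "Suc (j mod n)"] by (simp add: mod_Suc_eq)
  also have "\<dots> \<le> crossings g n ?b ?v"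
    unfolding crossings_def using w nonneg by (intro member_le_sum) auto
  finally show ?thesis .
qed

text \<open>A nondecreasing periodic sequence is constant.\<close>

lemma crossings_left_cycle_const:
  assumes d: "walk d m" "\<And>i. h \<bullet> snd (d i) > 0" and g: "walk g n" "\<And>i. h \<bullet> snd (g i) > 0" "\<And>i. lstep (g i) (g (Suc i))"
  shows "crossings d m (g i) (snd (g i)) = crossings d m (g j) (snd (g j))"
proof -
  let ?f = "\<lambda>i. crossings d m (g i) (snd (g i))"
  have "?f i \<le> ?f (Suc i)" for i by (rule crossings_mono_end[OF d g(3) g(2) g(2)])
  then have mono: "i \<le> j \<Longrightarrow> ?f i \<le> ?f j" for i j using lift_Suc_mono_le[of ?f] by blast
  have "?f i \<le> ?f j" for i j
  proof -
    have "n > 0" using g by (simp add: walk_def)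
    then have "i \<le> j + i * n" by (cases n) auto
    then show ?thesis using mono[of i "j + i * n"] walk_period[OF g(1)] by simp
  qed
  then show ?thesis by (simp add: order_antisym)
qed

text \<open>At the return to arc 0 in the opposite direction, the head of \<open>g (k - 1)\<close>
  is interior to that arc, so the walk may be closed by traversing the arc forwards instead.\<close>

lemma subwalk:
  assumes g: "swalk g n" and k: "0 < k" "k < n" and rev: "g k = prod.swap (g 0)"
  shows "swalk (\<lambda>i. g (i mod k)) k"
proof -
  have w: "walk g n" using g by (auto simp: swalk_def)
  have "snd (g (i mod k)) \<in> ocone (g (Suc i mod k))" for i
  proof (cases "Suc (i mod k) = k")
    case True
    have "snd (g (i mod k)) \<in> ocone (g (Suc (i mod k)))" using w by (simp add: walk_def)
    then show ?thesis using True rev by (simp add: mod_Suc)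
  next
    case False
    then show ?thesis using w by (simp add: walk_def mod_Suc)
  qed
  then have "walk (\<lambda>i. g (i mod k)) k" using w k by (simp add: walk_def)
  moreover have "inj_on (\<lambda>i. g (i mod k)) {..<k}"
    using g k by (auto simp: swalk_def inj_on_def)
  ultimately show ?thesis by (simp add: swalk_def)
qed

text \<open>The shortened walk turns left everywhere except possibly at its last vertex, where it
  takes \<open>g 0\<close> instead of the reversal \<open>g k\<close>. An exposed vertex other than
  that one gives the bound, and constancy along the full cycle spreads it.\<close>

lemma subwalk_crossings_ge_1:
  assumes g: "swalk g n" and pos: "\<And>i. h \<bullet> snd (g i) > 0" and ls: "\<And>i. lstep (g i) (g (Suc i))"
    and k: "0 < k" "k < n" and rev: "g k = prod.swap (g 0)"
  shows "crossings (\<lambda>i. g (i mod k)) k (g i) (snd (g i)) \<ge> 1"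
proof -
  let ?d = "\<lambda>i. g (i mod k)"
  have d: "swalk ?d k" by (rule subwalk[OF g k rev])
  have w: "walk g n" using g by (auto simp: swalk_def)
  have gS: "g i \<in> S" "snd (g i) \<in> ocone (g (Suc i))" for i using w by (auto simp: walk_def)
  let ?V = "(\<lambda>i. snd (g i)) ` {..<k}"
  have "snd (g (k - 1)) \<in> ocone (g 0)" using gS(2)[of "k - 1"] k rev by simp
  then have ne: "snd (g 0) \<noteq> snd (g (k - 1))" using ends_not_ocone gS by metis
  have V: "snd (g 0) \<in> ?V" "snd (g (k - 1)) \<in> ?V" using k by auto
  have fin: "finite ?V" by simp
  have Vp: "norm x = 1 \<and> h \<bullet> x > 0" if "x \<in> ?V" for x using that unit[OF gS(1)] pos by auto
  obtain v l where v: "v \<in> ?V" "v \<noteq> snd (g (k - 1))" "l \<bullet> v = 0" "\<forall>x\<in>?V. x \<noteq> v \<longrightarrow> l \<bullet> x < 0"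
    using exposed_point[OF fin Vp V(1) ne V(2)] by blast
  then obtain j where j: "j < k" "v = snd (g j)" by auto
  have "j \<noteq> k - 1" using v j by auto
  then have j': "Suc j < k" using j by linarith
  have "crossings ?d k (?d j) (snd (?d j)) \<ge> 1"
  proof (rule crossings_exposed_ge_1[OF d, where l = l])
    show "lstep (?d j) (?d (Suc j))" using j' ls by simp
    show "l \<bullet> snd (?d j) = 0" using j v by simp
    show "l \<bullet> snd (?d i) < 0" if "snd (?d i) \<noteq> snd (?d j)" for i
      using that v(4) k j by simp
  qed
  then have "crossings ?d k (g j) (snd (g j)) \<ge> 1" using j by simp
  then show ?thesis
    using crossings_left_cycle_const[of ?d k h g n i j] d w pos ls by (simp add: swalk_def)
qed

lemma swalk_shift: assumes "swalk g n" shows "swalk (\<lambda>i. g (i + k)) n"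
proof -
  have w: "walk g n" using assms by (simp add: swalk_def)
  have "walk (\<lambda>i. g (i + k)) n"
    using w by (auto simp: walk_def) (metis add.assoc add.commute)
  moreover have "inj_on (\<lambda>i. g (i + k)) {..<n}"
  proof (rule inj_onI)
    fix i j assume ij: "i \<in> {..<n}" "j \<in> {..<n}" "g (i + k) = g (j + k)"
    then have "g ((i + k) mod n) = g ((j + k) mod n)" using walk_mod[OF w] by simp
    then have "(i + k) mod n = (j + k) mod n" using assms ij by (auto simp: swalk_def inj_on_def)
    then have "(i + k + (n - 1) * k) mod n = (j + k + (n - 1) * k) mod n" by (rule mod_add_cong) simp
    moreover have "x + k + (n - 1) * k = x + k * n" for x using w by (cases n) (auto simp: walk_def)
    ultimately have "(i + k * n) mod n = (j + k * n) mod n" by metis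
    then have "i mod n = j mod n" by simp
    then show "i = j" using ij by simp
  qed
  ultimately show ?thesis by (simp add: swalk_def)
qed

text \<open>If a left cycle traverses an arc in both directions, it splits at that arc into two closed walks.
  The left winding number of each of them is constant along the cycle and at least 1, but at an
  exposed vertex of the whole cycle only one of the two walks passes.\<close>

lemma left_cycle_no_reversal_0:
  assumes g: "swalk g n" and pos: "\<And>i. h \<bullet> snd (g i) > 0" and ls: "\<And>i. lstep (g i) (g (Suc i))"
    and k: "0 < k" "k < n"
  shows "g k \<noteq> prod.swap (g 0)"
proof
  assume rev: "g k = prod.swap (g 0)"
  let ?d1 = "\<lambda>i. g (i mod k)" and ?g' = "\<lambda>i. g (i + k)"
  let ?d2 = "\<lambda>i. ?g' (i mod (n - k))"
  have w: "walk g n" using g by (auto simp: swalk_def)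
  have gS: "g i \<in> S" "snd (g i) \<in> ocone (g (Suc i))" for i using w by (auto simp: walk_def)
  have gn: "g n = g 0" using w by (auto simp: walk_def dest: spec[of _ 0])
  have R1: "crossings ?d1 k (g i) (snd (g i)) \<ge> 1" for i
    by (rule subwalk_crossings_ge_1[OF g pos ls k rev])
  have g': "swalk ?g' n" by (rule swalk_shift[OF g])
  have rev': "?g' (n - k) = prod.swap (?g' 0)" using k rev gn by simp
  have R2: "crossings ?d2 (n - k) (?g' i) (snd (?g' i)) \<ge> 1" for i
    using subwalk_crossings_ge_1[OF g' _ _ _ _ rev', where h = h] pos ls k by simp
  \<comment> \<open>Undoes the shift of the index; adding \<open>k * n\<close> keeps the subtraction
    on naturals exact.\<close>
  have R2: "crossings ?d2 (n - k) (g i) (snd (g i)) \<ge> 1" for i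
  proof -
    have "k \<le> k * n" using k by simp
    then have "i + k * n - k + k = i + k * n" by linarith
    then have "?g' (i + k * n - k) = g i" using walk_period[OF w] by metis
    then show ?thesis using R2[of "i + k * n - k"] by metis
  qed
  let ?V = "(\<lambda>i. snd (g i)) ` {..<n}"
  have V: "snd (g i) \<in> ?V" for i using walk_mod[OF w, of i] k
    by (metis (mono_tags, lifting) imageI lessThan_iff mod_less_divisor order.strict_trans)
  have "snd (g 0) \<noteq> fst (g 0)" using indep[OF gS(1)[of 0]] by (metis cross_refl)
  moreover have fst0: "fst (g 0) = snd (g k)" by (simp add: rev)
  ultimately have ne: "snd (g 0) \<noteq> snd (g k)" by simp
  have fin: "finite ?V" by simp
  have Vp: "norm x = 1 \<and> h \<bullet> x > 0" if "x \<in> ?V" for x using that unit[OF gS(1)] pos by auto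
  obtain v l where v: "v \<in> ?V" "l \<bullet> v = 0" "\<forall>x\<in>?V. x \<noteq> v \<longrightarrow> l \<bullet> x < 0"
    using exposed_point[OF fin Vp V ne V] by blast
  then obtain j where j: "j < n" "v = snd (g j)" by auto
  have ex: "snd (g i) = v \<or> l \<bullet> snd (g i) < 0" for i using v(3) V by blast
  \<comment> \<open>An exposed vertex cannot be interior to an arc whose two ends are both vertices
    of the cycle. This applies to \<open>g 0\<close>, since its tail is the head of
    \<open>g k\<close>.\<close>
  have notin: "v \<notin> ocone (g i)" if "fst (g i) = snd (g m)" for i m
  proof
    assume o: "v \<in> ocone (g i)"
    then have "snd (g i) \<noteq> v" "snd (g m) \<noteq> v" using ends_not_ocone[OF gS(1)[of i]] that by auto
    then have "l \<bullet> snd (g i) < 0" "l \<bullet> fst (g i) < 0" using ex that by metis+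
    moreover obtain x y where "x > 0" "y > 0" "v = x *\<^sub>R fst (g i) + y *\<^sub>R snd (g i)" using o by (auto simp: ocone_def)
    ultimately have "l \<bullet> v < 0" by (simp add: inner_add_right add_neg_neg mult_pos_neg)
    then show False using v by simp
  qed
  have "v \<notin> ocone (g 0)" "v \<in> ocone (g (Suc j))" using notin[OF fst0] gS(2)[of j] j by auto
  moreover have "ocone (g k) = ocone (g 0)" by (simp add: rev)
  \<comment> \<open>So the turn at the exposed vertex is not at a splitting point: the outgoing arc
    belongs to exactly one of the two walks.\<close>
  ultimately have "Suc j \<noteq> k" "Suc j \<noteq> n" using gn by metis+
  obtain p where p: "snd (g p) \<in> ocone (g j)" using walk_prev[OF w] by blast
  have lp: "l \<bullet> snd (g p) < 0" using ends_not_ocone[OF gS(1)] p ex j by metis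
  note ee = edge_exposed(1)[OF p lp]
  have ginj: "a = b" if "g a = g b" "a < n" "b < n" for a b using that g by (auto simp: swalk_def inj_on_def)
  \<comment> \<open>A positive count of the other walk would force one of its edges to leave the
    exposed vertex to the left of \<open>g j\<close>, hence along \<open>g (Suc j)\<close>, which
    that walk does not contain.\<close>
  have key: False if d: "crossings d m (g j) (snd (g j)) \<ge> 1" "walk d m" and sub: "\<And>i. \<exists>a. d i = g a \<and> P a"
      and nP: "\<And>a. P a \<Longrightarrow> g a \<noteq> g (Suc j)" for d m P
  proof -
    obtain i where i: "\<not> left_of (g j) (snd (d i))" "left_of (g j) (snd (d (Suc i)))" "dt (snd (g j)) (snd (d i)) (snd (d (Suc i))) \<ge> 0"
      using crossings_pos_edge[OF d(1)] by metis
    have exd: "snd (d i) = snd (g j) \<or> l \<bullet> snd (d i) < 0" for i using sub[of i] ex j by metis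
    have vi: "snd (d i) = v" using ee[OF _ exd exd i] v j by simp
    obtain a where a: "d (Suc i) = g a" "P a" using sub by blast
    have "v \<in> ocone (g a)" using d(2) vi a by (metis walk_def)
    then have "g a = g (Suc j) \<or> g a = prod.swap (g (Suc j))" using disj gS j by blast
    moreover have "g a \<noteq> prod.swap (g (Suc j))"
    proof
      assume "g a = prod.swap (g (Suc j))"
      then have 1: "left_of (g j) (fst (g (Suc j)))" using i(2) a by simp
      have 2: "left_of (g j) (snd (g (Suc j)))" using lstep_lt[OF ls] .
      obtain x y where xy: "x > 0" "y > 0" "snd (g j) = x *\<^sub>R fst (g (Suc j)) + y *\<^sub>R snd (g (Suc j))"
        using gS(2)[of j] by (auto simp: ocone_def)
      have "dt (fst (g j)) (snd (g j)) (snd (g j)) = x * dt (fst (g j)) (snd (g j)) (fst (g (Suc j))) + y * dt (fst (g j)) (snd (g j)) (snd (g (Suc j)))"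
        using arg_cong[OF xy(3), of "dt (fst (g j)) (snd (g j))"] by (simp only: dt_lin)
      moreover have "\<dots> > 0" using 1 2 xy(1,2) by (simp add: left_of_def add_pos_pos)
      ultimately show False by simp
    qed
    ultimately show False using nP a by blast
  qed
  show False
  proof (cases "j < k")
    case True
    then have sj: "Suc j < k" using \<open>Suc j \<noteq> k\<close> by simp
    show False
    proof (rule key[OF R2, where P = "\<lambda>a. k \<le> a \<and> a < n"])
      show "walk ?d2 (n - k)" using subwalk[OF g' _ _ rev'] k by (simp add: swalk_def)
      show "\<exists>a. ?d2 i = g a \<and> k \<le> a \<and> a < n" for i
      proof -
        have "i mod (n - k) < n - k" using k by simp
        then have "k \<le> i mod (n - k) + k \<and> i mod (n - k) + k < n" by linarith
        then show ?thesis by blast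
      qed
      show "g a \<noteq> g (Suc j)" if "k \<le> a \<and> a < n" for a
        using ginj[of a "Suc j"] that sj k by auto
    qed
  next
    case False
    then have sj: "Suc j < n" using \<open>Suc j \<noteq> n\<close> j by simp
    show False
    proof (rule key[OF R1, where P = "\<lambda>a. a < k"])
      show "walk ?d1 k" using subwalk[OF g k rev] by (simp add: swalk_def)
      show "\<exists>a. ?d1 i = g a \<and> a < k" for i using k by (intro exI[of _ "i mod k"]) auto
      show "g a \<noteq> g (Suc j)" if "a < k" for a
        using ginj[of a "Suc j"] that sj False k by auto
    qed
  qed
qed

lemma left_cycle_no_reversal:
  assumes g: "swalk g n" and pos: "\<And>i. h \<bullet> snd (g i) > 0" and ls: "\<And>i. lstep (g i) (g (Suc i))"
  shows "g j \<noteq> prod.swap (g i)"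
proof
  assume rev: "g j = prod.swap (g i)"
  have w: "walk g n" "n > 0" using g by (auto simp: swalk_def walk_def)
  define k where "k = (j + i * n - i) mod n"
  have "i \<le> i * n" using w by simp
  have "g (k + i) = g ((k + i) mod n)" using walk_mod[OF w(1)] by simp
  also have "(k + i) mod n = (j + i * n - i + i) mod n" unfolding k_def by (rule mod_add_left_eq)
  also have "j + i * n - i + i = j + i * n" using \<open>i \<le> i * n\<close> by linarith
  also have "g (\<dots> mod n) = g j" using walk_mod[OF w(1)] walk_period[OF w(1)] by simp
  finally have k: "g (k + i) = prod.swap (g (0 + i))" using rev by simp
  have "k < n" using w by (simp add: k_def)
  moreover have "k \<noteq> 0"
  proof
    assume "k = 0"
    then show False using k swap_neq[of "g i"] w by (simp add: walk_def)
  qed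
  ultimately show False
    using left_cycle_no_reversal_0[OF swalk_shift[OF g], of h i k] pos ls k by simp
qed

end


text \<open>The least distance between two equal values gives a period without internal repetition;
  the offset \<open>m\<close> skips the part before the cycle.\<close>

lemma eventual_cycle:
  fixes f :: "nat \<Rightarrow> 'a"
  assumes fin: "finite A" and fA: "\<And>i. f i \<in> A" and step: "\<And>i. f (Suc i) = F (f i)"
  shows "\<exists>m n. n > 0 \<and> (\<forall>i. f (m + (i + n)) = f (m + i)) \<and> inj_on (\<lambda>i. f (m + i)) {..<n}"
proof -
  define P where "P = (\<lambda>d. d > 0 \<and> (\<exists>m. f (m + d) = f m))"
  have "\<not> inj f" using fin fA by (meson finite_imageD finite_subset image_subsetI infinite_UNIV_nat rangeI)
  then obtain i j where "i \<noteq> j" "f i = f j" by (auto simp: inj_def)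
  then obtain i j where ij: "i < j" "f i = f j" by (metis linorder_neqE_nat)
  then have "P (j - i)" by (auto simp: P_def intro!: exI[of _ i])
  define n where "n = (LEAST d. P d)"
  have "P n" unfolding n_def by (rule LeastI) fact
  then obtain m where m: "n > 0" "f (m + n) = f m" by (auto simp: P_def)
  have per: "f (m + (i + n)) = f (m + i)" for i
    by (induction i) (simp_all add: m step)
  have ne: "f (m + i) \<noteq> f (m + j)" if "i < j" "j < n" for i j
  proof
    assume "f (m + i) = f (m + j)"
    then have "P (j - i)" using that by (auto simp: P_def intro!: exI[of _ "m + i"])
    then have "n \<le> j - i" unfolding n_def by (rule Least_le)
    then show False using that by simp
  qed
  have "inj_on (\<lambda>i. f (m + i)) {..<n}"
    by (rule linorder_inj_onI) (use ne in auto)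
  then show ?thesis using m per by blast
qed

context arrangement begin

text \<open>Membership of the head in \<open>K\<close> and a count of at least 1 are preserved
  together: the count keeps the next head in \<open>K\<close>, and being in the hemisphere keeps the
  count from dropping.\<close>

lemma left_cycle_in_cone:
  assumes K: "pointed_cone K h" and g: "walk g n" and gK: "\<And>i. snd (g i) \<in> K"
    and b: "b \<in> S" "snd b \<in> K" "crossings g n b (snd b) \<ge> 1"
  shows "\<exists>g' n'. swalk g' n' \<and> (\<forall>i. lstep (g' i) (g' (Suc i))) \<and> (\<forall>i. snd (g' i) \<in> K)"
proof -
  define F where "F = (\<lambda>b. SOME c. lstep b c)"
  have F: "lstep b (F b)" if "b \<in> S" for b
    unfolding F_def using lstep_exists[OF that] by (rule someI_ex)
  define f where "f = (\<lambda>i. (F ^^ i) b)"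
  have hK: "x \<in> K \<Longrightarrow> h \<bullet> x > 0" for x using K by (auto simp: pointed_cone_def)
  have inv: "f i \<in> S \<and> snd (f i) \<in> K \<and> crossings g n (f i) (snd (f i)) \<ge> 1" for i
  proof (induction i)
    case 0
    then show ?case using b by (simp add: f_def)
  next
    case (Suc i)
    have ls: "lstep (f i) (f (Suc i))" using F Suc by (simp add: f_def)
    then have K': "snd (f (Suc i)) \<in> K" using crossings_trap[OF K g gK ls] Suc by blast
    then have "crossings g n (f i) (snd (f i)) \<le> crossings g n (f (Suc i)) (snd (f (Suc i)))"
      using Suc by (intro crossings_mono_end[OF g _ ls, where h = h] hK gK) auto
    then show ?case using ls K' Suc by (auto simp: lstep_def)
  qed
  have ls: "lstep (f i) (f (Suc i))" for i using F inv by (simp add: f_def)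
  have fS: "f i \<in> S" and fF: "f (Suc i) = F (f i)" for i using inv by (auto simp: f_def)
  obtain m k where mk: "k > 0" "\<forall>i. f (m + (i + k)) = f (m + i)" "inj_on (\<lambda>i. f (m + i)) {..<k}"
    using eventual_cycle[where f = f and F = F and A = S, OF fin fS fF] by blast
  have "snd (f i) \<in> ocone (f (Suc i))" for i using ls[of i] by (simp add: lstep_def)
  then have "swalk (\<lambda>i. f (m + i)) k" using mk fS by (simp add: swalk_def walk_def)
  moreover have "lstep (f (m + i)) (f (m + Suc i))" "snd (f (m + i)) \<in> K" for i using ls[of "m + i"] inv by auto
  ultimately show ?thesis by blast
qed

end

section \<open>Swirls in cones\<close>

definition dirs :: "arc set \<Rightarrow> arc set" where
  "dirs D = D \<union> prod.swap ` D"

definition und :: "arc set \<Rightarrow> arc \<Rightarrow> arc" where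
  "und D b = (if b \<in> D then b else prod.swap b)"

lemma und: "b \<in> dirs D \<Longrightarrow> und D b \<in> D" "und D b = b \<or> und D b = prod.swap b" "ocone (und D b) = ocone b"
  by (auto simp: dirs_def und_def)

lemma SD_arrangement:
  assumes D: "is_SD D" and t: "t = 1 \<or> t = - 1"
  shows "arrangement (dirs D) t"
proof
  have val: "valid_arc a" if "a \<in> D" for a using D that by (auto simp: is_SD_def)
  show "finite (dirs D)" using D by (simp add: dirs_def is_SD_def)
  show "prod.swap b \<in> dirs D" if "b \<in> dirs D" for b using that by (auto simp: dirs_def)
  show cr: "cross3 (fst b) (snd b) \<noteq> 0" if b: "b \<in> dirs D" for b
  proof -
    have "cross3 (fst (und D b)) (snd (und D b)) \<noteq> 0" using valid_cross val und(1)[OF b] by blast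
    then show ?thesis using und(2)[of D b] cross_skew[of "fst b" "snd b"] by auto
  qed
  show "c = b \<or> c = prod.swap b" if bc: "b \<in> dirs D" "c \<in> dirs D" and x: "x \<in> ocone b" "x \<in> ocone c" for b c x
  proof -
    have "x \<noteq> 0"
    proof
      assume "x = 0"
      then obtain p q where pq: "p > 0" "0 = p *\<^sub>R fst b + q *\<^sub>R snd b" using x by (auto simp: ocone_def)
      have "cross3 0 (snd b) = p *\<^sub>R cross3 (fst b) (snd b)"
        by (subst pq(2)) (simp add: cross_add_left cross_mult_left)
      then show False using cr[OF bc(1)] pq by simp
    qed
    have s: "sgn x \<in> ocone a" if "x \<in> ocone a" for a
    proof -
      obtain p q where "p > 0" "q > 0" "x = p *\<^sub>R fst a + q *\<^sub>R snd a" using \<open>x \<in> ocone a\<close> by (auto simp: ocone_def)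
      then show ?thesis using \<open>x \<noteq> 0\<close> oconeI[of "p / norm x" "q / norm x" a]
        by (simp add: sgn_div_norm scaleR_add_right divide_inverse_commute)
    qed
    have "sgn x \<in> arc_relint (und D b)" "sgn x \<in> arc_relint (und D c)"
      using s[OF x(1)] s[OF x(2)] \<open>x \<noteq> 0\<close> by (auto intro!: ocone_imp_relint simp: und(3) norm_sgn)
    then have "und D b = und D c" using D und(1) bc unfolding is_SD_def by blast
    then show ?thesis using und(2)[of D b] und(2)[of D c] by (auto simp: prod_eq_iff)
  qed
  show "\<exists>c\<in>dirs D. snd b \<in> ocone c" if b: "b \<in> dirs D" for b
  proof -
    have "und D b \<in> D" by (rule und(1)[OF b])
    then obtain c d where "c \<in> D" "fst (und D b) \<in> arc_relint c" "d \<in> D" "snd (und D b) \<in> arc_relint d"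
      using D by (meson is_SD_def)
    then have "\<exists>c\<in>D. snd b \<in> arc_relint c" using und(2)[of D b] by auto
    then show ?thesis using relint_imp_ocone val unfolding dirs_def by blast
  qed
  show "norm (snd b) = 1" if b: "b \<in> dirs D" for b
    using val[OF und(1)[OF b]] und(2)[of D b] by (auto simp: valid_arc_def on_sphere_def)
  show "t = 1 \<or> t = - 1" by fact
qed

definition swirl_ends :: "arc list \<Rightarrow> (nat \<Rightarrow> point) \<Rightarrow> (nat \<Rightarrow> point) \<Rightarrow> bool" where
  "swirl_ends xs s e \<longleftrightarrow>
        (\<forall>i<length xs. xs ! i = (s i, e i) \<or> xs ! i = (e i, s i)) \<and>
        (\<forall>i<length xs. e i \<in> arc_relint (xs ! ((i + 1) mod length xs))) \<and>
        ((\<forall>i<length xs. det3 (s i) (e i) (e ((i + 1) mod length xs)) > 0) \<or>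
         (\<forall>i<length xs. det3 (s i) (e i) (e ((i + 1) mod length xs)) < 0))"

lemma is_swirl_alt: "is_swirl D xs \<longleftrightarrow> xs \<noteq> [] \<and> distinct xs \<and> set xs \<subseteq> D \<and> (\<exists>s e. swirl_ends xs s e)"
  by (simp add: is_swirl_def swirl_ends_def)

text \<open>The absence of reversals makes the underlying arcs distinct, as \<open>is_swirl\<close>
  demands.\<close>

lemma swirl_of_left_cycle:
  assumes D: "is_SD D" and t: "t = 1 \<or> t = - 1"
    and g: "arrangement.swalk (dirs D) g n" and ls: "\<And>i. arrangement.lstep (dirs D) t (g i) (g (Suc i))"
    and pos: "\<And>i. h \<bullet> snd (g i) > 0"
  shows "\<exists>xs. is_swirl D xs \<and> swirl_ends xs (\<lambda>i. fst (g i)) (\<lambda>i. snd (g i))"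
proof -
  interpret arrangement "dirs D" t by (rule SD_arrangement[OF D t])
  have w: "walk g n" "n > 0" using g by (auto simp: swalk_def walk_def)
  have gS: "g i \<in> dirs D" "snd (g i) \<in> ocone (g (Suc i))" for i using w by (auto simp: walk_def)
  define xs where "xs = map (\<lambda>i. und D (g i)) [0..<n]"
  have len: "length xs = n" by (simp add: xs_def)
  have nth: "xs ! i = und D (g i)" if "i < n" for i using that by (simp add: xs_def)
  have nth': "xs ! ((i + 1) mod n) = und D (g (Suc i))" for i
    using w nth[of "Suc i mod n"] walk_mod[OF w(1)] by simp
  have inj: "inj_on (\<lambda>i. und D (g i)) {..<n}"
  proof (rule inj_onI)
    fix i j assume ij: "i \<in> {..<n}" "j \<in> {..<n}" "und D (g i) = und D (g j)"
    then have "g i = g j \<or> g i = prod.swap (g j)" using und(2)[of D "g i"] und(2)[of D "g j"] by (auto simp: prod_eq_iff)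
    then have "g i = g j" using left_cycle_no_reversal[OF g pos ls] by blast
    then show "i = j" using g ij by (auto simp: swalk_def inj_on_def)
  qed
  have se: "swirl_ends xs (\<lambda>i. fst (g i)) (\<lambda>i. snd (g i))"
    unfolding swirl_ends_def len
  proof (intro conjI allI impI)
    fix i assume i: "i < n"
    show "xs ! i = (fst (g i), snd (g i)) \<or> xs ! i = (snd (g i), fst (g i))"
      using nth[OF i] und(2)[of D "g i"] by (auto simp: prod_eq_iff)
    show "snd (g i) \<in> arc_relint (xs ! ((i + 1) mod n))"
      unfolding nth' using gS by (intro ocone_imp_relint) (auto simp: und(3) unit)
  next
    have "t * det3 (fst (g i)) (snd (g i)) (snd (g (Suc i))) > 0" for i
      using lstep_lt[OF ls] by (simp add: left_of_def dt_def)
    then have *: "t * det3 (fst (g i)) (snd (g i)) (snd (g ((i + 1) mod n))) > 0" for i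
      using walk_mod[OF w(1)] by simp
    show "(\<forall>i<n. det3 (fst (g i)) (snd (g i)) (snd (g ((i + 1) mod n))) > 0) \<or>
          (\<forall>i<n. det3 (fst (g i)) (snd (g i)) (snd (g ((i + 1) mod n))) < 0)"
      using t * by (cases "t = 1") auto
  qed
  have "distinct xs" using inj by (simp add: xs_def distinct_map atLeast0LessThan)
  moreover have "set xs \<subseteq> D" unfolding xs_def set_map using und(1)[OF gS(1)] by blast
  moreover have "xs \<noteq> []" using len w by auto
  ultimately have "is_swirl D xs" using se by (auto simp: is_swirl_alt)
  then show ?thesis using se by blast
qed

lemma swirl_of_walk_in_cone:
  assumes D: "is_SD D" and K: "pointed_cone K h"
    and g: "arrangement.swalk (dirs D) g n" and gK: "\<And>i. snd (g i) \<in> K"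
  shows "\<exists>xs s e. is_swirl D xs \<and> swirl_ends xs s e \<and> (\<forall>i. e i \<in> K)"
proof -
  interpret A: arrangement "dirs D" 1 by (rule SD_arrangement[OF D]) simp
  have hK: "x \<in> K \<Longrightarrow> h \<bullet> x > 0" for x using K by (auto simp: pointed_cone_def)
  have w: "A.walk g n" "n > 0" using g by (auto simp: A.swalk_def A.walk_def)
  have gS: "g i \<in> dirs D" "snd (g i) \<in> ocone (g (Suc i))" for i using w by (auto simp: A.walk_def)
  let ?V = "(\<lambda>i. snd (g i)) ` {..<n}"
  have V: "snd (g i) \<in> ?V" for i using A.walk_mod[OF w(1), of i] w
    by (metis (mono_tags, lifting) imageI lessThan_iff mod_less_divisor)
  have ne: "snd (g 0) \<noteq> snd (g 1)" using gS A.ends_not_ocone by (metis One_nat_def)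
  have fin: "finite ?V" by simp
  have Vp: "norm x = 1 \<and> h \<bullet> x > 0" if "x \<in> ?V" for x using that A.unit[OF gS(1)] hK gK by auto
  obtain v l where v: "v \<in> ?V" "l \<bullet> v = 0" "\<forall>x\<in>?V. x \<noteq> v \<longrightarrow> l \<bullet> x < 0"
    using exposed_point[OF fin Vp V ne V] by blast
  then obtain j where j: "j < n" "v = snd (g j)" by auto
  let ?b = "g j" and ?c = "g (Suc j)"
  have "A.dt (fst ?c) (snd ?c) (fst ?b) \<noteq> 0" by (rule A.transversal[OF gS(1) gS(1) gS(2)])
  then have dn: "det3 (fst ?c) (snd ?c) (fst ?b) \<noteq> 0" by (simp add: A.dt_def)
  \<comment> \<open>The orientation in which the turn at the exposed vertex counts as a left turn.
    The first interpretation, with sign 1, serves only facts that do not depend on it.\<close>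
  define t :: real where "t = (if det3 (fst ?c) (snd ?c) (fst ?b) > 0 then 1 else - 1)"
  have t: "t = 1 \<or> t = - 1" by (simp add: t_def)
  interpret arrangement "dirs D" t by (rule SD_arrangement[OF D t])
  have ls: "lstep ?b ?c" unfolding lstep_def left_of_def dt_def using gS dn by (auto simp: t_def)
  have "crossings g n ?b (snd ?b) \<ge> 1"
  proof (rule crossings_exposed_ge_1[OF g ls, where l = l])
    show "l \<bullet> snd ?b = 0" using v j by simp
    show "l \<bullet> snd (g i) < 0" if "snd (g i) \<noteq> snd ?b" for i using v(3) V[of i] that j by metis
  qed
  then obtain g' n' where g': "swalk g' n'" "\<forall>i. lstep (g' i) (g' (Suc i))" "\<forall>i. snd (g' i) \<in> K"
    using left_cycle_in_cone[OF K w(1) gK gS(1) gK] by blast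
  have "\<exists>xs. is_swirl D xs \<and> swirl_ends xs (\<lambda>i. fst (g' i)) (\<lambda>i. snd (g' i))"
    using g' hK by (intro swirl_of_left_cycle[OF D t g'(1), where h = h]) auto
  then show ?thesis using g'(3) by blast
qed

lemma coplanar_det3:
  assumes "l \<noteq> 0" "l \<bullet> u = 0" "l \<bullet> v = 0" "l \<bullet> w = 0"
  shows "det3 u v w = 0"
proof -
  have "det3 u v w *\<^sub>R l = (l \<bullet> u) *\<^sub>R cross3 v w + (l \<bullet> v) *\<^sub>R cross3 w u + (l \<bullet> w) *\<^sub>R cross3 u v"
    by (simp add: vec_eq_iff forall_3 det3_expand cross3_def inner_vec_def sum_3) (simp add: algebra_simps)
  then show ?thesis using assms by simp
qed

section \<open>Every open hemisphere contains a vertex\<close>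

context arrangement begin

text \<open>A vertex on a supporting plane drags its blocking arc into the plane, and then the arc
  blocking that one; two coplanar arcs cannot block each other.\<close>

lemma no_supporting_plane:
  assumes l: "l \<noteq> 0" and le: "\<And>b. b \<in> S \<Longrightarrow> l \<bullet> snd b \<le> 0" and b: "b \<in> S" "l \<bullet> snd b = 0"
  shows False
proof -
  have ends: "c \<in> S \<and> l \<bullet> fst c = 0 \<and> l \<bullet> snd c = 0" if "b \<in> S" "l \<bullet> snd b = 0" "c \<in> S" "snd b \<in> ocone c" for b c
  proof -
    obtain x y where xy: "x > 0" "y > 0" "snd b = x *\<^sub>R fst c + y *\<^sub>R snd c" using \<open>snd b \<in> ocone c\<close> by (auto simp: ocone_def)
    have "x * (l \<bullet> fst c) + y * (l \<bullet> snd c) = 0" using \<open>l \<bullet> snd b = 0\<close> by (simp add: xy(3) inner_add_right)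
    moreover have "l \<bullet> fst c \<le> 0" "l \<bullet> snd c \<le> 0" using le[OF \<open>c \<in> S\<close>] le[OF swapS[OF \<open>c \<in> S\<close>]] by auto
    moreover from this have "x * (l \<bullet> fst c) \<le> 0" "y * (l \<bullet> snd c) \<le> 0" using xy by (auto simp: mult_le_0_iff)
    ultimately have "x * (l \<bullet> fst c) = 0" "y * (l \<bullet> snd c) = 0" by linarith+
    then show ?thesis using xy(1,2) that(3) by simp
  qed
  obtain c where c: "c \<in> S" "snd b \<in> ocone c" using blocked[OF b(1)] by blast
  have c0: "l \<bullet> fst c = 0" "l \<bullet> snd c = 0" using ends[OF b c] by auto
  obtain d where d: "d \<in> S" "snd c \<in> ocone d" using blocked[OF c(1)] by blast
  have "l \<bullet> fst d = 0" "l \<bullet> snd d = 0" using ends[OF c(1) c0(2) d] by auto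
  then have "dt (fst d) (snd d) (fst c) = 0" using coplanar_det3[OF l _ _ c0(1)] by (simp add: dt_def)
  then show False using transversal[OF c(1) d] by simp
qed

text \<open>Otherwise all vertices lie strictly on the other side; rotating the plane about an axis
  until it first touches a vertex yields a supporting plane.\<close>

lemma vertex_in_hemisphere:
  assumes h: "h \<noteq> 0" and ne: "S \<noteq> {}"
  shows "\<exists>b\<in>S. h \<bullet> snd b > 0"
proof (rule ccontr)
  assume "\<not> ?thesis"
  then have le: "h \<bullet> snd b \<le> 0" if "b \<in> S" for b using that by force
  then have neg: "h \<bullet> snd b < 0" if "b \<in> S" for b using no_supporting_plane[OF h le, of b] le[OF that] that by force
  obtain g :: point where g: "g \<noteq> 0" "g \<bullet> h = 0"
  proof -
    obtain b where b: "b \<in> S" using ne by blast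
    have "cross3 h (fst b) \<noteq> 0 \<or> cross3 h (snd b) \<noteq> 0"
    proof (rule ccontr)
      assume "\<not> ?thesis"
      then have "collinear {0, h, fst b}" "collinear {0, h, snd b}" by (simp_all add: cross_eq_0)
      then obtain x y where "fst b = x *\<^sub>R h" "snd b = y *\<^sub>R h" using h by (metis collinear_lemma scaleR_zero_left)
      then show False using indep[OF b] by (simp add: cross_mult_left cross_mult_right)
    qed
    then show ?thesis using that dot_cross_self(3) by (metis dot_cross_self(1) inner_commute)
  qed
  \<comment> \<open>The amount of rotation at which \<open>g + r *\<^sub>R h\<close> first vanishes
    at some vertex while staying nonpositive at all others.\<close>
  define r where "r = Max ((\<lambda>b. (g \<bullet> snd b) / (- (h \<bullet> snd b))) ` S)"
  have "r \<in> (\<lambda>b. (g \<bullet> snd b) / (- (h \<bullet> snd b))) ` S" unfolding r_def using fin ne by (intro Max_in) auto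
  then obtain b where b: "b \<in> S" "r = (g \<bullet> snd b) / (- (h \<bullet> snd b))" by auto
  have rb: "(g \<bullet> snd b) / (- (h \<bullet> snd b)) \<le> r" if "b \<in> S" for b using that fin by (simp add: r_def)
  show False
  proof (rule no_supporting_plane[of "g + r *\<^sub>R h" b])
    show "g + r *\<^sub>R h \<noteq> 0"
    proof
      assume "g + r *\<^sub>R h = 0"
      then have "g \<bullet> (g + r *\<^sub>R h) = 0" by simp
      then have "g \<bullet> g = 0" using g by (simp add: inner_add_right)
      then show False using g by simp
    qed
    show "(g + r *\<^sub>R h) \<bullet> snd a \<le> 0" if "a \<in> S" for a
      using rb[OF that] neg[OF that] by (simp add: inner_add_left field_simps)
    show "b \<in> S" by (rule b)
    show "(g + r *\<^sub>R h) \<bullet> snd b = 0" unfolding inner_add_left inner_scaleR_left b(2) using neg[OF b(1)] by (simp add: field_simps)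
  qed
qed

end

text \<open>Since neither \<open>p\<close> nor its antipode lies on the arc, the coefficients of
  \<open>p\<close> over the two ends have opposite signs; the positive one marks the head.\<close>

lemma arc_toward:
  assumes a: "valid_arc a" and p: "on_sphere p" "det3 (fst a) (snd a) p = 0" "p \<notin> arc_points a" "- p \<notin> arc_points a"
  obtains b \<alpha> \<beta> where "b = a \<or> b = prod.swap a" "\<alpha> > 0" "\<beta> > 0" "snd b = \<alpha> *\<^sub>R fst b + \<beta> *\<^sub>R p"
proof -
  obtain x y where xy: "p = x *\<^sub>R fst a + y *\<^sub>R snd a" using plane_span[OF valid_cross[OF a] p(2)] by blast
  have pt: "q \<in> arc_points a" if "norm q = 1" "q = x *\<^sub>R fst a + y *\<^sub>R snd a" "x \<ge> 0" "y \<ge> 0" for q x y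
  proof -
    have "x + y > 0" using that by (cases "x = 0"; cases "y = 0") auto
    define t where "t = y / (x + y)"
    have t: "0 \<le> t" "t \<le> 1" "1 - t = x / (x + y)" using that \<open>x + y > 0\<close> by (auto simp: t_def field_simps)
    have "(1 - t) *\<^sub>R fst a + t *\<^sub>R snd a = (1 / (x + y)) *\<^sub>R q"
      unfolding t(3) unfolding t_def that(2) by (simp add: scaleR_add_right)
    then have "sgn ((1 - t) *\<^sub>R fst a + t *\<^sub>R snd a) = sgn q" using \<open>x + y > 0\<close> by (simp add: sgn_scaleR)
    also have "sgn q = q" using that by (simp add: sgn_div_norm)
    finally have "q = sgn ((1 - t) *\<^sub>R fst a + t *\<^sub>R snd a)" by simp
    then show ?thesis using t(1,2) unfolding arc_points_def by auto
  qed
  have nn: "\<not> (x \<ge> 0 \<and> y \<ge> 0)" using pt[OF _ xy] p by (auto simp: on_sphere_def)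
  have "norm (- p) = 1" using p(1) by (simp add: on_sphere_def)
  moreover have "- p = (- x) *\<^sub>R fst a + (- y) *\<^sub>R snd a" using xy by simp
  ultimately have "\<not> (- x \<ge> 0 \<and> - y \<ge> 0)" using pt p by blast
  with nn consider "x > 0" "y < 0" | "x < 0" "y > 0" by linarith
  then show ?thesis
  proof cases
    case 1
    have "fst a = (1 / x) *\<^sub>R (x *\<^sub>R fst a)" using 1 by simp
    also have "x *\<^sub>R fst a = p + (- y) *\<^sub>R snd a" by (simp add: xy)
    finally have "fst a = (- y / x) *\<^sub>R snd a + (1 / x) *\<^sub>R p" by (simp add: algebra_simps)
    then show ?thesis using 1 that[of "prod.swap a" "- y / x" "1 / x"] by (simp add: divide_neg_pos)
  next
    case 2
    have "snd a = (1 / y) *\<^sub>R (y *\<^sub>R snd a)" using 2 by simp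
    also have "y *\<^sub>R snd a = p + (- x) *\<^sub>R fst a" by (simp add: xy)
    finally have "snd a = (- x / y) *\<^sub>R fst a + (1 / y) *\<^sub>R p" by (simp add: algebra_simps)
    then show ?thesis using 2 that[of a "- x / y" "1 / y"] by (simp add: divide_neg_pos)
  qed
qed

lemma toward_from_interior:
  assumes b: "snd b = \<alpha> *\<^sub>R fst b + \<beta> *\<^sub>R p" "\<alpha> > 0" "\<beta> > 0" and q: "q \<in> ocone b"
  obtains \<alpha>' \<beta>' where "\<alpha>' > 0" "\<beta>' > 0" "snd b = \<alpha>' *\<^sub>R q + \<beta>' *\<^sub>R p"
proof -
  obtain x y where xy: "x > 0" "y > 0" "q = x *\<^sub>R fst b + y *\<^sub>R snd b" using q by (auto simp: ocone_def)
  have "x * \<beta> > 0" "\<alpha> * y > 0" using xy b by auto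
  have "\<alpha> *\<^sub>R q = x *\<^sub>R (\<alpha> *\<^sub>R fst b) + (\<alpha> * y) *\<^sub>R snd b" by (simp add: xy(3) algebra_simps)
  also have "\<alpha> *\<^sub>R fst b = snd b - \<beta> *\<^sub>R p" by (simp add: b(1))
  finally have eq: "(x + \<alpha> * y) *\<^sub>R snd b = \<alpha> *\<^sub>R q + (x * \<beta>) *\<^sub>R p" by (simp add: algebra_simps)
  have pos: "x + \<alpha> * y > 0" using xy \<open>\<alpha> * y > 0\<close> by simp
  then have "snd b = (1 / (x + \<alpha> * y)) *\<^sub>R ((x + \<alpha> * y) *\<^sub>R snd b)" by simp
  also have "\<dots> = (\<alpha> / (x + \<alpha> * y)) *\<^sub>R q + (x * \<beta> / (x + \<alpha> * y)) *\<^sub>R p"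
    unfolding eq by (simp add: scaleR_add_right)
  finally show ?thesis using that[of "\<alpha> / (x + \<alpha> * y)" "x * \<beta> / (x + \<alpha> * y)"] pos b \<open>x * \<beta> > 0\<close> by simp
qed


text \<open>Each step towards a signed pole replaces the current vertex by a positive multiple of it
  plus an element of \<open>K\<close>. The start need only satisfy \<open>h > 0\<close>; periodicity
  then puts the cycle inside \<open>K\<close>.\<close>

lemma swirl_in_cone:
  assumes D: "is_SD D" and orient: "oriented k D P f" and K: "pointed_cone K h"
    and poles: "\<And>p. p \<in> P \<Longrightarrow> p \<in> K \<or> - p \<in> K"
  shows "\<exists>xs s e. is_swirl D xs \<and> swirl_ends xs s e \<and> (\<forall>i. e i \<in> K)"
proof -
  interpret arrangement "dirs D" 1 by (rule SD_arrangement[OF D]) simp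
  have hK: "x \<in> K \<Longrightarrow> h \<bullet> x > 0" and addK: "x \<in> K \<Longrightarrow> y \<in> K \<Longrightarrow> x + y \<in> K"
    and scK: "x \<in> K \<Longrightarrow> r > 0 \<Longrightarrow> r *\<^sub>R x \<in> K" for x y r
    using K by (auto simp: pointed_cone_def)
  define \<pi> where "\<pi> = (\<lambda>p. if p \<in> K then p else - p)"
  have \<pi>K: "\<pi> (f a) \<in> K" if "a \<in> D" for a
    using poles[of "f a"] orient that by (auto simp: \<pi>_def oriented_def)
  have "\<exists>b. (b = a \<or> b = prod.swap a) \<and> (\<exists>\<alpha> \<beta>. \<alpha> > 0 \<and> \<beta> > 0 \<and> snd b = \<alpha> *\<^sub>R fst b + \<beta> *\<^sub>R \<pi> (f a))" if a: "a \<in> D" for a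
  proof -
    have fa: "on_sphere (f a)" "det3 (fst a) (snd a) (f a) = 0" "f a \<notin> arc_points a" "- f a \<notin> arc_points a" "valid_arc a"
      using orient a D by (auto simp: oriented_def is_SD_def)
    have "on_sphere (\<pi> (f a))" "\<pi> (f a) \<notin> arc_points a" "- \<pi> (f a) \<notin> arc_points a"
      using fa by (auto simp: \<pi>_def on_sphere_def)
    moreover have "det3 (fst a) (snd a) (\<pi> (f a)) = 0" using fa(2) by (simp add: \<pi>_def det3_def)
    ultimately show ?thesis by (metis arc_toward[OF fa(5)])
  qed
  then obtain dir where dir: "\<And>a. a \<in> D \<Longrightarrow> dir a = a \<or> dir a = prod.swap a"
    "\<And>a. a \<in> D \<Longrightarrow> \<exists>\<alpha> \<beta>. \<alpha> > 0 \<and> \<beta> > 0 \<and> snd (dir a) = \<alpha> *\<^sub>R fst (dir a) + \<beta> *\<^sub>R \<pi> (f a)"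
    by metis
  have "\<exists>c\<in>D. snd b \<in> ocone c" if b: "b \<in> dirs D" for b
    using blocked[OF b] und(1,3) by metis
  then obtain nx where nx: "\<And>b. b \<in> dirs D \<Longrightarrow> nx b \<in> D" "\<And>b. b \<in> dirs D \<Longrightarrow> snd b \<in> ocone (nx b)" by metis
  define F where "F = (\<lambda>b. dir (nx b))"
  have F_dirs: "F b \<in> dirs D" and F_ocone: "ocone (F b) = ocone (nx b)" if "b \<in> dirs D" for b
    using dir(1)[OF nx(1)[OF that]] nx(1)[OF that] by (auto simp: F_def dirs_def)
  have F_step: "\<exists>\<alpha> k. \<alpha> > 0 \<and> k \<in> K \<and> snd (F b) = \<alpha> *\<^sub>R snd b + k" if b: "b \<in> dirs D" for b
  proof -
    obtain \<alpha> \<beta> where ab: "snd (F b) = \<alpha> *\<^sub>R fst (F b) + \<beta> *\<^sub>R \<pi> (f (nx b))" "\<alpha> > 0" "\<beta> > 0"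
      using dir(2)[OF nx(1)[OF b]] by (auto simp: F_def)
    have "snd b \<in> ocone (F b)" using nx(2)[OF b] F_ocone[OF b] by simp
    from toward_from_interior[OF ab this] obtain x y where "x > 0" "y > 0" "snd (F b) = x *\<^sub>R snd b + y *\<^sub>R \<pi> (f (nx b))" by blast
    then show ?thesis using scK[OF \<pi>K[OF nx(1)[OF b]]] by blast
  qed
  obtain a where a: "a \<in> D" using D by (auto simp: is_SD_def)
  have "h \<noteq> 0" using hK[OF \<pi>K[OF a]] by auto
  then obtain b0 where b0: "b0 \<in> dirs D" "h \<bullet> snd b0 > 0" using vertex_in_hemisphere a by (force simp: dirs_def)
  define g where "g = (\<lambda>i. (F ^^ i) b0)"
  have g: "g i \<in> dirs D \<and> h \<bullet> snd (g i) > 0" for i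
  proof (induction i)
    case 0
    then show ?case using b0 by (simp add: g_def)
  next
    case (Suc i)
    obtain \<alpha> k where "\<alpha> > 0" "k \<in> K" "snd (F (g i)) = \<alpha> *\<^sub>R snd (g i) + k" using F_step Suc by blast
    then show ?case using Suc F_dirs hK by (simp add: g_def inner_add_right add_pos_pos)
  qed
  have gS: "g i \<in> dirs D" and gF: "g (Suc i) = F (g i)" for i using g by (auto simp: g_def)
  obtain m n where mn: "n > 0" "\<forall>i. g (m + (i + n)) = g (m + i)" "inj_on (\<lambda>i. g (m + i)) {..<n}"
    using eventual_cycle[where f = g and F = F and A = "dirs D", OF fin gS gF] by blast
  have comb: "\<exists>\<alpha> k. \<alpha> > 0 \<and> k \<in> K \<and> snd (g (i + Suc j)) = \<alpha> *\<^sub>R snd (g i) + k" for i j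
  proof (induction j)
    case 0
    then show ?case using F_step[OF gS] gF by simp
  next
    case (Suc j)
    then obtain \<alpha> k where 1: "\<alpha> > 0" "k \<in> K" "snd (g (i + Suc j)) = \<alpha> *\<^sub>R snd (g i) + k" by blast
    obtain \<alpha>' k' where 2: "\<alpha>' > 0" "k' \<in> K" "snd (g (i + Suc (Suc j))) = \<alpha>' *\<^sub>R snd (g (i + Suc j)) + k'"
      using F_step[OF gS[of "i + Suc j"]] gF[of "i + Suc j"] by auto
    have "snd (g (i + Suc (Suc j))) = (\<alpha>' * \<alpha>) *\<^sub>R snd (g i) + (\<alpha>' *\<^sub>R k + k')"
      unfolding 2(3) unfolding 1(3) by (simp add: algebra_simps)
    then show ?case using 1 2 addK scK by (intro exI[of _ "\<alpha>' * \<alpha>"] exI[of _ "\<alpha>' *\<^sub>R k + k'"]) simp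
  qed
  have inK: "snd (g (m + i)) \<in> K" for i
  proof -
    let ?v = "snd (g (m + i))"
    obtain \<alpha> k where ak: "\<alpha> > 0" "k \<in> K" "snd (g (m + i + n)) = \<alpha> *\<^sub>R ?v + k"
      using comb[of "m + i" "n - 1"] mn by auto
    \<comment> \<open>One full period returns to the same vertex, so it solves an equation that
      makes it a multiple of an element of \<open>K\<close>; the sign of \<open>h\<close> makes the
      factor positive.\<close>
    then have eq: "(1 - \<alpha>) *\<^sub>R ?v = k" using mn(2) by (simp add: algebra_simps)
    then have "(1 - \<alpha>) * (h \<bullet> ?v) > 0" using hK[OF ak(2)] by auto
    then have "1 - \<alpha> > 0" using g[of "m + i"] by (auto simp: zero_less_mult_iff)
    then show ?thesis using scK[OF ak(2), of "1 / (1 - \<alpha>)"] by (simp flip: eq)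
  qed
  have "swalk (\<lambda>i. g (m + i)) n"
    using mn gS nx(2)[OF gS] F_ocone[OF gS] by (simp add: swalk_def walk_def gF)
  then show ?thesis by (rule swirl_of_walk_in_cone[OF D K]) (rule inK)
qed

text \<open>If the cycles agree, so do their corners, because an arc cannot hit the next one at both
  ends. All corners then lie in the plane of \<open>l\<close>, where no turn is possible.\<close>

lemma swirl_classes_distinct:
  assumes D: "is_SD D" and xs: "is_swirl D xs" "swirl_ends xs s e" and ys: "is_swirl D ys" "swirl_ends ys s' e'"
    and l: "l \<noteq> 0" "\<And>i j. e i = e' j \<Longrightarrow> l \<bullet> e i = 0"
  shows "{rotate n xs | n. True} \<noteq> {rotate n ys | n. True}"
proof
  assume eq: "{rotate n xs | n. True} = {rotate n ys | n. True}"
  interpret arrangement "dirs D" 1 by (rule SD_arrangement[OF D]) simp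
  have "ys = rotate 0 ys" by simp
  then have "ys \<in> {rotate n ys | n. True}" by blast
  then obtain r where r: "ys = rotate r xs" using eq by auto
  let ?n = "length xs"
  have n: "?n > 0" "length ys = ?n" using xs r by (auto simp: is_swirl_alt)
  have mem: "xs ! i \<in> D" if "i < ?n" for i using xs(1) that by (auto simp: is_swirl_alt)
  have val: "valid_arc a" if "a \<in> D" for a using D that by (auto simp: is_SD_def)
  have nth: "ys ! i = xs ! ((i + r) mod ?n)" if "i < ?n" for i using that by (simp add: r nth_rotate add.commute)
  have l0: "l \<bullet> e i = 0" if i: "i < ?n" for i
  proof -
    define j where "j = (i + (?n - r mod ?n)) mod ?n"
    have j: "j < ?n" using n by (simp add: j_def)
    have jr: "(j + r) mod ?n = i"
    proof -
      have "(j + r) mod ?n = (i + (?n - r mod ?n) + r mod ?n) mod ?n" unfolding j_def by (simp add: mod_simps)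
      also have "i + (?n - r mod ?n) + r mod ?n = i + ?n" using mod_less_divisor[OF n(1), of r] by linarith
      finally show ?thesis using i by simp
    qed
    let ?a = "xs ! i" and ?b = "xs ! ((i + 1) mod ?n)"
    have "ys ! j = ?a" using nth[OF j] jr by simp
    moreover have "ys ! ((j + 1) mod ?n) = ?b"
    proof -
      have "((j + 1) mod ?n + r) mod ?n = (j + r + 1) mod ?n" by (simp add: mod_simps)
      also have "\<dots> = (i + 1) mod ?n" using jr by (metis mod_add_left_eq)
      finally show ?thesis using nth[of "(j + 1) mod ?n"] n by simp
    qed
    ultimately have e': "?a = (s' j, e' j) \<or> ?a = (e' j, s' j)" "e' j \<in> arc_relint ?b"
      using ys(2) j n by (auto simp: swirl_ends_def)
    have e: "?a = (s i, e i) \<or> ?a = (e i, s i)" "e i \<in> arc_relint ?b" using xs(2) i by (auto simp: swirl_ends_def)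
    have aD: "?a \<in> D" "?b \<in> D" using mem i n by auto
    have "e i = e' j"
    \<comment> \<open>With different corners, both ends of one arc would be interior to the next,
      making the two arcs coplanar.\<close>
    proof (rule ccontr)
      assume "e i \<noteq> e' j"
      then have "fst ?a \<in> arc_relint ?b" "snd ?a \<in> arc_relint ?b" using e e' by auto
      then have o: "fst ?a \<in> ocone ?b" "snd ?a \<in> ocone ?b" using relint_imp_ocone val aD by auto
      then have "dt (fst ?b) (snd ?b) (fst ?a) = 0" by (auto simp: ocone_def dt_lin)
      then show False using transversal[of ?a ?b] o aD by (auto simp: dirs_def)
    qed
    then show ?thesis by (rule l(2))
  qed
  have s0: "l \<bullet> s ((i + 1) mod ?n) = 0" if i: "i < ?n" for i
  proof -
    let ?j = "(i + 1) mod ?n"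
    have j: "?j < ?n" using n by simp
    have "e i \<in> ocone (xs ! ?j)" using xs(2) i relint_imp_ocone val mem[OF j] by (auto simp: swirl_ends_def)
    moreover have "xs ! ?j = (s ?j, e ?j) \<or> xs ! ?j = (e ?j, s ?j)" using xs(2) j by (auto simp: swirl_ends_def)
    ultimately obtain x y where "x > 0" "y > 0" "e i = x *\<^sub>R s ?j + y *\<^sub>R e ?j"
      by (auto simp: ocone_def add.commute)
    then show ?thesis using l0[OF i] l0[OF j] by (simp add: inner_add_right)
  qed
  let ?j = "(0 + 1) mod ?n"
  have j: "?j < ?n" by (rule mod_less_divisor[OF n(1)])
  have "det3 (s ?j) (e ?j) (e ((?j + 1) mod ?n)) = 0"
    by (rule coplanar_det3[OF l(1) s0[OF n(1)] l0[OF j] l0[OF mod_less_divisor[OF n(1)]]])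
  moreover have "det3 (s ?j) (e ?j) (e ((?j + 1) mod ?n)) \<noteq> 0" using xs(2) j by (auto simp: swirl_ends_def)
  ultimately show False by simp
qed

lemma finite_swirls:
  assumes "finite D"
  shows "finite (swirls D)"
proof -
  have "{xs. is_swirl D xs} \<subseteq> {xs. set xs \<subseteq> D \<and> distinct xs}" by (auto simp: is_swirl_def)
  then have "finite {xs. is_swirl D xs}" by (rule finite_subset) (rule finite_subset_distinct[OF assms])
  moreover have "swirls D = (\<lambda>xs. {rotate n xs | n. True}) ` {xs. is_swirl D xs}" unfolding swirls_def by blast
  ultimately show ?thesis by simp
qed

section \<open>The lower bound\<close>

definition facet_cone :: "point set \<Rightarrow> point \<Rightarrow> point set" where
  "facet_cone L h = {x. (\<forall>l\<in>L. l \<bullet> x \<ge> 0) \<and> h \<bullet> x > 0}"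

lemma pointed_facet_cone: "pointed_cone (facet_cone L h) h"
  by (auto simp: pointed_cone_def facet_cone_def inner_add_right)

definition class_in :: "arc set \<Rightarrow> point set \<Rightarrow> arc list set \<Rightarrow> bool" where
  "class_in D K c \<longleftrightarrow> (\<exists>xs s e. is_swirl D xs \<and> swirl_ends xs s e \<and> (\<forall>i. e i \<in> K) \<and> c = {rotate n xs | n. True})"

lemma class_in_distinct:
  assumes D: "is_SD D" and c: "class_in D K c" and d: "class_in D K' d" and l: "l \<noteq> 0" "\<And>x. x \<in> K \<Longrightarrow> x \<in> K' \<Longrightarrow> l \<bullet> x = 0"
  shows "c \<noteq> d"
proof -
  obtain xs s e where 1: "is_swirl D xs" "swirl_ends xs s e" "\<forall>i. e i \<in> K" "c = {rotate n xs | n. True}"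
    using c by (auto simp: class_in_def)
  obtain ys s' e' where 2: "is_swirl D ys" "swirl_ends ys s' e'" "\<forall>i. e' i \<in> K'" "d = {rotate n ys | n. True}"
    using d by (auto simp: class_in_def)
  have "l \<bullet> e i = 0" if "e i = e' j" for i j
    using l(2)[of "e i"] 1(3) 2(3) that by metis
  from swirl_classes_distinct[OF D 1(1,2) 2(1,2) l(1) this] show ?thesis using 1(4) 2(4) by simp
qed

lemma class_in_swirls: "class_in D K c \<Longrightarrow> c \<in> swirls D"
  by (auto simp: class_in_def swirls_def)

section \<open>The pole configuration determined by the alignment\<close>

lemma great_circle_eq_iff:
  assumes u: "on_sphere p" "on_sphere q" "on_sphere r" and ne: "q \<noteq> p" "q \<noteq> - p" "r \<noteq> p" "r \<noteq> - p"
  shows "great_circle_through p q = great_circle_through p r \<longleftrightarrow> det3 p q r = 0"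
proof
  assume "great_circle_through p q = great_circle_through p r"
  moreover have "r \<in> great_circle_through p r" using u by (simp add: great_circle_through_def dot_cross_self)
  ultimately show "det3 p q r = 0" by (auto simp: great_circle_through_def det3_def)
next
  assume 0: "det3 p q r = 0"
  have cr: "cross3 p x \<noteq> 0" if "on_sphere x" "x \<noteq> p" "x \<noteq> - p" for x
    using valid_cross[of "(p, x)"] that u by (simp add: valid_arc_def) (metis minus_minus)
  obtain x y where xy: "r = x *\<^sub>R p + y *\<^sub>R q" using plane_span[OF cr 0] u ne by blast
  have eq: "cross3 p r = y *\<^sub>R cross3 p q" by (simp add: xy cross_add_right cross_mult_right)
  then have "y \<noteq> 0" using cr[of r] u ne by auto
  then show "great_circle_through p q = great_circle_through p r"
    by (simp add: great_circle_through_def eq)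
qed

text \<open>The pole of degree 2 sees the other four on two great circles. A split 3 + 1 would put
  four poles on one circle, leaving those other than \<open>p\<close> with degree at most 2; so the
  split is 2 + 2.\<close>

lemma alignment_structure:
  assumes P: "finite P" "card P = 5" "\<And>p. p \<in> P \<Longrightarrow> on_sphere p" "\<And>p q. p \<in> P \<Longrightarrow> q \<in> P \<Longrightarrow> q \<noteq> - p"
    and al: "alignment P = {#2, 3, 3, 3, 3#}"
  obtains p a a' b b' where "P = {p, a, a', b, b'}" "distinct [p, a, a', b, b']"
    "det3 p a a' = 0" "det3 p b b' = 0" "det3 p a b \<noteq> 0"
proof -
  have "2 \<in># alignment P" using al by simp
  then obtain p where p: "p \<in> P" "align_deg P p = 2" using P(1) by (auto simp: alignment_def)
  have "alignment P = add_mset 2 (image_mset (align_deg P) (mset_set (P - {p})))"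
    unfolding alignment_def using p P(1) by (simp add: mset_set.remove)
  then have "image_mset (align_deg P) (mset_set (P - {p})) = {#3, 3, 3, 3#}" using al by simp
  moreover have "align_deg P q \<in># image_mset (align_deg P) (mset_set (P - {p}))" if "q \<in> P - {p}" for q
    using that P(1) by simp
  ultimately have deg3: "align_deg P q = 3" if "q \<in> P - {p}" for q
    using that by (metis (no_types, lifting) add_mset_not_empty count_add_mset insert_iff set_mset_add_mset_insert set_mset_empty singletonD)
  define X where "X = great_circle_through p"
  have X_iff: "X q = X r \<longleftrightarrow> det3 p q r = 0" if "q \<in> P - {p}" "r \<in> P - {p}" for q r
    unfolding X_def using that p P by (intro great_circle_eq_iff) auto
  have three: False if abc: "a \<in> P - {p}" "b \<in> P - {p}" "c \<in> P - {p}" "a \<noteq> b" "a \<noteq> c" "b \<noteq> c" and eq: "X a = X b" "X a = X c" for a b c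
  proof -
    have "card {p, a, b, c} = 4" using that by auto
    then have "card (P - {p, a, b, c}) = 1" using P p abc by (subst card_Diff_subset) auto
    then obtain d where d: "P - {p, a, b, c} = {d}" by (auto simp: card_1_singleton_iff)
    then have P': "P - {a} = {p, b, c, d}" using abc p by auto
    have "great_circle_through a p = great_circle_through a q" if q: "q \<in> {b, c}" for q
    proof (subst great_circle_eq_iff)
      have "det3 p a q = 0" using X_iff[OF abc(1)] q abc eq by auto
      then show "det3 a p q = 0" by (simp add: det3_expand algebra_simps)
    qed (use q abc p P in auto)
    then have "great_circle_through a ` (P - {a}) = {great_circle_through a p, great_circle_through a d}"
      unfolding P' by auto
    then have "align_deg P a \<le> 2" by (simp add: align_deg_def card_insert_if)
    then show False using deg3[OF abc(1)] by simp
  qed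
  have "card (P - {p}) = 4" using P p by simp
  then obtain q1 q2 q3 q4 where Q: "P - {p} = {q1, q2, q3, q4}" "distinct [q1, q2, q3, q4]"
    by (auto simp: numeral_eq_Suc card_Suc_eq)
  have "card (X ` {q1, q2, q3, q4}) = 2" using p(2) unfolding align_deg_def X_def Q(1) .
  then have c2: "card {X q1, X q2, X q3, X q4} = 2" by simp
  have mem: "q1 \<in> P - {p}" "q2 \<in> P - {p}" "q3 \<in> P - {p}" "q4 \<in> P - {p}" using Q by auto
  have result: thesis if "a \<in> P - {p}" "a' \<in> P - {p}" "b \<in> P - {p}" "b' \<in> P - {p}" "P - {p} = {a, a', b, b'}" "distinct [a, a', b, b']"
    "X a = X a'" "X b = X b'" "X a \<noteq> X b" for a a' b b'
  proof (rule \<open>\<And>p a a' b b'. P = {p, a, a', b, b'} \<Longrightarrow> distinct [p, a, a', b, b'] \<Longrightarrow> det3 p a a' = 0 \<Longrightarrow> det3 p b b' = 0 \<Longrightarrow> det3 p a b \<noteq> 0 \<Longrightarrow> thesis\<close>)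
    show "P = {p, a, a', b, b'}" using that(5) p by blast
    show "distinct [p, a, a', b, b']" using that(1-4,6) by auto
    show "det3 p a a' = 0" "det3 p b b' = 0" "det3 p a b \<noteq> 0" using that X_iff by auto
  qed
  have n3: "\<not> (X q1 = X q2 \<and> X q1 = X q3)" "\<not> (X q1 = X q2 \<and> X q1 = X q4)" "\<not> (X q1 = X q3 \<and> X q1 = X q4)" "\<not> (X q2 = X q3 \<and> X q2 = X q4)"
    using three[OF mem(1,2,3)] three[OF mem(1,2,4)] three[OF mem(1,3,4)] three[OF mem(2,3,4)] Q(2) by auto
  consider "X q1 = X q2" "X q3 = X q4" "X q1 \<noteq> X q3" | "X q1 = X q3" "X q2 = X q4" "X q1 \<noteq> X q2" | "X q1 = X q4" "X q2 = X q3" "X q1 \<noteq> X q2"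
    using c2 n3 by (auto simp: card_insert_if split: if_splits)
  then show thesis
  proof cases
    case 1 then show ?thesis using result[OF mem] Q by auto
  next
    case 2 then show ?thesis using result[OF mem(1,3,2,4)] Q by auto
  next
    case 3 then show ?thesis using result[OF mem(1,4,2,3)] Q by auto
  qed
qed

lemma pole_decomposition:
  assumes u: "on_sphere p" "on_sphere a" "on_sphere a'" and ne: "a \<noteq> p" "a \<noteq> - p" "a' \<noteq> p" "a' \<noteq> - p" "a \<noteq> a'" "a \<noteq> - a'"
    and 0: "det3 p a a' = 0"
  obtains x y where "x \<noteq> 0" "y \<noteq> 0" "p = x *\<^sub>R a + y *\<^sub>R a'"
proof -
  have "cross3 p a \<noteq> 0" using valid_cross[of "(p, a)"] u ne by (simp add: valid_arc_def) (metis minus_minus)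
  then obtain x y where xy: "a' = x *\<^sub>R p + y *\<^sub>R a" using plane_span[OF _ 0] by blast
  have "x \<noteq> 0"
  proof
    assume "x = 0"
    then have "a' = y *\<^sub>R a" "\<bar>y\<bar> = 1" using xy u by (auto simp: on_sphere_def)
    then show False using ne by (auto simp: abs_if split: if_splits)
  qed
  moreover have "y \<noteq> 0"
  proof
    assume "y = 0"
    then have "a' = x *\<^sub>R p" "\<bar>x\<bar> = 1" using xy u by (auto simp: on_sphere_def)
    then show False using ne by (auto simp: abs_if split: if_splits)
  qed
  moreover have "p = (1 / x) *\<^sub>R (x *\<^sub>R p)" using \<open>x \<noteq> 0\<close> by simp
  then have "p = (1 / x) *\<^sub>R (a' + (- y) *\<^sub>R a)" by (simp add: xy)
  then have "p = (- y / x) *\<^sub>R a + (1 / x) *\<^sub>R a'" by (simp add: algebra_simps)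
  ultimately show ?thesis using that[of "- y / x" "1 / x"] by simp
qed

lemma at_least_five_swirls:
  assumes D: "is_SD D" and orient: "oriented 5 D P f" and al: "alignment P = {#2, 3, 3, 3, 3#}"
  shows "num_swirls D \<ge> 5"
proof -
  have P: "finite P" "card P = 5" "\<And>p. p \<in> P \<Longrightarrow> on_sphere p" "\<And>p q. p \<in> P \<Longrightarrow> q \<in> P \<Longrightarrow> q \<noteq> - p"
    using orient by (auto simp: oriented_def)
  obtain p a a' b b' where Pe: "P = {p, a, a', b, b'}" "distinct [p, a, a', b, b']"
    "det3 p a a' = 0" "det3 p b b' = 0" "det3 p a b \<noteq> 0"
    by (rule alignment_structure[OF P al])
  have nn: "a \<noteq> - p" "a' \<noteq> - p" "a \<noteq> - a'" "b \<noteq> - p" "b' \<noteq> - p" "b \<noteq> - b'" using P(4) Pe(1) by auto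
  obtain x x' where x: "x \<noteq> 0" "x' \<noteq> 0" "p = x *\<^sub>R a + x' *\<^sub>R a'"
    by (rule pole_decomposition[of p a a']) (use P(3) Pe nn in auto)
  obtain y y' where y: "y \<noteq> 0" "y' \<noteq> 0" "p = y *\<^sub>R b + y' *\<^sub>R b'"
    by (rule pole_decomposition[of p b b']) (use P(3) Pe nn in auto)
  \<comment> \<open>In the basis \<open>U\<close>, \<open>V\<close>, \<open>p\<close> the poles
    become \<open>p\<close>, \<open>p + U\<close>, \<open>p - U\<close>, \<open>p + V\<close>,
    \<open>p - V\<close> up to nonzero factors; signs do not matter, since cones need a pole only up
    to antipode. The forms \<open>\<xi>\<close>, \<open>\<eta>\<close>, \<open>\<zeta>\<close> below
    are the dual basis.\<close>
  define U V where "U = 2 *\<^sub>R (x *\<^sub>R a) - p" and "V = 2 *\<^sub>R (y *\<^sub>R b) - p"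
  define N where "N = det3 U V p"
  have "N = 4 * x * y * det3 p a b" by (simp add: N_def U_def V_def det3_expand algebra_simps)
  then have N: "N \<noteq> 0" using x y Pe by simp
  define \<xi> \<eta> \<zeta> where "\<xi> = (1 / N) *\<^sub>R cross3 V p" and "\<eta> = (1 / N) *\<^sub>R cross3 p U" and "\<zeta> = (1 / N) *\<^sub>R cross3 U V"
  have "cross3 V p \<bullet> U = N" "cross3 p U \<bullet> V = N" "cross3 U V \<bullet> p = N"
    by (simp_all add: N_def det3_def cross3_def inner_vec_def sum_3 algebra_simps)
  then have dual: "\<xi> \<bullet> U = 1" "\<xi> \<bullet> V = 0" "\<xi> \<bullet> p = 0" "\<eta> \<bullet> U = 0" "\<eta> \<bullet> V = 1" "\<eta> \<bullet> p = 0" "\<zeta> \<bullet> U = 0" "\<zeta> \<bullet> V = 0" "\<zeta> \<bullet> p = 1"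
    using N by (simp_all add: \<xi>_def \<eta>_def \<zeta>_def dot_cross_self)
  have vecs: "x *\<^sub>R a = (1 / 2) *\<^sub>R (p + U)" "x' *\<^sub>R a' = (1 / 2) *\<^sub>R (p - U)" "y *\<^sub>R b = (1 / 2) *\<^sub>R (p + V)" "y' *\<^sub>R b' = (1 / 2) *\<^sub>R (p - V)"
  proof -
    show "x *\<^sub>R a = (1 / 2) *\<^sub>R (p + U)" "y *\<^sub>R b = (1 / 2) *\<^sub>R (p + V)" by (simp_all add: U_def V_def)
    have ab': "x' *\<^sub>R a' = p - x *\<^sub>R a" "y' *\<^sub>R b' = p - y *\<^sub>R b" using x(3) y(3) by (simp_all add: algebra_simps)
    show "x' *\<^sub>R a' = (1 / 2) *\<^sub>R (p - U)" "y' *\<^sub>R b' = (1 / 2) *\<^sub>R (p - V)"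
    proof -
      have pU: "p - U = 2 *\<^sub>R (p - x *\<^sub>R a)" "p - V = 2 *\<^sub>R (p - y *\<^sub>R b)"
        unfolding U_def V_def scaleR_diff_right scaleR_2 by simp_all
      show "x' *\<^sub>R a' = (1 / 2) *\<^sub>R (p - U)" "y' *\<^sub>R b' = (1 / 2) *\<^sub>R (p - V)"
        unfolding ab' pU by simp_all
    qed
  qed
  have key: "\<exists>c. class_in D (facet_cone L h) c"
    if mem: "\<And>v. v \<in> {p, p + U, p - U, p + V, p - V} \<Longrightarrow> v \<in> facet_cone L h \<or> - v \<in> facet_cone L h" for L h
  proof -
    have sc: "q \<in> facet_cone L h \<or> - q \<in> facet_cone L h" if q: "c *\<^sub>R q = (1 / 2) *\<^sub>R v" "c \<noteq> 0" and v: "v \<in> facet_cone L h \<or> - v \<in> facet_cone L h" for q v c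
    proof -
      have sp: "w \<in> facet_cone L h \<Longrightarrow> r > 0 \<Longrightarrow> r *\<^sub>R w \<in> facet_cone L h" for w r by (auto simp: facet_cone_def)
      have qv: "q = (1 / (2 * c)) *\<^sub>R v"
        using arg_cong[OF q(1), of "\<lambda>w. (1 / c) *\<^sub>R w"] q(2) by (simp add: mult.commute)
      have qv': "q = (1 / (2 * (- c))) *\<^sub>R (- v)" unfolding qv by simp
      consider "c > 0" | "- c > 0" using q(2) by linarith
      then show ?thesis
      proof cases
        case 1
        then have "1 / (2 * c) > 0" by simp
        then have "v \<in> facet_cone L h \<Longrightarrow> q \<in> facet_cone L h" "- v \<in> facet_cone L h \<Longrightarrow> - q \<in> facet_cone L h"
          using sp[of v "1 / (2 * c)"] sp[of "- v" "1 / (2 * c)"] qv by simp_all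
        then show ?thesis using v by blast
      next
        case 2
        then have "1 / (2 * (- c)) > 0" by simp
        then have "v \<in> facet_cone L h \<Longrightarrow> - q \<in> facet_cone L h" "- v \<in> facet_cone L h \<Longrightarrow> q \<in> facet_cone L h"
          using sp[of v "1 / (2 * (- c))"] sp[of "- v" "1 / (2 * (- c))"] qv' by simp_all
        then show ?thesis using v by blast
      qed
    qed
    have "q \<in> facet_cone L h \<or> - q \<in> facet_cone L h" if "q \<in> P" for q
      using that mem[of p] sc[OF vecs(1) x(1) mem] sc[OF vecs(2) x(2) mem] sc[OF vecs(3) y(1) mem] sc[OF vecs(4) y(2) mem]
      unfolding Pe(1) by auto
    then have "\<exists>xs s e. is_swirl D xs \<and> swirl_ends xs s e \<and> (\<forall>i. e i \<in> facet_cone L h)"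
      by (rule swirl_in_cone[OF D orient pointed_facet_cone])
    then show ?thesis unfolding class_in_def by blast
  qed
  \<comment> \<open>Cones given by facets. \<open>KC s t\<close> is spanned by \<open>p\<close>,
    \<open>s *\<^sub>R U - p\<close>, \<open>t *\<^sub>R V - p\<close>, and \<open>KS s t\<close> by
    \<open>- p\<close>, \<open>p + s *\<^sub>R U\<close>, \<open>p + t *\<^sub>R V\<close>. The last
    form in each takes the value 1 on all three generators.\<close>
  define KC KS where "KC = (\<lambda>s t. facet_cone {s *\<^sub>R \<xi>, t *\<^sub>R \<eta>, \<zeta> + s *\<^sub>R \<xi> + t *\<^sub>R \<eta>} (\<zeta> + (2 * s) *\<^sub>R \<xi> + (2 * t) *\<^sub>R \<eta>))"
    and "KS = (\<lambda>s t. facet_cone {s *\<^sub>R \<xi>, t *\<^sub>R \<eta>, s *\<^sub>R \<xi> + t *\<^sub>R \<eta> - \<zeta>} ((2 * s) *\<^sub>R \<xi> + (2 * t) *\<^sub>R \<eta> - \<zeta>))"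
  \<comment> \<open>The quadrilateral cone: in dual coordinates, the points with
    \<open>\<zeta>\<close> at least the sum of the absolute values of \<open>\<xi>\<close> and
    \<open>\<eta>\<close>.\<close>
  define KQ where "KQ = facet_cone {\<zeta> + \<xi> + \<eta>, \<zeta> + \<xi> - \<eta>, \<zeta> - \<xi> + \<eta>, \<zeta> - \<xi> - \<eta>} \<zeta>"
  note lin = inner_add_left inner_diff_left inner_add_right inner_diff_right dual
  have "\<exists>c. class_in D KQ c" unfolding KQ_def by (rule key) (auto simp: facet_cone_def lin)
  then obtain q where q: "class_in D KQ q" by blast
  have "\<exists>c. class_in D (KC s t) c" "\<exists>c. class_in D (KS s t) c" if "s \<in> {1, -1}" "t \<in> {1, -1}" for s t
  proof -
    show "\<exists>c. class_in D (KC s t) c"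
      unfolding KC_def by (rule key) (use that in \<open>auto simp: facet_cone_def lin\<close>)
    show "\<exists>c. class_in D (KS s t) c"
      unfolding KS_def by (rule key) (use that in \<open>auto simp: facet_cone_def lin\<close>)
  qed
  then obtain c d where c: "\<And>s t. s \<in> {1, -1} \<Longrightarrow> t \<in> {1, -1} \<Longrightarrow> class_in D (KC s t) (c s t)"
    and d: "\<And>s t. s \<in> {1, -1} \<Longrightarrow> t \<in> {1, -1} \<Longrightarrow> class_in D (KS s t) (d s t)" by metis
  have nz: "\<xi> \<noteq> 0" "\<eta> \<noteq> 0" using dual by auto
  have side: "s * (\<xi> \<bullet> v) \<ge> 0 \<and> t * (\<eta> \<bullet> v) \<ge> 0" if "v \<in> K" "K \<in> {KC s t, KS s t}" for v K s t
    using that(2,1) unfolding insert_iff empty_iff KC_def KS_def by (elim disjE) (simp_all add: facet_cone_def)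
  \<comment> \<open>Cones in different lunes lie on opposite sides of the plane
    \<open>\<xi> = 0\<close> or of the plane \<open>\<eta> = 0\<close>.\<close>
  have disj: "e \<noteq> e'" if K: "K \<in> {KC s t, KS s t}" "K' \<in> {KC s' t', KS s' t'}" and st: "s \<in> {1, -1}" "t \<in> {1, -1}" "s' \<in> {1, -1}" "t' \<in> {1, -1}"
    and ne: "(s, t) \<noteq> (s', t')" and e: "class_in D K e" "class_in D K' e'" for s t s' t' K K' e e'
  proof (cases "s = s'")
    case False
    then have s': "s' = - s" using st by auto
    have "\<xi> \<bullet> v = 0" if "v \<in> K" "v \<in> K'" for v
      using side[OF that(1) K(1)] side[OF that(2) K(2)] st(1) unfolding s' by auto
    then show ?thesis by (rule class_in_distinct[OF D e nz(1)])
  next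
    case True
    then have t': "t' = - t" using ne st by auto
    have "\<eta> \<bullet> v = 0" if "v \<in> K" "v \<in> K'" for v
      using side[OF that(1) K(1)] side[OF that(2) K(2)] st(2) unfolding t' by auto
    then show ?thesis by (rule class_in_distinct[OF D e nz(2)])
  qed
  \<comment> \<open>\<open>KQ\<close> and \<open>KS s t\<close> impose opposite inequalities on this
    form, so they meet only where it vanishes.\<close>
  have qd: "q \<noteq> d s t" if st: "s \<in> {1, -1}" "t \<in> {1, -1}" for s t
  proof (rule class_in_distinct[OF D q d[OF st], of "\<zeta> - s *\<^sub>R \<xi> - t *\<^sub>R \<eta>"])
    have "(\<zeta> - s *\<^sub>R \<xi> - t *\<^sub>R \<eta>) \<bullet> p = 1" by (simp add: lin)
    then show "\<zeta> - s *\<^sub>R \<xi> - t *\<^sub>R \<eta> \<noteq> 0" by auto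
    show "(\<zeta> - s *\<^sub>R \<xi> - t *\<^sub>R \<eta>) \<bullet> v = 0" if "v \<in> KQ" "v \<in> KS s t" for v
      using that st by (auto simp: KQ_def KS_def facet_cone_def inner_add_left inner_diff_left)
  qed
  have cd: "c s t \<noteq> d s' t'" and cc: "c s t \<noteq> c s' t'" if "s \<in> {1, -1}" "t \<in> {1, -1}" "s' \<in> {1, -1}" "t' \<in> {1, -1}" "(s, t) \<noteq> (s', t')" for s t s' t'
  proof -
    show "c s t \<noteq> d s' t'"
      by (rule disj[of "KC s t" s t "KS s' t'" s' t', OF _ _ that(1-5) c[OF that(1,2)] d[OF that(3,4)]]) simp_all
    show "c s t \<noteq> c s' t'"
      by (rule disj[of "KC s t" s t "KC s' t'" s' t', OF _ _ that(1-5) c[OF that(1,2)] c[OF that(3,4)]]) simp_all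
  qed
  have sw: "q \<in> swirls D" "\<And>s t. s \<in> {1, -1} \<Longrightarrow> t \<in> {1, -1} \<Longrightarrow> c s t \<in> swirls D \<and> d s t \<in> swirls D"
    using class_in_swirls[OF q] class_in_swirls[OF c] class_in_swirls[OF d] by simp_all
  have cc4: "distinct [c 1 1, c 1 (-1), c (-1) 1, c (-1) (-1)]" using cc by simp
  have five: "num_swirls D \<ge> 5" if "w \<in> swirls D" "w \<notin> {c 1 1, c 1 (-1), c (-1) 1, c (-1) (-1)}" for w
  proof -
    have "distinct [w, c 1 1, c 1 (-1), c (-1) 1, c (-1) (-1)]" using that cc4 by simp
    then have "card (set [w, c 1 1, c 1 (-1), c (-1) 1, c (-1) (-1)]) = 5" by (subst distinct_card) simp_all
    moreover have "set [w, c 1 1, c 1 (-1), c (-1) 1, c (-1) (-1)] \<subseteq> swirls D" using that sw by simp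
    moreover have "finite (swirls D)" using D by (intro finite_swirls) (simp add: is_SD_def)
    ultimately show ?thesis unfolding num_swirls_def by (metis card_mono)
  qed
  show ?thesis
  proof (cases "q \<in> {c 1 1, c 1 (-1), c (-1) 1, c (-1) (-1)}")
    case False
    then show ?thesis using five[OF sw(1)] by simp
  next
    case True
    then have "\<exists>s\<in>{1, -1}. \<exists>t\<in>{1, -1}. q = c s t" by auto
    then obtain s t where st: "s \<in> {1, -1}" "t \<in> {1, -1}" "q = c s t" by blast
    \<comment> \<open>In the other lunes \<open>d s t\<close> differs from the chosen swirls by
      disjointness; in its own lune the chosen swirl is \<open>q\<close>, which avoids
      \<open>KS s t\<close>.\<close>
    have "d s t \<noteq> c s' t'" if "s' \<in> {1, -1}" "t' \<in> {1, -1}" for s' t'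
      using cd[OF that st(1,2)] qd[OF st(1,2)] st(3) by (cases "(s', t') = (s, t)") auto
    then show ?thesis using five[of "d s t"] sw(2)[OF st(1,2)] by simp
  qed
qed


section \<open>Diagrams with integer coordinates\<close>

type_synonym ivec = "int \<times> int \<times> int"

fun icross :: "ivec \<Rightarrow> ivec \<Rightarrow> ivec" where
  "icross (a, b, c) (x, y, z) = (b * z - c * y, c * x - a * z, a * y - b * x)"

fun idot :: "ivec \<Rightarrow> ivec \<Rightarrow> int" where
  "idot (a, b, c) (x, y, z) = a * x + b * y + c * z"

definition idet :: "ivec \<Rightarrow> ivec \<Rightarrow> ivec \<Rightarrow> int" where
  "idet u v w = idot (icross u v) w"

fun rv :: "ivec \<Rightarrow> point" where
  "rv (a, b, c) = vector [real_of_int a, real_of_int b, real_of_int c]"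

definition sp :: "ivec \<Rightarrow> point" where
  "sp u = sgn (rv u)"

lemma rv_dot: "rv u \<bullet> rv v = of_int (idot u v)"
  by (cases u; cases v) (simp add: inner_vec_def sum_3)

lemma rv_cross: "cross3 (rv u) (rv v) = rv (icross u v)"
  by (cases u; cases v) (simp add: cross3_def)

lemma rv_det: "det3 (rv u) (rv v) (rv w) = of_int (idet u v w)"
  by (simp add: det3_def idet_def rv_cross rv_dot)

lemma rv_eq_0: "rv u = 0 \<longleftrightarrow> u = (0, 0, 0)"
  by (cases u) (simp add: vec_eq_iff forall_3)

lemma sp_scale:
  assumes "u \<noteq> (0, 0, 0)"
  obtains k where "k > 0" "sp u = k *\<^sub>R rv u"
  using assms by (intro that[of "inverse (norm (rv u))"]) (auto simp: sp_def sgn_div_norm rv_eq_0)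

lemma norm_sp: "u \<noteq> (0, 0, 0) \<Longrightarrow> norm (sp u) = 1"
  by (simp add: sp_def norm_sgn rv_eq_0)

lemma det3_scaleR: "det3 (a *\<^sub>R u) v w = a * det3 u v w" "det3 u (a *\<^sub>R v) w = a * det3 u v w" "det3 u v (a *\<^sub>R w) = a * det3 u v w"
  by (simp_all add: det3_expand algebra_simps)

lemma sp_det:
  assumes "u \<noteq> (0, 0, 0)" "v \<noteq> (0, 0, 0)" "w \<noteq> (0, 0, 0)"
  obtains k where "k > 0" "det3 (sp u) (sp v) (sp w) = k * of_int (idet u v w)"
proof -
  obtain a b c where "a > 0" "b > 0" "c > 0" "sp u = a *\<^sub>R rv u" "sp v = b *\<^sub>R rv v" "sp w = c *\<^sub>R rv w"
    using sp_scale assms by metis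
  then show ?thesis using that[of "a * b * c"] by (simp add: det3_scaleR rv_det)
qed

lemma icross_nz: "icross u v \<noteq> (0, 0, 0) \<Longrightarrow> u \<noteq> (0, 0, 0) \<and> v \<noteq> (0, 0, 0)"
  by (cases u; cases v) auto

lemma sp_neq:
  assumes "icross u v \<noteq> (0, 0, 0)"
  shows "sp u \<noteq> sp v" "sp u \<noteq> - sp v"
proof -
  obtain a b where ab: "a > 0" "b > 0" "sp u = a *\<^sub>R rv u" "sp v = b *\<^sub>R rv v"
    using sp_scale icross_nz[OF assms] by metis
  have "cross3 (sp u) (sp v) = (a * b) *\<^sub>R rv (icross u v)"
    by (simp add: ab cross_mult_left cross_mult_right rv_cross)
  then have "cross3 (sp u) (sp v) \<noteq> 0" using ab assms by (simp add: rv_eq_0)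
  then show "sp u \<noteq> sp v" "sp u \<noteq> - sp v" by (auto simp: cross_minus_left)
qed

definition iarc :: "ivec \<times> ivec \<Rightarrow> arc" where
  "iarc a = (sp (fst a), sp (snd a))"

lemma valid_iarc:
  assumes "icross (fst a) (snd a) \<noteq> (0, 0, 0)"
  shows "valid_arc (iarc a)"
  using sp_neq[OF assms] norm_sp icross_nz[OF assms] by (simp add: valid_arc_def iarc_def on_sphere_def)

lemma rv_plane:
  assumes "idot (icross u v) w = 0"
  shows "of_int (idot (icross u v) (icross u v)) *\<^sub>R rv w
       = of_int (idot (icross w v) (icross u v)) *\<^sub>R rv u + of_int (idot (icross u w) (icross u v)) *\<^sub>R rv v"
proof -
  show ?thesis
    using cross_expansion[of "rv u" "rv v" "rv w"] assms by (simp add: rv_cross rv_dot)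
qed

text \<open>The two inequalities are the signs of the coefficients in
  \<open>rv_plane\<close>.\<close>

definition in_iarc :: "ivec \<Rightarrow> ivec \<times> ivec \<Rightarrow> bool" where
  "in_iarc w a = (let u = fst a; v = snd a; N = icross u v in
     idot N w = 0 \<and> idot (icross w v) N > 0 \<and> idot (icross u w) N > 0)"

lemma idot_self_pos: "u \<noteq> (0, 0, 0) \<Longrightarrow> idot u u > 0"
  using rv_dot[of u u] rv_eq_0[of u] inner_gt_zero_iff[of "rv u"] by simp

lemma in_iarc_relint:
  assumes a: "icross (fst a) (snd a) \<noteq> (0, 0, 0)" and w: "in_iarc w a"
  shows "sp w \<in> arc_relint (iarc a)"
proof -
  obtain u v where uv: "a = (u, v)" by (cases a)
  let ?N = "icross u v"
  have w: "idot ?N w = 0" "idot (icross w v) ?N > 0" "idot (icross u w) ?N > 0" using w by (auto simp: in_iarc_def uv Let_def)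
  have nz: "?N \<noteq> (0, 0, 0)" using a uv by simp
  have w0: "w \<noteq> (0, 0, 0)"
  proof
    assume "w = (0, 0, 0)"
    then have "icross w v = (0, 0, 0)" by (cases v) simp
    then have "idot (icross w v) ?N = 0" by (cases ?N) simp
    then show False using w by simp
  qed
  obtain p q r where k: "p > 0" "q > 0" "r > 0" "sp u = p *\<^sub>R rv u" "sp v = q *\<^sub>R rv v" "sp w = r *\<^sub>R rv w"
    using sp_scale icross_nz[OF nz] w0 by metis
  let ?n = "real_of_int (idot ?N ?N)" and ?a = "real_of_int (idot (icross w v) ?N)" and ?b = "real_of_int (idot (icross u w) ?N)"
  have n: "?n > 0" using idot_self_pos[OF nz] by simp
  have "sp w = (r / ?n) *\<^sub>R (?n *\<^sub>R rv w)" using n k by simp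
  also have "?n *\<^sub>R rv w = ?a *\<^sub>R rv u + ?b *\<^sub>R rv v" by (rule rv_plane[OF w(1)])
  also have "(r / ?n) *\<^sub>R \<dots> = (r / ?n * ?a / p) *\<^sub>R sp u + (r / ?n * ?b / q) *\<^sub>R sp v"
    using k by (simp add: scaleR_add_right)
  finally have "sp w \<in> ocone (iarc a)"
    using oconeI[of "r / ?n * ?a / p" "r / ?n * ?b / q" "iarc a"] k n w by (simp add: iarc_def uv)
  then show ?thesis using norm_sp[OF w0] by (intro ocone_imp_relint)
qed

text \<open>Deliberately weak: arcs may touch the plane from both sides. One strict value on
  \<open>a\<close> suffices, since a point of the open cone has both coefficients positive.\<close>

definition separates :: "ivec \<Rightarrow> ivec \<times> ivec \<Rightarrow> ivec \<times> ivec \<Rightarrow> bool" where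
  "separates l a b \<longleftrightarrow> idot l (fst a) \<ge> 0 \<and> idot l (snd a) \<ge> 0 \<and> idot l (fst a) + idot l (snd a) > 0
     \<and> idot l (fst b) \<le> 0 \<and> idot l (snd b) \<le> 0"

lemma separates_disjoint:
  assumes l: "separates l a b" and x: "x \<in> ocone (iarc a)" "x \<in> ocone (iarc b)"
  shows False
proof -
  have sp: "\<exists>k. k > 0 \<and> rv l \<bullet> sp u = k * of_int (idot l u)" for u
  proof (cases "u = (0, 0, 0)")
    case True
    then have "sp u = 0" using rv_eq_0[of u] by (simp add: sp_def)
    moreover have "idot l u = 0" using True by (cases l) simp
    ultimately show ?thesis by (auto intro: exI[of _ 1])
  next
    case False
    then obtain k where "k > 0" "sp u = k *\<^sub>R rv u" using sp_scale by metis
    then show ?thesis by (auto simp: rv_dot)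
  qed
  obtain \<alpha> \<beta> where ab: "\<alpha> > 0" "\<beta> > 0" "x = \<alpha> *\<^sub>R sp (fst a) + \<beta> *\<^sub>R sp (snd a)"
    using x by (auto simp: ocone_def iarc_def)
  obtain \<alpha>' \<beta>' where ab': "\<alpha>' > 0" "\<beta>' > 0" "x = \<alpha>' *\<^sub>R sp (fst b) + \<beta>' *\<^sub>R sp (snd b)"
    using x by (auto simp: ocone_def iarc_def)
  obtain k1 k2 k3 k4 where k: "k1 > 0" "rv l \<bullet> sp (fst a) = k1 * of_int (idot l (fst a))" "k2 > 0" "rv l \<bullet> sp (snd a) = k2 * of_int (idot l (snd a))"
    "k3 > 0" "rv l \<bullet> sp (fst b) = k3 * of_int (idot l (fst b))" "k4 > 0" "rv l \<bullet> sp (snd b) = k4 * of_int (idot l (snd b))"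
    using sp by metis
  have "rv l \<bullet> x \<le> 0" unfolding ab'(3) inner_add_right inner_scaleR_right k
    using l k ab' by (intro add_nonpos_nonpos mult_nonneg_nonpos) (auto simp: separates_def)
  moreover have "rv l \<bullet> x > 0"
  proof (cases "idot l (fst a) > 0")
    case True
    then show ?thesis unfolding ab(3) inner_add_right inner_scaleR_right k
      using l k ab by (intro add_pos_nonneg mult_pos_pos mult_nonneg_nonneg) (auto simp: separates_def)
  next
    case False
    then have "idot l (snd a) > 0" using l by (auto simp: separates_def)
    then show ?thesis unfolding ab(3) inner_add_right inner_scaleR_right k
      using l k ab by (intro add_nonneg_pos mult_pos_pos mult_nonneg_nonneg) (auto simp: separates_def)
  qed
  ultimately show False by simp
qed

lemma arc_points_nonneg:
  assumes "x \<in> arc_points a"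
  obtains \<alpha> \<beta> where "\<alpha> \<ge> 0" "\<beta> \<ge> 0" "x = \<alpha> *\<^sub>R fst a + \<beta> *\<^sub>R snd a"
proof -
  obtain t where t: "0 \<le> t" "t \<le> 1" "x = sgn ((1 - t) *\<^sub>R fst a + t *\<^sub>R snd a)"
    using assms by (auto simp: arc_points_def)
  let ?c = "inverse (norm ((1 - t) *\<^sub>R fst a + t *\<^sub>R snd a))"
  show ?thesis
    using that[of "?c * (1 - t)" "?c * t"] t by (simp add: sgn_div_norm scaleR_add_right)
qed

text \<open>Coefficients of opposite sign exclude \<open>p\<close> and its antipode at once.\<close>

definition avoids :: "ivec \<Rightarrow> ivec \<times> ivec \<Rightarrow> bool" where
  "avoids p a = (let u = fst a; v = snd a; N = icross u v in
     idot N p = 0 \<and> idot (icross p v) N * idot (icross u p) N < 0)"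

lemma avoids_arc_points:
  assumes a: "icross (fst a) (snd a) \<noteq> (0, 0, 0)" and p: "avoids p a"
  shows "sp p \<notin> arc_points (iarc a)" "- sp p \<notin> arc_points (iarc a)" "det3 (sp (fst a)) (sp (snd a)) (sp p) = 0"
proof -
  obtain u v where uv: "a = (u, v)" by (cases a)
  let ?N = "icross u v"
  have p: "idot ?N p = 0" "idot (icross p v) ?N * idot (icross u p) ?N < 0" using p by (auto simp: avoids_def uv Let_def)
  have nz: "?N \<noteq> (0, 0, 0)" using a uv by simp
  have p0: "p \<noteq> (0, 0, 0)"
  proof
    assume "p = (0, 0, 0)"
    then have "icross p v = (0, 0, 0)" by (cases v) simp
    then have "idot (icross p v) ?N = 0" by (cases ?N) simp
    then show False using p by simp
  qed
  obtain k1 k2 r where k: "k1 > 0" "k2 > 0" "r > 0" "sp u = k1 *\<^sub>R rv u" "sp v = k2 *\<^sub>R rv v" "sp p = r *\<^sub>R rv p"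
    using sp_scale icross_nz[OF nz] p0 by metis
  have key: False if pt: "\<sigma> *\<^sub>R sp p \<in> arc_points (iarc a)" and \<sigma>: "\<sigma> \<noteq> 0" for \<sigma> :: real
  proof -
    obtain \<alpha> \<beta> where ab: "\<alpha> \<ge> 0" "\<beta> \<ge> 0" "\<sigma> *\<^sub>R sp p = \<alpha> *\<^sub>R sp u + \<beta> *\<^sub>R sp v"
      using arc_points_nonneg[OF pt] by (auto simp: iarc_def uv)
    then have "\<sigma> *\<^sub>R r *\<^sub>R rv p = (\<alpha> * k1) *\<^sub>R rv u + (\<beta> * k2) *\<^sub>R rv v" by (simp add: k)
    then have eq: "(\<sigma> * r) *\<^sub>R rv p = (\<alpha> * k1) *\<^sub>R rv u + (\<beta> * k2) *\<^sub>R rv v" by simp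
    have e1: "(\<sigma> * r) *\<^sub>R cross3 (rv p) (rv v) = (\<alpha> * k1) *\<^sub>R cross3 (rv u) (rv v)"
      using arg_cong[OF eq, of "\<lambda>x. cross3 x (rv v)"] by (simp add: cross_add_left cross_mult_left)
    have 1: "(\<sigma> * r) * of_int (idot (icross p v) ?N) = (\<alpha> * k1) * of_int (idot ?N ?N)"
      using arg_cong[OF e1, of "\<lambda>x. x \<bullet> rv ?N"] by (simp add: rv_cross rv_dot)
    have e2: "(\<sigma> * r) *\<^sub>R cross3 (rv u) (rv p) = (\<beta> * k2) *\<^sub>R cross3 (rv u) (rv v)"
      using arg_cong[OF eq, of "\<lambda>x. cross3 (rv u) x"] by (simp add: cross_add_right cross_mult_right)
    have 2: "(\<sigma> * r) * of_int (idot (icross u p) ?N) = (\<beta> * k2) * of_int (idot ?N ?N)"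
      using arg_cong[OF e2, of "\<lambda>x. x \<bullet> rv ?N"] by (simp add: rv_cross rv_dot)
    have "idot ?N ?N > 0" by (rule idot_self_pos[OF nz])
    then have "((\<alpha> * k1) * of_int (idot ?N ?N)) * ((\<beta> * k2) * of_int (idot ?N ?N)) \<ge> 0" using ab k by simp
    then have "((\<sigma> * r) * of_int (idot (icross p v) ?N)) * ((\<sigma> * r) * of_int (idot (icross u p) ?N)) \<ge> 0" by (simp only: 1 2)
    then have "(\<sigma> * r)\<^sup>2 * of_int (idot (icross p v) ?N * idot (icross u p) ?N) \<ge> 0" by (simp add: power2_eq_square mult_ac)
    moreover have "(\<sigma> * r)\<^sup>2 > 0" using \<sigma> k by simp
    ultimately have "real_of_int (idot (icross p v) ?N * idot (icross u p) ?N) \<ge> 0" by (simp only: zero_le_mult_iff) linarith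
    then show False using p(2) by linarith
  qed
  show "sp p \<notin> arc_points (iarc a)" using key[of 1] by auto
  show "- sp p \<notin> arc_points (iarc a)" using key[of "-1"] by auto
  have "u \<noteq> (0,0,0)" "v \<noteq> (0,0,0)" using icross_nz[OF nz] by auto
  then obtain k where "det3 (sp u) (sp v) (sp p) = k * of_int (idet u v p)" using sp_det[of u v p] p0 by metis
  then show "det3 (sp (fst a)) (sp (snd a)) (sp p) = 0" using p(1) by (simp add: uv idet_def)
qed


text \<open>An entry lists the two endpoints of an arc, its pole, and the indices of the arcs that block
  its first and its second endpoint.\<close>

type_synonym entry = "(ivec \<times> ivec) \<times> ivec \<times> nat \<times> nat"

definition arc_of :: "entry list \<Rightarrow> nat \<Rightarrow> ivec \<times> ivec" where
  "arc_of dat i = fst (dat ! i)"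

definition pole_of :: "entry list \<Rightarrow> nat \<Rightarrow> ivec" where
  "pole_of dat i = fst (snd (dat ! i))"

definition hit_of :: "entry list \<Rightarrow> nat \<Rightarrow> bool \<Rightarrow> nat" where
  "hit_of dat i d = (if d then snd (snd (snd (dat ! i))) else fst (snd (snd (dat ! i))))"

definition endp :: "ivec \<times> ivec \<Rightarrow> bool \<Rightarrow> ivec" where
  "endp a d = (if d then snd a else fst a)"

text \<open>For \<open>j < i\<close> the vector \<open>seps ! i ! j\<close> is the normal of a plane separating the arcs \<open>i\<close> and \<open>j\<close>.\<close>

definition check_diagram :: "entry list \<Rightarrow> ivec list list \<Rightarrow> ivec list \<Rightarrow> bool" where
  "check_diagram dat seps ps \<longleftrightarrow> dat \<noteq> [] \<and>
     list_all (\<lambda>i. icross (fst (arc_of dat i)) (snd (arc_of dat i)) \<noteq> (0, 0, 0)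
        \<and> pole_of dat i \<in> set ps \<and> avoids (pole_of dat i) (arc_of dat i)
        \<and> hit_of dat i True < length dat \<and> in_iarc (endp (arc_of dat i) True) (arc_of dat (hit_of dat i True))
        \<and> hit_of dat i False < length dat \<and> in_iarc (endp (arc_of dat i) False) (arc_of dat (hit_of dat i False))
        \<and> list_all (\<lambda>j. separates (seps ! i ! j) (arc_of dat i) (arc_of dat j)
              \<or> separates (seps ! i ! j) (arc_of dat j) (arc_of dat i)) [0..<i]) [0..<length dat]"

definition diagram :: "entry list \<Rightarrow> arc set" where
  "diagram dat = (\<lambda>i. iarc (arc_of dat i)) ` {..<length dat}"

text \<open>Only recorded blockers are tested; disjointness of interiors ensures that no other hits
  exist.\<close>

definition check_one_sided :: "entry list \<Rightarrow> int list \<Rightarrow> bool" where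
  "check_one_sided dat sides \<longleftrightarrow> list_all (\<lambda>i. list_all (\<lambda>j. (hit_of dat j True = i \<or> hit_of dat j False = i) \<longrightarrow>
     (sides ! i) * idet (fst (arc_of dat i)) (snd (arc_of dat i)) (fst (arc_of dat j)) \<ge> 0 \<and>
     (sides ! i) * idet (fst (arc_of dat i)) (snd (arc_of dat i)) (snd (arc_of dat j)) \<ge> 0) [0..<length dat]
     \<and> (sides ! i = 1 \<or> sides ! i = - 1)) [0..<length dat]"

text \<open>A state \<open>(i, d)\<close> is arc \<open>i\<close> traversed towards its second endpoint iff \<open>d\<close>; on hitting
  the next arc one turns left if \<open>t = 1\<close> and right if \<open>t = - 1\<close>.\<close>

definition turn :: "entry list \<Rightarrow> int \<Rightarrow> nat \<times> bool \<Rightarrow> nat \<times> bool" where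
  "turn dat t k = (let j = hit_of dat (fst k) (snd k); a = arc_of dat j in
     (j, t * idet (fst a) (snd a) (endp (arc_of dat (fst k)) (\<not> snd k)) > 0))"

fun trace :: "(nat \<times> bool \<Rightarrow> nat \<times> bool) \<Rightarrow> nat \<Rightarrow> nat \<times> bool \<Rightarrow> nat list" where
  "trace f 0 k = []"
| "trace f (Suc n) k = fst k # trace f n (f k)"

text \<open>The search stops as soon as an arc index recurs in either direction, because the arcs of
  a swirl are distinct. A return to the start requires the collected list to occur in
  \<open>cs\<close>.\<close>

fun orbit_ok :: "nat list list \<Rightarrow> (nat \<times> bool \<Rightarrow> nat \<times> bool) \<Rightarrow> nat \<Rightarrow> nat \<times> bool \<Rightarrow> nat \<times> bool \<Rightarrow> nat list \<Rightarrow> bool" where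
  "orbit_ok cs f 0 k0 k acc \<longleftrightarrow> True"
| "orbit_ok cs f (Suc n) k0 k acc \<longleftrightarrow> fst k \<in> set acc \<or>
     (let acc' = acc @ [fst k]; k' = f k in
       (k' = k0 \<longrightarrow> acc' \<in> set cs) \<and> orbit_ok cs f n k0 k' acc')"

definition check_swirls :: "entry list \<Rightarrow> nat list list \<Rightarrow> bool" where
  "check_swirls dat cs \<longleftrightarrow> list_all (\<lambda>t. list_all (\<lambda>i. list_all (\<lambda>d.
     orbit_ok (concat (map (\<lambda>c. map (\<lambda>r. rotate r c) [0..<length c]) cs)) (turn dat t) (length dat) (i, d) (i, d) [])
     [True, False]) [0..<length dat]) [1, - 1]"

lemma trace_eq: "trace f n k = map (\<lambda>i. fst ((f ^^ i) k)) [0..<n]"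
proof (induction n arbitrary: k)
  case (Suc n)
  have "map (\<lambda>i. fst ((f ^^ i) k)) [0..<Suc n] = fst k # map (\<lambda>i. fst ((f ^^ i) (f k))) [0..<n]"
    by (simp add: upt_conv_Cons map_Suc_upt[symmetric] funpow_swap1 del: upt_Suc)
  then show ?case using Suc by simp
qed simp

lemma orbit_okD:
  assumes "orbit_ok cs f n k0 k acc" "m \<le> n" "m > 0" "distinct (acc @ trace f m k)" "(f ^^ m) k = k0"
  shows "acc @ trace f m k \<in> set cs"
  using assms
proof (induction n arbitrary: k acc m)
  case (Suc n)
  obtain m' where m: "m = Suc m'" using Suc.prems by (cases m) auto
  have 1: "(f k = k0 \<longrightarrow> acc @ [fst k] \<in> set cs) \<and> orbit_ok cs f n k0 (f k) (acc @ [fst k])"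
    using Suc.prems by (auto simp: m Let_def)
  show ?case
  proof (cases "m' = 0")
    case True
    then show ?thesis using 1 Suc.prems by (simp add: m)
  next
    case False
    then have "(acc @ [fst k]) @ trace f m' (f k) \<in> set cs"
      using Suc.prems 1 by (intro Suc.IH) (auto simp: m funpow_swap1)
    then show ?thesis by (simp add: m)
  qed
qed simp

section \<open>From a successful check to a diagram and an upper bound for its swirls\<close>

context
  fixes dat seps ps
  assumes chk: "check_diagram dat seps ps"
begin

lemma dat_arc:
  assumes "i < length dat"
  shows "icross (fst (arc_of dat i)) (snd (arc_of dat i)) \<noteq> (0, 0, 0)"
    "pole_of dat i \<in> set ps" "avoids (pole_of dat i) (arc_of dat i)"
    "hit_of dat i d < length dat" "in_iarc (endp (arc_of dat i) d) (arc_of dat (hit_of dat i d))"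
  using chk assms by (cases d; auto simp: check_diagram_def list_all_iff)+

lemma dat_disjoint:
  assumes ij: "i < length dat" "j < length dat" and x: "x \<in> ocone (iarc (arc_of dat i))" "x \<in> ocone (iarc (arc_of dat j))"
  shows "i = j"
proof (rule ccontr)
  have *: False if "i < length dat" "j < i" "x \<in> ocone (iarc (arc_of dat i))" "x \<in> ocone (iarc (arc_of dat j))" for i j
  proof -
    have "separates (seps ! i ! j) (arc_of dat i) (arc_of dat j) \<or> separates (seps ! i ! j) (arc_of dat j) (arc_of dat i)"
      using chk that(1,2) by (auto simp: check_diagram_def list_all_iff)
    then show False using separates_disjoint that(3,4) by blast
  qed
  assume "i \<noteq> j"
  then show False using *[of i j] *[of j i] ij x by (metis linorder_neqE_nat)
qed

lemma dat_valid: "i < length dat \<Longrightarrow> valid_arc (iarc (arc_of dat i))"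
  using dat_arc(1) by (rule valid_iarc)

lemma dat_hit:
  assumes "i < length dat"
  shows "sp (endp (arc_of dat i) d) \<in> arc_relint (iarc (arc_of dat (hit_of dat i d)))"
  using dat_arc(1)[OF dat_arc(4)[OF assms]] dat_arc(5)[OF assms] by (rule in_iarc_relint)

lemma dat_inj: "inj_on (\<lambda>i. iarc (arc_of dat i)) {..<length dat}"
proof (rule inj_onI)
  fix i j assume ij: "i \<in> {..<length dat}" "j \<in> {..<length dat}" "iarc (arc_of dat i) = iarc (arc_of dat j)"
  have "1 *\<^sub>R fst (iarc (arc_of dat i)) + 1 *\<^sub>R snd (iarc (arc_of dat i)) \<in> ocone (iarc (arc_of dat i))"
    by (rule oconeI) auto
  then show "i = j" using dat_disjoint ij by (metis lessThan_iff)
qed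

lemma card_diagram: "card (diagram dat) = length dat"
  by (simp add: diagram_def card_image dat_inj)

lemma diagram_SD: "is_SD (diagram dat)"
  unfolding is_SD_def
proof (intro conjI ballI impI)
  show "finite (diagram dat)" by (simp add: diagram_def)
  show "diagram dat \<noteq> {}" using chk by (auto simp: diagram_def check_diagram_def)
next
  fix a assume "a \<in> diagram dat"
  then obtain i where i: "i < length dat" "a = iarc (arc_of dat i)" by (auto simp: diagram_def)
  show "valid_arc a" using dat_valid i by simp
  show "\<exists>b\<in>diagram dat. fst a \<in> arc_relint b"
    using dat_hit[OF i(1), of False] dat_arc(4)[OF i(1), of False] by (auto simp: i(2) diagram_def iarc_def endp_def)
  show "\<exists>b\<in>diagram dat. snd a \<in> arc_relint b"
    using dat_hit[OF i(1), of True] dat_arc(4)[OF i(1), of True] by (auto simp: i(2) diagram_def iarc_def endp_def)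
next
  fix a b assume "a \<in> diagram dat" "b \<in> diagram dat" "a \<noteq> b"
  then obtain i j where i: "i < length dat" "a = iarc (arc_of dat i)" and j: "j < length dat" "b = iarc (arc_of dat j)" and "i \<noteq> j"
    by (auto simp: diagram_def)
  then show "arc_relint a \<inter> arc_relint b = {}"
    using relint_imp_ocone dat_valid dat_disjoint by blast
qed

lemma diagram_oriented:
  assumes "distinct (map sp ps)" "\<And>p. p \<in> set ps \<Longrightarrow> p \<noteq> (0, 0, 0)" "\<And>p q. p \<in> set ps \<Longrightarrow> q \<in> set ps \<Longrightarrow> sp q \<noteq> - sp p"
  shows "\<exists>f. oriented (length ps) (diagram dat) (sp ` set ps) f"
proof
  define idx where "idx = (\<lambda>a. inv_into {..<length dat} (\<lambda>i. iarc (arc_of dat i)) a)"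
  have idx: "idx (iarc (arc_of dat i)) = i" if "i < length dat" for i
    unfolding idx_def using that inv_into_f_f[OF dat_inj] by simp
  have "card (sp ` set ps) = length ps" using distinct_card[OF assms(1)] by simp
  moreover have "sp (pole_of dat i) \<in> sp ` set ps \<and> det3 (fst (iarc (arc_of dat i))) (snd (iarc (arc_of dat i))) (sp (pole_of dat i)) = 0
     \<and> sp (pole_of dat i) \<notin> arc_points (iarc (arc_of dat i)) \<and> - sp (pole_of dat i) \<notin> arc_points (iarc (arc_of dat i))" if "i < length dat" for i
    using avoids_arc_points[OF dat_arc(1,3)[OF that]] dat_arc(2)[OF that] by (simp add: iarc_def)
  ultimately show "oriented (length ps) (diagram dat) (sp ` set ps) (\<lambda>a. sp (pole_of dat (idx a)))"
    using assms(2,3) by (auto simp: oriented_def on_sphere_def norm_sp diagram_def idx)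
qed

lemma diagram_SOD:
  assumes sd: "check_one_sided dat sides"
  shows "is_SOD (diagram dat)"
  unfolding is_SOD_def
proof (intro conjI ballI diagram_SD)
  fix a assume "a \<in> diagram dat"
  then obtain i where i: "i < length dat" "a = iarc (arc_of dat i)" by (auto simp: diagram_def)
  let ?s = "sides ! i"
  have s: "?s = 1 \<or> ?s = - 1" using sd i by (auto simp: check_one_sided_def list_all_iff)
  have pos: "of_int ?s * det3 (fst a) (snd a) x \<ge> 0" if b: "b \<in> diagram dat" "hits b a" "x \<in> arc_points b" for b x
  proof -
    obtain j where j: "j < length dat" "b = iarc (arc_of dat j)" using b by (auto simp: diagram_def)
    have hij: "hit_of dat j d = i" if "sp (endp (arc_of dat j) d) \<in> arc_relint a" for d
    proof (rule dat_disjoint[OF dat_arc(4)[OF j(1)] i(1)])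
      show "sp (endp (arc_of dat j) d) \<in> ocone (iarc (arc_of dat (hit_of dat j d)))"
        by (rule relint_imp_ocone[OF dat_valid[OF dat_arc(4)[OF j(1)]] dat_hit[OF j(1)]])
      show "sp (endp (arc_of dat j) d) \<in> ocone (iarc (arc_of dat i))"
        using relint_imp_ocone[OF dat_valid[OF i(1)]] that i by simp
    qed
    have "hit_of dat j True = i \<or> hit_of dat j False = i"
      using b(2) hij[of True] hij[of False] by (auto simp: hits_def j(2) iarc_def endp_def)
    then have g: "?s * idet (fst (arc_of dat i)) (snd (arc_of dat i)) (fst (arc_of dat j)) \<ge> 0"
      "?s * idet (fst (arc_of dat i)) (snd (arc_of dat i)) (snd (arc_of dat j)) \<ge> 0"
      using sd i j by (auto simp: check_one_sided_def list_all_iff)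
    have nz: "fst (arc_of dat k) \<noteq> (0, 0, 0) \<and> snd (arc_of dat k) \<noteq> (0, 0, 0)" if "k < length dat" for k
      using icross_nz dat_arc(1)[OF that] by blast
    obtain k where k: "k > 0" "det3 (fst a) (snd a) (fst b) = k * of_int (idet (fst (arc_of dat i)) (snd (arc_of dat i)) (fst (arc_of dat j)))"
      using sp_det[of "fst (arc_of dat i)" "snd (arc_of dat i)" "fst (arc_of dat j)"] nz i j by (auto simp: iarc_def)
    obtain k' where k': "k' > 0" "det3 (fst a) (snd a) (snd b) = k' * of_int (idet (fst (arc_of dat i)) (snd (arc_of dat i)) (snd (arc_of dat j)))"
      using sp_det[of "fst (arc_of dat i)" "snd (arc_of dat i)" "snd (arc_of dat j)"] nz i j by (auto simp: iarc_def)
    obtain \<alpha> \<beta> where ab: "\<alpha> \<ge> 0" "\<beta> \<ge> 0" "x = \<alpha> *\<^sub>R fst b + \<beta> *\<^sub>R snd b" by (rule arc_points_nonneg[OF b(3)])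
    have "of_int ?s * det3 (fst a) (snd a) x = \<alpha> * k * of_int (?s * idet (fst (arc_of dat i)) (snd (arc_of dat i)) (fst (arc_of dat j)))
       + \<beta> * k' * of_int (?s * idet (fst (arc_of dat i)) (snd (arc_of dat i)) (snd (arc_of dat j)))"
      unfolding ab(3) by (simp add: det3_def inner_add_right) (simp add: k k' flip: det3_def, simp add: algebra_simps)
    also have "\<dots> \<ge> 0" using g ab k k' by (intro add_nonneg_nonneg mult_nonneg_nonneg) (auto simp del: of_int_mult)
    finally show ?thesis .
  qed
  show "(\<forall>b\<in>diagram dat. hits b a \<longrightarrow> arc_points b \<subseteq> {x. det3 (fst a) (snd a) x \<ge> 0}) \<or>
        (\<forall>b\<in>diagram dat. hits b a \<longrightarrow> arc_points b \<subseteq> {x. det3 (fst a) (snd a) x \<le> 0})"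
    using s
  proof
    assume "?s = 1" then show ?thesis using pos by auto
  next
    assume "?s = - 1" then show ?thesis using pos by auto
  qed
qed


lemma rotate_class:
  "{rotate n (rotate r xs) | n. True} = {rotate n xs | n. True}"
proof (cases "xs = []")
  case False
  have "rotate n xs = rotate (n + (length xs - r mod length xs)) (rotate r xs)" for n
  proof -
    have "r mod length xs < length xs" using False by simp
    then have eq: "n + (length xs - r mod length xs) + r mod length xs = n + length xs" by linarith
    have "rotate (n + (length xs - r mod length xs)) (rotate r xs) = rotate (n + (length xs - r mod length xs)) (rotate (r mod length xs) xs)"
      by (metis rotate_conv_mod)
    also have "\<dots> = rotate (n + length xs) xs" by (simp only: rotate_rotate eq)
    also have "\<dots> = rotate n xs" by (metis mod_add_self2 rotate_conv_mod)
    finally show ?thesis by simp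
  qed
  then show ?thesis by (auto simp: rotate_rotate)
qed simp

text \<open>For a fixed orientation the turn at each head is determined, so every swirl is an orbit
  of \<open>turn\<close> and the finite search over all starting states finds it up to
  rotation.\<close>

lemma diagram_swirls:
  assumes cs: "check_swirls dat cs"
  shows "swirls (diagram dat) \<subseteq> (\<lambda>c. {rotate n (map (\<lambda>i. iarc (arc_of dat i)) c) | n. True}) ` set cs"
proof
  let ?D = "diagram dat" and ?N = "length dat"
  fix C assume "C \<in> swirls ?D"
  then obtain xs s e where xs: "is_swirl ?D xs" "swirl_ends xs s e" and C: "C = {rotate n xs | n. True}"
    unfolding swirls_def is_swirl_alt by blast
  let ?n = "length xs"
  have n: "?n > 0" "distinct xs" "set xs \<subseteq> ?D" using xs(1) by (auto simp: is_swirl_def)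
  obtain t :: int where t: "t = 1 \<or> t = - 1" and pos: "\<And>i. i < ?n \<Longrightarrow> of_int t * det3 (s i) (e i) (e ((i + 1) mod ?n)) > 0"
  proof (cases "\<forall>i<?n. det3 (s i) (e i) (e ((i + 1) mod ?n)) > 0")
    case True
    then show ?thesis using that[of 1] by auto
  next
    case False
    then show ?thesis using xs(2) that[of "- 1"] by (auto simp: swirl_ends_def)
  qed
  have t': "real_of_int t = 1 \<or> real_of_int t = - 1" using t by auto
  interpret arrangement "dirs ?D" "of_int t" by (rule SD_arrangement[OF diagram_SD t'])
  \<comment> \<open>Geometric directed arc belonging to a search state.\<close>
  define B where "B = (\<lambda>k. (sp (endp (arc_of dat (fst k)) (\<not> snd k)), sp (endp (arc_of dat (fst k)) (snd k))))"
  have B: "B k = (if snd k then iarc (arc_of dat (fst k)) else prod.swap (iarc (arc_of dat (fst k))))" for k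
    by (simp add: B_def iarc_def endp_def)
  have oB: "ocone (B k) = ocone (iarc (arc_of dat (fst k)))" for k by (simp add: B)
  have B_dirs: "B k \<in> dirs ?D" if "fst k < ?N" for k using that by (auto simp: B dirs_def diagram_def)
  have dirs_B: "\<exists>k. fst k < ?N \<and> b = B k" if b: "b \<in> dirs ?D" for b
  proof -
    obtain i where i: "i < ?N" "b = iarc (arc_of dat i) \<or> b = prod.swap (iarc (arc_of dat i))"
      using b by (auto simp: dirs_def diagram_def)
    then have "b = B (i, True) \<or> b = B (i, False)" by (auto simp: B)
    then show ?thesis using i(1) by (metis fst_conv)
  qed
  have ne: "\<exists>x. x \<in> ocone a" for a using oconeI[of 1 1 a] by auto
  have B_inj: "k = k'" if k: "fst k < ?N" "fst k' < ?N" "B k = B k'" for k k'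
  proof -
    have "fst k = fst k'" using ne[of "B k"] oB k dat_disjoint[OF k(1,2)] by metis
    moreover have "snd k = snd k'"
    proof (rule ccontr)
      assume "snd k \<noteq> snd k'"
      then have "prod.swap (iarc (arc_of dat (fst k))) = iarc (arc_of dat (fst k))"
        using k(3) \<open>fst k = fst k'\<close> by (auto simp: B split: if_splits)
      moreover have "iarc (arc_of dat (fst k)) \<in> dirs ?D" using B_dirs[of "(fst k, True)"] k by (simp add: B)
      ultimately show False using swap_neq by blast
    qed
    ultimately show ?thesis by (simp add: prod_eq_iff)
  qed
  have nz: "endp (arc_of dat i) d \<noteq> (0, 0, 0)" if "i < ?N" for i d
    using icross_nz[OF dat_arc(1)[OF that]] by (simp add: endp_def)
  let ?f = "turn dat t"
  have f_lt: "fst (?f k) < ?N" if "fst k < ?N" for k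
    using dat_arc(4)[OF that] by (simp add: turn_def Let_def)
  have B_lstep: "lstep (B k) (B (?f k))" if k: "fst k < ?N" for k
  proof -
    let ?j = "hit_of dat (fst k) (snd k)"
    let ?a = "arc_of dat ?j" and ?w = "endp (arc_of dat (fst k)) (\<not> snd k)"
    have j: "?j < ?N" by (rule dat_arc(4)[OF k])
    have o: "snd (B k) \<in> ocone (iarc ?a)"
      using relint_imp_ocone[OF dat_valid[OF j] dat_hit[OF k]] by (simp add: B_def)
    have aS: "iarc ?a \<in> dirs ?D" using j by (auto simp: dirs_def diagram_def)
    obtain r where r: "r > 0" "det3 (sp (fst ?a)) (sp (snd ?a)) (sp ?w) = r * of_int (idet (fst ?a) (snd ?a) ?w)"
      using sp_det[of "fst ?a" "snd ?a" ?w] nz[OF j, of False] nz[OF j, of True] nz[OF k] by (auto simp: endp_def)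
    have d: "dt (fst (iarc ?a)) (snd (iarc ?a)) (fst (B k)) = r * of_int (t * idet (fst ?a) (snd ?a) ?w)"
      by (simp add: dt_def iarc_def B_def r)
    have "dt (fst (iarc ?a)) (snd (iarc ?a)) (fst (B k)) \<noteq> 0" by (rule transversal[OF B_dirs[OF k] aS o])
    then have nz0: "t * idet (fst ?a) (snd ?a) ?w \<noteq> 0" unfolding d by auto
    show ?thesis
    proof (cases "t * idet (fst ?a) (snd ?a) ?w > 0")
      case True
      then have "B (?f k) = iarc ?a" by (simp add: B turn_def Let_def)
      moreover have "left_of (iarc ?a) (fst (B k))" unfolding left_of_def d using True r by (simp del: of_int_mult)
      ultimately show ?thesis using B_dirs[OF k] aS o by (simp add: lstep_def)
    next
      case False
      then have neg: "t * idet (fst ?a) (snd ?a) ?w < 0" using nz0 by linarith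
      have "B (?f k) = prod.swap (iarc ?a)" using False by (simp add: B turn_def Let_def)
      moreover have "left_of (prod.swap (iarc ?a)) (fst (B k))"
        unfolding left_of_swap d using neg r(1) by (intro mult_pos_neg) (auto simp del: of_int_mult)
      ultimately show ?thesis using B_dirs[OF k] swapS[OF aS] o by (simp add: lstep_def)
    qed
  qed
  define b where "b = (\<lambda>i. (s i, e i))"
  have bx: "xs ! i = b i \<or> xs ! i = prod.swap (b i)" if "i < ?n" for i
    using xs(2) that by (auto simp: swirl_ends_def b_def)
  have b_dirs: "b i \<in> dirs ?D" if "i < ?n" for i
  proof -
    have "xs ! i \<in> ?D" using n(3) that by auto
    then have "xs ! i \<in> dirs ?D" by (simp add: dirs_def)
    then show ?thesis using bx[OF that] swapS[of "xs ! i"] by auto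
  qed
  have ob: "ocone (b i) = ocone (xs ! i)" if "i < ?n" for i using bx[OF that] by auto
  have b_lstep: "lstep (b i) (b ((i + 1) mod ?n))" if i: "i < ?n" for i
  proof -
    let ?j = "(i + 1) mod ?n"
    have j: "?j < ?n" using n(1) by simp
    have "xs ! ?j \<in> ?D" using n(3) j by auto
    then have "valid_arc (xs ! ?j)" using diagram_SD by (auto simp: is_SD_def)
    moreover have "e i \<in> arc_relint (xs ! ?j)" using xs(2) i by (auto simp: swirl_ends_def)
    ultimately have o: "snd (b i) \<in> ocone (b ?j)" using relint_imp_ocone ob[OF j] by (simp add: b_def)
    obtain \<alpha> where \<alpha>: "\<alpha> > 0" "\<And>x. dt (snd (b i)) (snd (b ?j)) x = \<alpha> * dt (fst (b ?j)) (snd (b ?j)) x"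
      using ocone_dt[OF o] by blast
    have "dt (fst (b i)) (snd (b i)) (snd (b ?j)) > 0" using pos[OF i] by (simp add: dt_def b_def)
    also have "dt (fst (b i)) (snd (b i)) (snd (b ?j)) = dt (snd (b i)) (snd (b ?j)) (fst (b i))" by (rule dt_cyc)
    also have "\<dots> = \<alpha> * dt (fst (b ?j)) (snd (b ?j)) (fst (b i))" by (rule \<alpha>(2))
    finally have "left_of (b ?j) (fst (b i))" using \<alpha>(1) by (simp add: left_of_def zero_less_mult_iff)
    then show ?thesis using o b_dirs[OF i] b_dirs[OF j] by (simp add: lstep_def)
  qed
  obtain k where k: "fst k < ?N" "b 0 = B k" using dirs_B[OF b_dirs[OF n(1)]] by blast
  have fk: "fst ((?f ^^ i) k) < ?N" for i using k f_lt by (induction i) auto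
  have bB: "b (i mod ?n) = B ((?f ^^ i) k)" for i
  proof (induction i)
    case 0
    then show ?case using k by simp
  next
    case (Suc i)
    have 1: "lstep (b (i mod ?n)) (b (Suc i mod ?n))" using b_lstep[of "i mod ?n"] n(1) by (simp add: mod_Suc_eq)
    have 2: "lstep (b (i mod ?n)) (B ((?f ^^ Suc i) k))" using B_lstep[OF fk[of i]] Suc by simp
    \<comment> \<open>The swirl and the simulation leave the same directed arc by left turns, hence
      continue along the same one.\<close>
    then show ?case using lstep_unique[OF 1 2] by (simp add: lstep_def)
  qed
  have per: "(?f ^^ ?n) k = k" using bB[of ?n] k B_inj fk by simp
  have xi: "xs ! i = iarc (arc_of dat (fst ((?f ^^ i) k)))" if i: "i < ?n" for i
  proof -
    obtain j where j: "j < ?N" "xs ! i = iarc (arc_of dat j)" using n(3) nth_mem[OF i] by (auto simp: diagram_def)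
    have "ocone (xs ! i) = ocone (iarc (arc_of dat (fst ((?f ^^ i) k))))" using ob[OF i] bB[of i] i oB by simp
    then have "j = fst ((?f ^^ i) k)" using ne dat_disjoint[OF j(1) fk] j(2) by metis
    then show ?thesis using j by simp
  qed
  have xt: "xs = map (\<lambda>i. iarc (arc_of dat i)) (trace ?f ?n k)"
    by (rule nth_equalityI) (simp_all add: trace_eq xi)
  then have dist: "distinct (trace ?f ?n k)" using n(2) by (metis distinct_map)
  \<comment> \<open>Distinctness bounds the swirl by the number of arcs, so the search depth
    suffices.\<close>
  have "?n = card (set xs)" using n(2) by (simp add: distinct_card)
  also have "\<dots> \<le> card ?D" using n(3) by (intro card_mono) (auto simp: diagram_def)
  finally have le: "?n \<le> ?N" by (simp add: card_diagram)
  let ?cs = "concat (map (\<lambda>c. map (\<lambda>r. rotate r c) [0..<length c]) cs)"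
  from cs have all: "\<forall>t\<in>set [1, - 1]. \<forall>i\<in>set [0..<?N]. \<forall>d\<in>set [True, False]. orbit_ok ?cs (turn dat t) ?N (i, d) (i, d) []"
    by (simp only: check_swirls_def list_all_iff)
  have "t \<in> set [1, - 1]" "fst k \<in> set [0..<?N]" "snd k \<in> set [True, False]" using t k(1) by auto
  with all have "orbit_ok ?cs ?f ?N (fst k, snd k) (fst k, snd k) []" by blast
  then have "orbit_ok ?cs ?f ?N k k []" by simp
  then have "[] @ trace ?f ?n k \<in> set ?cs" using le n(1) dist per by (intro orbit_okD) auto
  then obtain c r where c: "c \<in> set cs" "trace ?f ?n k = rotate r c" by auto
  have "xs = rotate r (map (\<lambda>i. iarc (arc_of dat i)) c)" by (subst xt) (simp add: c(2) rotate_map)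
  then have "C = {rotate n (map (\<lambda>i. iarc (arc_of dat i)) c) | n. True}" unfolding C by (simp only: rotate_class)
  then show "C \<in> (\<lambda>c. {rotate n (map (\<lambda>i. iarc (arc_of dat i)) c) | n. True}) ` set cs" using c(1) by blast
qed

text \<open>An upper bound is enough: the general theorem supplies the matching lower bound for the
  examples.\<close>

lemma num_swirls_diagram_le:
  assumes "check_swirls dat cs"
  shows "num_swirls (diagram dat) \<le> length cs"
proof -
  have "num_swirls (diagram dat) \<le> card ((\<lambda>c. {rotate n (map (\<lambda>i. iarc (arc_of dat i)) c) | n. True}) ` set cs)"
    unfolding num_swirls_def using diagram_swirls[OF assms] by (intro card_mono) auto
  also have "\<dots> \<le> card (set cs)" by (rule card_image_le) simp
  also have "\<dots> \<le> length cs" by (rule card_length)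
  finally show ?thesis .
qed

end


section \<open>The two examples\<close>

text \<open>The configuration of the lower bound in its normal form, with \<open>U\<close>,
  \<open>V\<close>, \<open>p\<close> the coordinate vectors.\<close>

definition pole_list :: "ivec list" where
  "pole_list = [(0, 0, 1), (1, 0, 1), (-1, 0, 1), (0, 1, 1), (0, -1, 1)]"

definition eight_arcs :: "entry list" where
  "eight_arcs = [(((-2, 1, -5), (8, 3, -1)), (1, 0, 1), 3, 5),
    (((2, -1, -2), (-2, -1, 2)), (-1, 0, 1), 5, 6),
    (((-4, -1, -7), (3, -2, -3)), (1, 0, 1), 3, 1),
    (((-1, 3, -5), (-1, -3, 1)), (0, -1, 1), 4, 1),
    (((-1, 3, -10), (-1, 3, 7)), (0, 0, 1), 0, 7),
    (((4, -3, -5), (2, 1, 0)), (0, 1, 1), 2, 7),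
    (((-4, -7, -1), (-2, 6, 9)), (0, 1, 1), 3, 4),
    (((5, 2, -1), (-2, 1, 4)), (-1, 0, 1), 0, 6)]"

definition eight_seps :: "ivec list list" where
  "eight_seps = [[],
    [(0, -1, 0)],
    [(0, -1, 0), (-1, 0, -1)],
    [(2, -1, -1), (-1, 0, -1), (2, -1, -1)],
    [(-1, 3, 1), (0, -1, 0), (0, -1, 0), (-3, -1, 0)],
    [(-1, 2, -2), (1, -2, 2), (1, 3, -1), (-1, 0, 0), (-1, 0, 0)],
    [(-1, 0, 1), (3, -2, 2), (-1, 0, 1), (-2, 1, 1), (-3, -1, 0), (-1, 0, 0)],
    [(-1, 3, 1), (0, -1, 0), (0, -1, 0), (-1, 0, -1), (-1, 2, -1), (1, -2, 1), (3, -2, 2)]]"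

definition eight_swirls :: "nat list list" where
  "eight_swirls = [[0, 3, 4], [1, 6, 3], [0, 5, 7], [1, 5, 2], [4, 7, 6]]"

definition nine_arcs :: "entry list" where
  "nine_arcs = [(((-3, 2, -2), (3, 2, 4)), (1, 0, 1), 6, 7),
    (((1, -1, -6), (1, -1, 6)), (0, 0, 1), 8, 2),
    (((-4, -1, 1), (4, -1, 9)), (1, 0, 1), 6, 7),
    (((1, -2, -4), (-13, -4, 7)), (-1, 0, 1), 4, 2),
    (((1, -2, -7), (1, -2, 11)), (0, 0, 1), 8, 2),
    (((-1, -6, -8), (-1, 2, 0)), (0, 1, 1), 3, 0),
    (((-1, 1, -1), (-5, -2, 2)), (0, -1, 1), 5, 3),
    (((2, 7, -3), (1, -1, 3)), (0, -1, 1), 8, 1),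
    (((1, -8, -13), (1, 12, 7)), (0, 1, 1), 3, 0)]"

definition nine_seps :: "ivec list list" where
  "nine_seps = [[],
    [(0, -1, 0)],
    [(0, -1, 0), (8, -40, -8)],
    [(0, -1, 0), (-1, -1, 0), (8, -40, -8)],
    [(0, -1, 0), (-1, -1, 0), (8, -40, -8), (-2, -1, 0)],
    [(2, 1, -2), (-1, 0, 0), (0, 0, -1), (-2, 3, -2), (-1, 0, 0)],
    [(0, 1, 1), (-1, 0, 0), (0, 1, 1), (-2, 3, -2), (-1, 0, 0), (-2, -1, 1)],
    [(-2, 1, 1), (1, 1, 0), (-2, 1, 1), (-1, -1, 0), (-1, -1, 0), (-1, 0, 0), (-1, 0, 0)],
    [(2, 1, -2), (100, -20, 20), (0, -1, 1), (-2, 3, -2), (100, -20, 20), (-1, 0, 0), (-1, 0, 0), (100, -20, 20)]]"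

definition nine_swirls :: "nat list list" where
  "nine_swirls = [[0, 7, 8], [2, 6, 3], [0, 6, 5], [1, 2, 7], [3, 4, 8]]"

definition nine_sides :: "int list" where
  "nine_sides = [1, -1, -1, 1, 1, -1, 1, -1, 1]"


lemma eight_check:
  "check_diagram eight_arcs eight_seps pole_list" "check_swirls eight_arcs eight_swirls" "length eight_arcs = 8" "length eight_swirls = 5"
  by code_simp+

lemma nine_check:
  "check_diagram nine_arcs nine_seps pole_list" "check_swirls nine_arcs nine_swirls" "check_one_sided nine_arcs nine_sides"
  "length nine_arcs = 9" "length nine_swirls = 5"
  by code_simp+


lemma great_circle_sp_iff:
  assumes "icross p q \<noteq> (0, 0, 0)" "icross p r \<noteq> (0, 0, 0)"
  shows "great_circle_through (sp p) (sp q) = great_circle_through (sp p) (sp r) \<longleftrightarrow> idet p q r = 0"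
proof -
  have nz: "p \<noteq> (0, 0, 0)" "q \<noteq> (0, 0, 0)" "r \<noteq> (0, 0, 0)" using icross_nz assms by blast+
  obtain k where k: "k > 0" "det3 (sp p) (sp q) (sp r) = k * of_int (idet p q r)" using sp_det[OF nz] by blast
  have "sp q \<noteq> sp p" "sp q \<noteq> - sp p" "sp r \<noteq> sp p" "sp r \<noteq> - sp p"
    using sp_neq[OF assms(1)] sp_neq[OF assms(2)] by (metis minus_minus)+
  then have "great_circle_through (sp p) (sp q) = great_circle_through (sp p) (sp r) \<longleftrightarrow> det3 (sp p) (sp q) (sp r) = 0"
    using nz by (intro great_circle_eq_iff) (simp_all add: on_sphere_def norm_sp)
  then show ?thesis using k by simp
qed

lemma sp_pole_list:
  "distinct (map sp pole_list)" "p \<in> set pole_list \<Longrightarrow> p \<noteq> (0, 0, 0)"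
  "p \<in> set pole_list \<Longrightarrow> q \<in> set pole_list \<Longrightarrow> sp q \<noteq> - sp p"
proof -
  show "distinct (map sp pole_list)" by (simp add: pole_list_def sp_neq)
  show nz: "p \<noteq> (0, 0, 0)" if "p \<in> set pole_list" for p using that by (auto simp: pole_list_def)
  show "sp q \<noteq> - sp p" if "p \<in> set pole_list" "q \<in> set pole_list"
  proof (cases "p = q")
    case True
    have "sp p \<noteq> 0" using norm_sp[OF nz[OF that(1)]] by auto
    then have "sp p + sp p \<noteq> 0" by (simp flip: scaleR_2)
    then show ?thesis using True by (auto simp: eq_neg_iff_add_eq_0)
  next
    case False
    then have "icross q p \<noteq> (0, 0, 0)" using that by (auto simp: pole_list_def)
    then show ?thesis by (rule sp_neq)
  qed
qed

lemma alignment_pole_list: "alignment (sp ` set pole_list) = {#2, 3, 3, 3, 3#}"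
  by (simp add: alignment_def align_deg_def pole_list_def insert_Diff_if sp_neq card_insert_if great_circle_sp_iff idet_def numeral_eq_Suc)

theorem mainTheorem5:
  shows "(\<forall>D P f. is_SD D \<and> oriented 5 D P f \<and> alignment P = {#2, 3, 3, 3, 3#}
              \<longrightarrow> num_swirls D \<ge> 5)
       \<and> (\<exists>D P f. is_SD D \<and> oriented 5 D P f \<and> alignment P = {#2, 3, 3, 3, 3#}
              \<and> num_swirls D = 5 \<and> card D = 8)
       \<and> (\<exists>D P f. is_SOD D \<and> oriented 5 D P f \<and> alignment P = {#2, 3, 3, 3, 3#}
              \<and> num_swirls D = 5 \<and> card D = 9)"
proof (intro conjI)
  show "\<forall>D P f. is_SD D \<and> oriented 5 D P f \<and> alignment P = {#2, 3, 3, 3, 3#} \<longrightarrow> num_swirls D \<ge> 5"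
    using at_least_five_swirls by blast
  have len: "length pole_list = 5" by (simp add: pole_list_def)
  note alg = alignment_pole_list
  show "\<exists>D P f. is_SD D \<and> oriented 5 D P f \<and> alignment P = {#2, 3, 3, 3, 3#} \<and> num_swirls D = 5 \<and> card D = 8"
  proof -
    have D: "is_SD (diagram eight_arcs)" by (rule diagram_SD[OF eight_check(1)])
    obtain f where f: "oriented 5 (diagram eight_arcs) (sp ` set pole_list) f"
      using diagram_oriented[OF eight_check(1) sp_pole_list] len by auto
    have "num_swirls (diagram eight_arcs) = 5"
      using at_least_five_swirls[OF D f alg] num_swirls_diagram_le[OF eight_check(1,2)] eight_check(4) by simp
    moreover have "card (diagram eight_arcs) = 8" using card_diagram[OF eight_check(1)] eight_check(3) by simp
    ultimately show ?thesis using D f alg by blast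
  qed
  show "\<exists>D P f. is_SOD D \<and> oriented 5 D P f \<and> alignment P = {#2, 3, 3, 3, 3#} \<and> num_swirls D = 5 \<and> card D = 9"
  proof -
    have D: "is_SOD (diagram nine_arcs)" by (rule diagram_SOD[OF nine_check(1,3)])
    have D': "is_SD (diagram nine_arcs)" by (rule diagram_SD[OF nine_check(1)])
    obtain f where f: "oriented 5 (diagram nine_arcs) (sp ` set pole_list) f"
      using diagram_oriented[OF nine_check(1) sp_pole_list] len by auto
    have "num_swirls (diagram nine_arcs) = 5"
      using at_least_five_swirls[OF D' f alg] num_swirls_diagram_le[OF nine_check(1,2)] nine_check(5) by simp
    moreover have "card (diagram nine_arcs) = 9" using card_diagram[OF nine_check(1)] nine_check(4) by simp
    ultimately show ?thesis using D f alg by blast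
  qed
qed

end
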